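(* Let $G$ be a finite simple group, and let $G\le S_n$ be a faithful permutation representation of $G$ of minimum degree $n$. Then for all integers $k,d\ge 1$, \[ \mathcal L^{G^{k-1}}_{\mathsf{TC}}(\textsc{Word}_{G,k})\ \ge\ n^{\log_2 k},\qquad \mathcal L^{G^{k-1}}_{\mathsf{TC}_d}(\textsc{Word}_{G,k})\ \ge\ n^{d(k^{1/d}-1)}. \]
   Context: Word problem. For a permutation group $G\le S_n$, let $\overline G$ be the set of $n\times n$ permutation matrices of elements of $G$. View $\overline G^k$ as a subset of $\{0,1\}^{kn^2}$, with Boolean variables $M_{i,a,b}$ ($i\in[k]$, $a,b\in[n]$) giving entry $(a,b)$ of the $i$-th matrix. $\textsc{Word}_{G,k}:\overline G^k\to\{0,1\}$ outputs the $(1,1)$-entry of $M_1\cdots M_k$. The group $G^{k-1}$ acts faithfully on the variables by $(g_1,\dots,g_{k-1})\cdot M_{i,a,b}=M_{i,g_{i-1}(a),g_i(b)}$ with $g_0=g_k=1$; this corresponds to $(M_1,\dots,M_k)\mapsto(M_1\overline{g_1}^{-1},\overline{g_1}M_2\overline{g_2}^{-1},\dots,\overline{g_{k-1}}M_k)$. Thus $G^{k-1}\le S_{kn^2}$. Formulas. A $\mathsf{TC}$ formula over $x_1,\dots,x_m$ is a finite rooted tree with unordered children. Leaves are labeled by $0,1,x_i,\neg x_i$, and internal gates are unbounded fan-in $\textsc{maj}$ (majority) gates. Formulas are taken up to labeled-tree isomorphism. Depth is the maximum number of gates on a root-leaf path; size is the number of literal-labeled leaves. $S_m$ acts by relabeling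 indices of literals. For $P\le S_m$, $\Phi$ is $P$-invariant if $\pi\Phi=\Phi$ for all $\pi\in P$. A formula computes a partial function on $\Omega\subseteq\{0,1\}^m$ if it agrees with it on $\Omega$. $\mathcal L^P_{\mathsf{TC}_d}(f)$ (resp. $\mathcal L^P_{\mathsf{TC}}(f)$) is the minimum size of a $P$-invariant $\mathsf{TC}$ formula of depth at most $d$ (resp. unrestricted depth) computing $f$. *)

theory Defs
  imports Complex_Main "HOL-Library.Multiset" "HOL-Algebra.Sym_Groups" "HOL-Algebra.SimpleGroups"
begin

text \<open>A TC formula over variables of type 'v: a finite rooted tree with unordered children
  (children form a multiset, so formulas are identified up to labeled-tree isomorphism).
  Leaves: constants 0/1 (TConst), literals (TLit v True = x_v, TLit v False = not x_v).
  Internal gates: unbounded fan-in majority gates.\<close>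

datatype 'v tc = TConst bool | TLit 'v bool | TMaj "'v tc multiset"

primrec tc_eval :: "('v \<Rightarrow> bool) \<Rightarrow> 'v tc \<Rightarrow> bool" where
  "tc_eval x (TConst c) = c"
| "tc_eval x (TLit v p) = (x v = p)"
| "tc_eval x (TMaj cs) =
     (2 * size (filter_mset (\<lambda>b. b) (image_mset (tc_eval x) cs)) > size cs)"

primrec tc_size :: "'v tc \<Rightarrow> nat" where
  "tc_size (TConst c) = 0"
| "tc_size (TLit v p) = 1"
| "tc_size (TMaj cs) = sum_mset (image_mset tc_size cs)"

primrec tc_depth :: "'v tc \<Rightarrow> nat" where
  "tc_depth (TConst c) = 0"
| "tc_depth (TLit v p) = 0"
| "tc_depth (TMaj cs) = 1 + Max (insert 0 (set_mset (image_mset tc_depth cs)))"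

definition tc_invariant :: "('v \<Rightarrow> 'v) set \<Rightarrow> 'v tc \<Rightarrow> bool" where
  "tc_invariant P \<Phi> \<longleftrightarrow> (\<forall>\<pi>\<in>P. map_tc \<pi> \<Phi> = \<Phi>)"

definition tc_computes :: "'v tc \<Rightarrow> ('v \<Rightarrow> bool) set \<Rightarrow> (('v \<Rightarrow> bool) \<Rightarrow> bool) \<Rightarrow> bool" where
  "tc_computes \<Phi> \<Omega> f \<longleftrightarrow> (\<forall>x\<in>\<Omega>. tc_eval x \<Phi> = f x)"

text \<open>Variables M_{i,a,b} are triples (i,a,b) with i in [k], a,b in [n].\<close>
definition word_vars :: "nat \<Rightarrow> nat \<Rightarrow> (nat \<times> nat \<times> nat) set" where
  "word_vars n k = {1..k} \<times> {1..n} \<times> {1..n}"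

definition perm_matrix :: "nat \<Rightarrow> (nat \<Rightarrow> nat) \<Rightarrow> nat \<Rightarrow> nat \<Rightarrow> bool" where
  "perm_matrix n g a b \<longleftrightarrow> (g a = b)"

text \<open>The domain \<open>G\<close>-bar^k, as assignments to the k n^2 variables (the value at any
  triple outside word_vars is irrelevant for formulas over word_vars; we fix it to False).\<close>
definition word_domain :: "nat \<Rightarrow> (nat \<Rightarrow> nat) set \<Rightarrow> nat \<Rightarrow> (nat \<times> nat \<times> nat \<Rightarrow> bool) set" where
  "word_domain n G k = {x. (\<forall>i\<in>{1..k}. \<exists>g\<in>G. \<forall>a\<in>{1..n}. \<forall>b\<in>{1..n}. x (i,a,b) = perm_matrix n g a b)
                         \<and> (\<forall>v. v \<notin> word_vars n k \<longrightarrow> x v = False)}"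

definition mat_of :: "(nat \<times> nat \<times> nat \<Rightarrow> bool) \<Rightarrow> nat \<Rightarrow> nat \<Rightarrow> nat \<Rightarrow> nat" where
  "mat_of x i a b = (if x (i,a,b) then 1 else 0)"

primrec mat_prefix :: "nat \<Rightarrow> (nat \<times> nat \<times> nat \<Rightarrow> bool) \<Rightarrow> nat \<Rightarrow> nat \<Rightarrow> nat \<Rightarrow> nat" where
  "mat_prefix n x 0 a c = (if a = c then 1 else 0)"
| "mat_prefix n x (Suc j) a c = (\<Sum>b\<in>{1..n}. mat_prefix n x j a b * mat_of x (Suc j) b c)"

definition word_fun :: "nat \<Rightarrow> nat \<Rightarrow> (nat \<times> nat \<times> nat \<Rightarrow> bool) \<Rightarrow> bool" where
  "word_fun n k x \<longleftrightarrow> mat_prefix n x k 1 1 = 1"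

text \<open>The action of (g_1,...,g_{k-1}) in G^{k-1} on the variables:
  M_{i,a,b} \<mapsto> M_{i,g_{i-1}(a),g_i(b)}, with g_0 = g_k = 1.  Triples outside word_vars are fixed.\<close>
definition word_perm :: "nat \<Rightarrow> nat \<Rightarrow> (nat \<Rightarrow> nat \<Rightarrow> nat) \<Rightarrow> (nat \<times> nat \<times> nat \<Rightarrow> nat \<times> nat \<times> nat)" where
  "word_perm n k gs = (\<lambda>(i,a,b).
      let g' = (\<lambda>j. if 1 \<le> j \<and> j \<le> k - 1 then gs j else id) in
      if (i,a,b) \<in> word_vars n k then (i, g' (i - 1) a, g' i b) else (i,a,b))"

definition word_group :: "nat \<Rightarrow> (nat \<Rightarrow> nat) set \<Rightarrow> nat \<Rightarrow> (nat \<times> nat \<times> nat \<Rightarrow> nat \<times> nat \<times> nat) set" where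
  "word_group n G k = {word_perm n k gs | gs. \<forall>j\<in>{1..k-1}. gs j \<in> G}"

definition perm_grp :: "nat \<Rightarrow> (nat \<Rightarrow> nat) set \<Rightarrow> (nat \<Rightarrow> nat) monoid" where
  "perm_grp n G = (sym_group n) \<lparr> carrier := G \<rparr>"

definition min_faithful_degree :: "nat \<Rightarrow> (nat \<Rightarrow> nat) set \<Rightarrow> bool" where
  "min_faithful_degree n G \<longleftrightarrow>
     (\<forall>m h. h \<in> hom (perm_grp n G) (sym_group m) \<and> inj_on h G \<longrightarrow> n \<le> m)"

end

theory Submission
  imports Defs "HOL-Algebra.Sylow" "HOL-Algebra.Left_Coset"
begin

text \<open>
  An input is a labelling \<open>M\<close> of the edges of a path with \<open>k\<close> edges by elements of \<open>G\<close>, and the symmetry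
  group acts by gauge transformations at the \<open>k - 1\<close> inner vertices. Follow an invariant formula from
  its root to a leaf: at a majority gate invariant under \<open>U\<close>, averaging over \<open>U\<close> produces a child that
  still separates two given inputs up to gauge, and if the stabilizer \<open>H\<close> of that child has index at least
  \<open>n^t\<close> in \<open>U\<close>, the gate costs a factor \<open>n^t\<close> in size. The point is that the number of coordinates one
  must inspect to tell the two inputs apart modulo the current group drops from \<open>k\<close> to no less than
  \<open>k / (t + 1)\<close>, while it is \<open>1\<close> at a literal; optimising over \<open>t\<close> yields both bounds.

  All proper subgroups of \<open>G\<close> have index at least \<open>n\<close>. If \<open>G\<close> is abelian, a greedy choice of coordinate
  sets works, since every strict inclusion of subgroups of a power of \<open>G\<close> has index at least \<open>n\<close>. If \<open>G\<close> is
  nonabelian, Goursat's lemma shows that \<open>H\<close> contains a twisted diagonal in which \<open>t\<close> vertices of the path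
  have been merged with each other or with the end points. The two inputs differ at a single
  oriented edge; such a change can be absorbed by a gauge transformation on any tree growing from
  the head of this edge, so it is visible only through a connected set of edges that closes a cycle
  or reaches an end point. The size of the smallest such set is the quantity that is tracked.
\<close>

section \<open>Subgroups of powers of a simple group\<close>

text \<open>The stabilizer of a child may be any subgroup. Replacing it by a smaller group is
  harmless: the child stays invariant, and the gate is charged for the index of the whole
  stabilizer. This freedom is why a twisted diagonal inside it is enough. For abelian
  \<open>G\<close> there need not be a large one: the triples \<open>(x, y, x y)\<close> form a
  subgroup that is no twisted diagonal. Hence two kinds of states behind one interface.

  The factor \<open>t + 1\<close> comes from counting cycles, with the root and the tail of the
  differing edge identified. Merging \<open>t\<close> classes creates at most \<open>t\<close>
  independent cycles. If every relevant edge had a witness with at most \<open>k' - 1\<close> edges,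
  \<open>t + 1\<close> of them could be glued into \<open>t + 1\<close> independent cycles with
  fewer than \<open>k\<close> edges in total, too few to contain a cycle of the unmerged graph.

  Along a branch with parameters \<open>t_1, ..., t_d\<close> the size is at least \<open>n\<close>
  to the power \<open>t_1 + ... + t_d\<close>, where the product of the \<open>t_i + 1\<close> is at
  least \<open>k\<close>. Without a depth limit, \<open>t + 1 <= 2^t\<close> bounds the sum below by
  the binary logarithm of \<open>k\<close>; for fixed \<open>d\<close> the sum is least when all
  factors equal the \<open>d\<close>-th root of \<open>k\<close>.\<close>

definition tuple_group :: "('a, 'b) monoid_scheme \<Rightarrow> nat \<Rightarrow> (nat \<Rightarrow> 'a) monoid" where
  "tuple_group G m =
     \<lparr>carrier = {w. (\<forall>j\<in>{1..m}. w j \<in> carrier G) \<and> (\<forall>j. j \<notin> {1..m} \<longrightarrow> w j = \<one>\<^bsub>G\<^esub>)},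
      mult = (\<lambda>u v j. u j \<otimes>\<^bsub>G\<^esub> v j), one = (\<lambda>j. \<one>\<^bsub>G\<^esub>)\<rparr>"

text \<open>Coordinates of one class carry the same element up to automorphisms. Class
  \<open>0\<close> reads \<open>w 0\<close>, which is the unit for every member of a tuple group, so
  trivial coordinates need no case of their own.\<close>

definition diag_tuple ::
  "('a, 'b) monoid_scheme \<Rightarrow> nat \<Rightarrow> (nat \<Rightarrow> nat) \<Rightarrow> (nat \<Rightarrow> 'a \<Rightarrow> 'a) \<Rightarrow> (nat \<Rightarrow> 'a) \<Rightarrow> nat \<Rightarrow> 'a" where
  "diag_tuple G m c \<tau> w = (\<lambda>j. if j \<in> {1..m} then \<tau> j (w (c j)) else \<one>\<^bsub>G\<^esub>)"

lemma mult_tuple_group [simp]: "mult (tuple_group G m) = (\<lambda>u v j. u j \<otimes>\<^bsub>G\<^esub> v j)"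
  and one_tuple_group [simp]: "one (tuple_group G m) = (\<lambda>j. \<one>\<^bsub>G\<^esub>)"
  by (simp_all add: tuple_group_def)

context group
begin

lemma mem_tuple_group:
  "w \<in> carrier (tuple_group G m) \<longleftrightarrow> (\<forall>j. w j \<in> carrier G) \<and> (\<forall>j. j \<notin> {1..m} \<longrightarrow> w j = \<one>)"
  unfolding tuple_group_def by auto

lemma tuple_closed: "w \<in> carrier (tuple_group G m) \<Longrightarrow> w j \<in> carrier G"
  by (simp add: mem_tuple_group)

lemma group_tuple_group: "group (tuple_group G m)"
proof (rule groupI)
  fix x assume x: "x \<in> carrier (tuple_group G m)"
  show "\<exists>y\<in>carrier (tuple_group G m). y \<otimes>\<^bsub>tuple_group G m\<^esub> x = \<one>\<^bsub>tuple_group G m\<^esub>"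
    using x by (intro bexI[of _ "\<lambda>j. inv (x j)"]) (auto simp: mem_tuple_group)
qed (auto simp: mem_tuple_group m_assoc)

lemma inv_tuple_group:
  assumes "x \<in> carrier (tuple_group G m)"
  shows "inv\<^bsub>tuple_group G m\<^esub> x = (\<lambda>j. inv (x j))"
proof -
  interpret T: group "tuple_group G m" by (rule group_tuple_group)
  show ?thesis using assms
    by (intro T.inv_equality) (auto simp: mem_tuple_group)
qed

lemma subgroup_tupleD:
  assumes "subgroup H (tuple_group G m)"
  shows "u \<in> H \<Longrightarrow> u \<in> carrier (tuple_group G m)"
    and "(\<lambda>j. \<one>) \<in> H"
    and "u \<in> H \<Longrightarrow> v \<in> H \<Longrightarrow> (\<lambda>j. u j \<otimes> v j) \<in> H"
    and "u \<in> H \<Longrightarrow> (\<lambda>j. inv (u j)) \<in> H"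
proof -
  show "u \<in> H \<Longrightarrow> u \<in> carrier (tuple_group G m)" using subgroup.subset[OF assms] by auto
  show "(\<lambda>j. \<one>) \<in> H" using subgroup.one_closed[OF assms] by simp
  show "u \<in> H \<Longrightarrow> v \<in> H \<Longrightarrow> (\<lambda>j. u j \<otimes> v j) \<in> H" using subgroup.m_closed[OF assms, of u v] by simp
  show "u \<in> H \<Longrightarrow> (\<lambda>j. inv (u j)) \<in> H"
    using subgroup.m_inv_closed[OF assms, of u] subgroup.subset[OF assms] inv_tuple_group by auto
qed

lemma subgroup_tupleI:
  assumes "H \<subseteq> carrier (tuple_group G m)" "(\<lambda>j. \<one>) \<in> H"
    "\<And>u v. u \<in> H \<Longrightarrow> v \<in> H \<Longrightarrow> (\<lambda>j. u j \<otimes> v j) \<in> H" "\<And>u. u \<in> H \<Longrightarrow> (\<lambda>j. inv (u j)) \<in> H"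
  shows "subgroup H (tuple_group G m)"
  using assms inv_tuple_group by unfold_locales (auto simp: subset_iff)

lemma tuple_Suc_decomp:
  assumes "w \<in> carrier (tuple_group G (Suc m))"
  shows "w(Suc m := \<one>) \<in> carrier (tuple_group G m)"
  using assms by (auto simp: mem_tuple_group)

lemma card_tuple_group:
  assumes "finite (carrier G)"
  shows "finite (carrier (tuple_group G m)) \<and> card (carrier (tuple_group G m)) = card (carrier G) ^ m"
proof (induction m)
  case 0
  have "carrier (tuple_group G 0) = {\<lambda>j. \<one>}" by (auto simp: tuple_group_def)
  then show ?case by simp
next
  case (Suc m)
  have b: "bij_betw (\<lambda>(w, g). w(Suc m := g)) (carrier (tuple_group G m) \<times> carrier G)
      (carrier (tuple_group G (Suc m)))"
  proof (rule bij_betw_byWitness[where f' = "\<lambda>w. (w(Suc m := \<one>), w (Suc m))"])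
    show "\<forall>a\<in>carrier (tuple_group G m) \<times> carrier G.
       (\<lambda>w. (w(Suc m := \<one>), w (Suc m))) ((\<lambda>(w, g). w(Suc m := g)) a) = a"
      by (auto simp: mem_tuple_group fun_eq_iff)
  qed (auto simp: mem_tuple_group)
  show ?case
    using bij_betw_same_card[OF b] bij_betw_finite[OF b] Suc assms
    by (simp add: card_cartesian_product mult.commute)
qed

text \<open>A power is generated by the tuples with one nontrivial coordinate: the truncations of
  \<open>w\<close> arise by multiplying in one coordinate at a time. Membership of a whole diagonal
  in a subgroup thus has to be checked for one class at a time.\<close>

lemma tuple_induct:
  assumes w: "w \<in> carrier (tuple_group G m)"
    and one: "P (\<lambda>j. \<one>)"
    and single: "\<And>b h. b \<in> {1..m} \<Longrightarrow> h \<in> carrier G \<Longrightarrow> P ((\<lambda>j. \<one>)(b := h))"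
    and mult: "\<And>u v. u \<in> carrier (tuple_group G m) \<Longrightarrow> v \<in> carrier (tuple_group G m) \<Longrightarrow>
                 P u \<Longrightarrow> P v \<Longrightarrow> P (\<lambda>j. u j \<otimes> v j)"
  shows "P w"
proof -
  have "r \<le> m \<Longrightarrow> P (\<lambda>j. if j \<le> r then w j else \<one>)" for r
  proof (induction r)
    case 0
    have "(\<lambda>j. if j \<le> 0 then w j else \<one>) = (\<lambda>j. \<one>)"
      using w by (auto simp: mem_tuple_group fun_eq_iff)
    then show ?case using one by simp
  next
    case (Suc r)
    have "P (\<lambda>j. (if j \<le> r then w j else \<one>) \<otimes> ((\<lambda>j. \<one>)(Suc r := w (Suc r))) j)"
      using Suc w by (intro mult single) (auto simp: mem_tuple_group)
    moreover have "(\<lambda>j. (if j \<le> r then w j else \<one>) \<otimes> ((\<lambda>j. \<one>)(Suc r := w (Suc r))) j)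
        = (\<lambda>j. if j \<le> Suc r then w j else \<one>)"
      using w by (auto simp: mem_tuple_group fun_eq_iff le_Suc_eq)
    ultimately show ?case by simp
  qed
  from this[of m] have "P (\<lambda>j. if j \<le> m then w j else \<one>)" by simp
  moreover have "(\<lambda>j. if j \<le> m then w j else \<one>) = w"
    using w by (auto simp: mem_tuple_group fun_eq_iff)
  ultimately show ?thesis by simp
qed

lemma diag_tuple_closed:
  assumes "\<And>j. \<tau> j \<in> iso G G" "w \<in> carrier (tuple_group G m')"
  shows "diag_tuple G m c \<tau> w \<in> carrier (tuple_group G m)"
proof -
  have "\<tau> j (w i) \<in> carrier G" for i j
    using assms(1)[of j] tuple_closed[OF assms(2), of i] by (auto simp: iso_def hom_def)
  then show ?thesis by (auto simp: mem_tuple_group diag_tuple_def)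
qed

lemma diag_tuple_mult:
  assumes "\<And>j. \<tau> j \<in> iso G G" "u \<in> carrier (tuple_group G m')" "v \<in> carrier (tuple_group G m')"
  shows "diag_tuple G m c \<tau> (\<lambda>j. u j \<otimes> v j)
       = (\<lambda>j. diag_tuple G m c \<tau> u j \<otimes> diag_tuple G m c \<tau> v j)"
  using assms tuple_closed[OF assms(2)] tuple_closed[OF assms(3)]
  by (auto simp: diag_tuple_def iso_def hom_def fun_eq_iff)

lemma iso_one: "f \<in> iso G G \<Longrightarrow> f \<one> = \<one>"
  using hom_one[of f G G] group_axioms by (auto simp: iso_def is_group)

lemma diag_tuple_one:
  assumes "\<And>j. \<tau> j \<in> iso G G"
  shows "diag_tuple G m c \<tau> (\<lambda>j. \<one>) = (\<lambda>j. \<one>)"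
  using iso_one[OF assms] by (auto simp: diag_tuple_def fun_eq_iff)

lemma diag_tuple_inv:
  assumes "\<And>j. \<tau> j \<in> iso G G" "w \<in> carrier (tuple_group G m')"
  shows "diag_tuple G m c \<tau> (\<lambda>j. inv (w j)) = (\<lambda>j. inv (diag_tuple G m c \<tau> w j))"
proof -
  have "\<tau> j (inv (w i)) = inv (\<tau> j (w i))" for i j
  proof -
    interpret h: group_hom G G "\<tau> j"
      using assms(1)[of j] by unfold_locales (auto simp: iso_def)
    show ?thesis using tuple_closed[OF assms(2)] by simp
  qed
  then show ?thesis by (auto simp: diag_tuple_def fun_eq_iff)
qed

end

text \<open>The index bound is how minimality of the degree enters the group theory: for simple
  \<open>G\<close> the action on the cosets of a proper subgroup is faithful.\<close>

locale index_bounded_group = group +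
  fixes n :: nat
  assumes degree_ge_2: "2 \<le> n"
    and finite_carrier: "finite (carrier G)"
    and index_bound: "\<And>L. subgroup L G \<Longrightarrow> L \<noteq> carrier G \<Longrightarrow> card L * n \<le> card (carrier G)"

locale nonabelian_simple_group = index_bounded_group + simple_group +
  assumes not_comm: "\<exists>x\<in>carrier G. \<exists>y\<in>carrier G. x \<otimes> y \<noteq> y \<otimes> x"

section \<open>Relations with constant fibres and Goursat's lemma by counting\<close>

context group
begin

text \<open>The fibre over each \<open>a\<close> is a left coset of \<open>L\<close>, so a choice of
  one point \<open>s a\<close> in every fibre identifies \<open>R\<close> with \<open>A\<close>
  times \<open>L\<close>.\<close>

lemma card_relation_factor:
  assumes "finite (carrier G)" "R \<subseteq> A \<times> carrier G" "finite A"
    and dom: "\<And>a. a \<in> A \<Longrightarrow> \<exists>g. (a, g) \<in> R"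
    and L: "L \<subseteq> carrier G"
    and fib: "\<And>a g h. (a, g) \<in> R \<Longrightarrow> h \<in> carrier G \<Longrightarrow> (a, g \<otimes> h) \<in> R \<longleftrightarrow> h \<in> L"
  shows "card R = card A * card L"
proof -
  obtain s where s: "\<And>a. a \<in> A \<Longrightarrow> (a, s a) \<in> R" using dom by metis
  have sc: "s a \<in> carrier G" if "a \<in> A" for a using s[OF that] assms(2) by auto
  have "bij_betw (\<lambda>(a, h). (a, s a \<otimes> h)) (A \<times> L) R"
  proof (rule bij_betw_byWitness[where f' = "\<lambda>(a, g). (a, inv (s a) \<otimes> g)"])
    show "\<forall>a\<in>A \<times> L. (\<lambda>(a, g). (a, inv (s a) \<otimes> g)) ((\<lambda>(a, h). (a, s a \<otimes> h)) a) = a"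
      using sc L by (auto simp: m_assoc[symmetric])
    show "\<forall>a'\<in>R. (\<lambda>(a, h). (a, s a \<otimes> h)) ((\<lambda>(a, g). (a, inv (s a) \<otimes> g)) a') = a'"
      using sc assms(2) by (auto simp: m_assoc[symmetric])
    show "(\<lambda>(a, h). (a, s a \<otimes> h)) ` (A \<times> L) \<subseteq> R"
      using fib s L by auto
    show "(\<lambda>(a, g). (a, inv (s a) \<otimes> g)) ` R \<subseteq> A \<times> L"
    proof clarsimp
      fix a g assume r: "(a, g) \<in> R"
      then have a: "a \<in> A" "g \<in> carrier G" using assms(2) by auto
      have "s a \<otimes> (inv (s a) \<otimes> g) = g" using a sc by (simp add: m_assoc[symmetric])
      then show "a \<in> A \<and> inv (s a) \<otimes> g \<in> L" using fib[OF s[OF a(1)], of "inv (s a) \<otimes> g"] r a sc by auto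
    qed
  qed
  from bij_betw_same_card[OF this] show ?thesis by (simp add: card_cartesian_product)
qed

end

context nonabelian_simple_group
begin

text \<open>Since \<open>R\<close> projects onto the first factor, every \<open>x\<close> lifts to
  some \<open>(x, g)\<close> in \<open>R\<close>, and conjugation by it shows that \<open>N\<close>
  is normal. Simplicity and \<open>nontriv\<close> make \<open>N\<close> trivial, so the second
  projection is injective. Comparing \<open>card R\<close> with the order of \<open>G\<close> then
  forces \<open>L\<close> to be trivial and the second projection to be onto.\<close>

lemma graph_of_automorphism:
  assumes R: "R \<subseteq> carrier G \<times> carrier G"
    and mult: "\<And>a g b h. (a, g) \<in> R \<Longrightarrow> (b, h) \<in> R \<Longrightarrow> (a \<otimes> b, g \<otimes> h) \<in> R"
    and inv: "\<And>a g. (a, g) \<in> R \<Longrightarrow> (inv a, inv g) \<in> R"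
    and dom: "\<And>a. a \<in> carrier G \<Longrightarrow> \<exists>g. (a, g) \<in> R"
    and nontriv: "h \<in> carrier G" "(h, \<one>) \<notin> R"
  shows "\<exists>\<theta>\<in>iso G G. R = {(a, \<theta> a) |a. a \<in> carrier G}"
proof -
  have one: "(\<one>, \<one>) \<in> R"
    using dom[of \<one>] mult inv R by (metis SigmaD2 inv_one one_closed r_inv r_one subsetD)
  define N where "N = {a \<in> carrier G. (a, \<one>) \<in> R}"
  define L where "L = {g \<in> carrier G. (\<one>, g) \<in> R}"
  have "N \<lhd> G"
  proof (rule normal_invI)
    show "subgroup N G"
      using one mult[where g = \<one> and h = \<one>] inv[where g = \<one>] by unfold_locales (auto simp: N_def)
    fix x a assume x: "x \<in> carrier G" "a \<in> N"
    obtain g where g: "(x, g) \<in> R" using dom x by auto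
    then have "g \<in> carrier G" using R by auto
    have "(x \<otimes> a \<otimes> inv x, g \<otimes> \<one> \<otimes> inv g) \<in> R" using x g by (intro mult inv) (auto simp: N_def)
    then show "x \<otimes> a \<otimes> inv x \<in> N" using x \<open>g \<in> carrier G\<close> by (auto simp: N_def)
  qed
  moreover have "N \<noteq> carrier G" using nontriv by (auto simp: N_def)
  ultimately have N: "N = {\<one>}" using no_real_normal_subgroup by auto
  have finR: "finite R" using R finite_carrier by (meson finite_SigmaI finite_subset)
  have cR: "card R = card (carrier G) * card L"
  proof (rule card_relation_factor)
    fix a g x assume r: "(a, g) \<in> R" "x \<in> carrier G"
    then have c: "a \<in> carrier G" "g \<in> carrier G" using R by auto
    show "((a, g \<otimes> x) \<in> R) = (x \<in> L)"
    proof
      assume "(a, g \<otimes> x) \<in> R"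
      from mult[OF inv[OF r(1)] this] c r(2) show "x \<in> L" by (simp add: L_def m_assoc[symmetric])
    next
      assume "x \<in> L"
      then have "(\<one>, x) \<in> R" by (simp add: L_def)
      from mult[OF r(1) this] c show "(a, g \<otimes> x) \<in> R" by simp
    qed
  qed (use finite_carrier R dom in \<open>auto simp: L_def\<close>)
  have inj: "inj_on snd R"
  proof (rule inj_onI, clarsimp)
    fix a b g assume r: "(a, g) \<in> R" "(b, g) \<in> R"
    then have c: "a \<in> carrier G" "b \<in> carrier G" "g \<in> carrier G" using R by auto
    from mult[OF inv[OF r(1)] r(2)] c have "inv a \<otimes> b \<in> N" by (simp add: N_def)
    with N have "inv a \<otimes> b = \<one>" by simp
    then show "a = b" using c by (metis inv_equality inv_inv inv_closed)
  qed
  have "card R \<le> card (carrier G)"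
  proof -
    have "snd ` R \<subseteq> carrier G" using R by auto
    then show ?thesis using card_image[OF inj] card_mono[OF finite_carrier] by metis
  qed
  with cR have "card L \<le> 1" using order_gt_one by (simp add: order_def)
  moreover have "\<one> \<in> L" "finite L" using one finite_carrier by (auto simp: L_def)
  ultimately have L: "L = {\<one>}" using card_le_Suc0_iff_eq[of L] by auto
  with cR have "card (snd ` R) = card (carrier G)" using card_image[OF inj] by simp
  moreover have "snd ` R \<subseteq> carrier G" using R by auto
  ultimately have surj: "snd ` R = carrier G" using card_subset_eq[OF finite_carrier] by blast
  obtain \<theta> where \<theta>: "\<And>a. a \<in> carrier G \<Longrightarrow> (a, \<theta> a) \<in> R" using dom by metis
  have uniq: "g = \<theta> a" if "(a, g) \<in> R" for a g
  proof -
    have c: "a \<in> carrier G" "g \<in> carrier G" "\<theta> a \<in> carrier G" using that R \<theta> by auto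
    from mult[OF inv[OF that] \<theta>[OF c(1)]] c have "inv g \<otimes> \<theta> a \<in> L" by (simp add: L_def)
    with L have "inv g \<otimes> \<theta> a = \<one>" by simp
    then show ?thesis using c by (metis inv_equality inv_inv inv_closed)
  qed
  have RR: "R = {(a, \<theta> a) |a. a \<in> carrier G}" using \<theta> uniq R by auto
  have "\<theta> \<in> hom G G"
  proof (rule homI)
    show "\<theta> a \<in> carrier G" if "a \<in> carrier G" for a using R \<theta>[OF that] by auto
    show "\<theta> (a \<otimes> b) = \<theta> a \<otimes> \<theta> b" if "a \<in> carrier G" "b \<in> carrier G" for a b
      using uniq[OF mult[OF \<theta>[OF that(1)] \<theta>[OF that(2)]]] by simp
  qed
  moreover have "bij_betw \<theta> (carrier G) (carrier G)"
  proof (rule bij_betw_imageI)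
    show "inj_on \<theta> (carrier G)"
    proof (rule inj_onI)
      fix a b assume "a \<in> carrier G" "b \<in> carrier G" "\<theta> a = \<theta> b"
      then show "a = b" using inj_onD[OF inj, of "(a, \<theta> a)" "(b, \<theta> b)"] \<theta>[of a] \<theta>[of b] by simp
    qed
    show "\<theta> ` carrier G = carrier G" using surj by (auto simp: RR image_image setcompr_eq_image)
  qed
  ultimately show ?thesis using RR by (auto simp: iso_def)
qed

text \<open>Goursat's lemma for powers of a nonabelian simple group; class \<open>0\<close> marks the coordinates on
  which the twisted diagonal is trivial.\<close>

lemma twisted_diagonal_in_subgroup:
  assumes "subgroup H (tuple_group G m)"
  shows "\<exists>m' c \<tau>. m' \<le> m \<and> (\<forall>j. j \<notin> {1..m} \<longrightarrow> c j = 0) \<and> (\<forall>j. c j \<le> m') \<and> {1..m'} \<subseteq> c ` {1..m}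
    \<and> (\<forall>j. \<tau> j \<in> iso G G) \<and> (\<forall>w\<in>carrier (tuple_group G m'). diag_tuple G m c \<tau> w \<in> H)
    \<and> card H * n ^ (m - m') \<le> card (carrier G) ^ m"
  using assms
proof (induction m arbitrary: H)
  case 0
  have "carrier (tuple_group G 0) = {\<lambda>j. \<one>}" by (auto simp: tuple_group_def)
  then have "H = {\<lambda>j. \<one>}"
    using subgroup.subset[OF 0] subgroup_tupleD(2)[OF 0] by blast
  moreover have "diag_tuple G 0 c \<tau> w = (\<lambda>j. \<one>)" for c \<tau> w by (simp add: diag_tuple_def)
  ultimately show ?case
    by (intro exI[of _ 0] exI[of _ "\<lambda>_. 0"] exI[of _ "\<lambda>_ x. x"]) (simp add: iso_set_refl)
next
  case (Suc m)
  note HD = subgroup_tupleD[OF Suc.prems]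
  define p where "p = (\<lambda>w::nat\<Rightarrow>'a. w(Suc m := \<one>))"
  define K where "K = p ` H"
  define L where "L = {g \<in> carrier G. (\<lambda>j. \<one>)(Suc m := g) \<in> H}"
  have upd: "u(Suc m := g) \<in> H \<Longrightarrow> v(Suc m := h) \<in> H \<Longrightarrow> (\<lambda>j. u j \<otimes> v j)(Suc m := g \<otimes> h) \<in> H" for u v g h
  proof -
    assume a: "u(Suc m := g) \<in> H" "v(Suc m := h) \<in> H"
    have "(\<lambda>j. u j \<otimes> v j)(Suc m := g \<otimes> h) = (\<lambda>j. (u(Suc m := g)) j \<otimes> (v(Suc m := h)) j)"
      by (simp add: fun_eq_iff)
    then show ?thesis using HD(3)[OF a] by simp
  qed
  have updi: "u(Suc m := g) \<in> H \<Longrightarrow> (\<lambda>j. inv (u j))(Suc m := inv g) \<in> H" for u g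
  proof -
    assume a: "u(Suc m := g) \<in> H"
    have "(\<lambda>j. inv (u j))(Suc m := inv g) = (\<lambda>j. inv ((u(Suc m := g)) j))" by (simp add: fun_eq_iff)
    then show ?thesis using HD(4)[OF a] by simp
  qed
  have KD: "u \<in> K \<longleftrightarrow> u (Suc m) = \<one> \<and> (\<exists>g\<in>carrier G. u(Suc m := g) \<in> H)" for u
  proof
    assume "u \<in> K"
    then obtain w where "w \<in> H" "u = p w" by (auto simp: K_def)
    then show "u (Suc m) = \<one> \<and> (\<exists>g\<in>carrier G. u(Suc m := g) \<in> H)"
      using tuple_closed[OF HD(1)] by (auto simp: p_def intro!: bexI[of _ "w (Suc m)"])
  next
    assume u: "u (Suc m) = \<one> \<and> (\<exists>g\<in>carrier G. u(Suc m := g) \<in> H)"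
    then obtain g where "u(Suc m := g) \<in> H" by auto
    moreover have "p (u(Suc m := g)) = u" using u by (auto simp: p_def)
    ultimately show "u \<in> K" unfolding K_def by (metis imageI)
  qed
  have subK: "subgroup K (tuple_group G m)"
  proof (rule subgroup_tupleI)
    show "K \<subseteq> carrier (tuple_group G m)"
      using HD(1) tuple_Suc_decomp by (auto simp: K_def p_def)
    show "(\<lambda>j. \<one>) \<in> K" using HD(2) by (auto simp: KD fun_upd_idem intro!: bexI[of _ \<one>])
    show "(\<lambda>j. u j \<otimes> v j) \<in> K" if "u \<in> K" "v \<in> K" for u v
      using that upd by (fastforce simp: KD)
    show "(\<lambda>j. inv (u j)) \<in> K" if "u \<in> K" for u
      using that updi by (fastforce simp: KD)
  qed
  have subL: "subgroup L G"
  proof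
    show "L \<subseteq> carrier G" by (auto simp: L_def)
    show "\<one> \<in> L" using HD(2) by (auto simp: L_def fun_upd_idem)
    show "x \<otimes> y \<in> L" if "x \<in> L" "y \<in> L" for x y
      using that upd[of "\<lambda>_. \<one>" x "\<lambda>_. \<one>" y] by (auto simp: L_def)
    show "inv x \<in> L" if "x \<in> L" for x
      using that updi[of "\<lambda>_. \<one>" x] by (auto simp: L_def)
  qed
  have fin: "finite (carrier (tuple_group G m))" "card (carrier (tuple_group G m)) = card (carrier G) ^ m" for m
    using card_tuple_group[OF finite_carrier] by auto
  have finK: "finite K" using finite_subset[OF subgroup.subset[OF subK] fin(1)] .
  have KC: "K \<subseteq> carrier (tuple_group G m)" using subgroup.subset[OF subK] .
  have cardH: "card H = card K * card L"
  proof -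
    define R where "R = {(u, g). u \<in> K \<and> g \<in> carrier G \<and> u(Suc m := g) \<in> H}"
    have "card R = card K * card L"
    proof (rule card_relation_factor)
      fix u g h assume r: "(u, g) \<in> R" "h \<in> carrier G"
      then have uc: "\<And>j. u j \<in> carrier G" and gc: "g \<in> carrier G"
        using KC tuple_closed by (auto simp: R_def)
      show "((u, g \<otimes> h) \<in> R) = (h \<in> L)"
      proof
        assume "(u, g \<otimes> h) \<in> R"
        with r have "(\<lambda>j. inv (u j) \<otimes> u j)(Suc m := inv g \<otimes> (g \<otimes> h)) \<in> H"
          by (intro upd updi) (auto simp: R_def)
        then show "h \<in> L" using uc gc r by (simp add: L_def m_assoc[symmetric])
      next
        assume "h \<in> L"
        with r have "(\<lambda>j. u j \<otimes> \<one>)(Suc m := g \<otimes> h) \<in> H"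
          by (intro upd) (auto simp: R_def L_def)
        then show "(u, g \<otimes> h) \<in> R" using uc gc r by (simp add: R_def)
      qed
    qed (use finite_carrier finK KD in \<open>auto simp: R_def L_def\<close>)
    moreover have "bij_betw (\<lambda>(u, g). u(Suc m := g)) R H"
    proof (rule bij_betw_byWitness[where f' = "\<lambda>w. (p w, w (Suc m))"])
      show "\<forall>a\<in>R. (p ((\<lambda>(u, g). u(Suc m := g)) a), (\<lambda>(u, g). u(Suc m := g)) a (Suc m)) = a"
        using KD by (auto simp: R_def p_def fun_eq_iff)
      show "(\<lambda>w. (p w, w (Suc m))) ` H \<subseteq> R"
        using tuple_closed[OF HD(1)] by (auto simp: R_def K_def p_def)
    qed (auto simp: R_def p_def)
    ultimately show ?thesis using bij_betw_same_card by metis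
  qed
  obtain m' c \<tau> where ih: "m' \<le> m" "\<And>j. j \<notin> {1..m} \<Longrightarrow> c j = 0" "\<And>j. c j \<le> m'" "{1..m'} \<subseteq> c ` {1..m}"
    "\<And>j. \<tau> j \<in> iso G G" "\<And>w. w \<in> carrier (tuple_group G m') \<Longrightarrow> diag_tuple G m c \<tau> w \<in> K"
    "card K * n ^ (m - m') \<le> card (carrier G) ^ m"
    using Suc.IH[OF subK] by blast
  let ?d = "diag_tuple G m c \<tau>"
  have ds: "?d w (Suc m) = \<one>" for w by (simp add: diag_tuple_def)
  have dc: "?d w j \<in> carrier G" if "w \<in> carrier (tuple_group G m')" for w j
    using tuple_closed[OF diag_tuple_closed[of \<tau>, OF ih(5) that]] .
  have dmult: "?d (\<lambda>j. u j \<otimes> v j) = (\<lambda>j. ?d u j \<otimes> ?d v j)"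
    if "u \<in> carrier (tuple_group G m')" "v \<in> carrier (tuple_group G m')" for u v
    using diag_tuple_mult[OF ih(5) that] .
  have ext: "\<exists>g\<in>carrier G. (?d w)(Suc m := g) \<in> H" if "w \<in> carrier (tuple_group G m')" for w
    using ih(6)[OF that] KD by blast
  \<comment> \<open>A full fibre \<open>L\<close> leaves the last coordinate unconstrained: it opens
    a new class and \<open>m - m'\<close> does not change. Otherwise the coordinate has to join an
    old class or class \<open>0\<close>.\<close>
  show ?case
  proof (cases "L = carrier G")
    case True
    define c' where "c' = c(Suc m := Suc m')"
    define \<tau>' where "\<tau>' = \<tau>(Suc m := (\<lambda>x. x))"
    have mem: "diag_tuple G (Suc m) c' \<tau>' w \<in> H" if w: "w \<in> carrier (tuple_group G (Suc m'))" for w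
    proof -
      define w' where "w' = w(Suc m' := \<one>)"
      have w': "w' \<in> carrier (tuple_group G m')" using tuple_Suc_decomp[OF w] by (simp add: w'_def)
      obtain g where g: "g \<in> carrier G" "(?d w')(Suc m := g) \<in> H" using ext[OF w'] by auto
      have "inv g \<otimes> w (Suc m') \<in> L" using g tuple_closed[OF w] True by auto
      then have "(\<lambda>j. ?d w' j \<otimes> \<one>)(Suc m := g \<otimes> (inv g \<otimes> w (Suc m'))) \<in> H"
        using g by (intro upd) (auto simp: L_def)
      moreover have "(\<lambda>j. ?d w' j \<otimes> \<one>)(Suc m := g \<otimes> (inv g \<otimes> w (Suc m'))) = diag_tuple G (Suc m) c' \<tau>' w"
        using g tuple_closed[OF w] dc[OF w'] ih(3)
        by (auto simp: fun_eq_iff diag_tuple_def c'_def \<tau>'_def w'_def m_assoc[symmetric])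
          (metis Suc_n_not_le_n)
      ultimately show ?thesis by simp
    qed
    have "{1..Suc m'} \<subseteq> c' ` {1..Suc m}"
    proof
      fix x assume x: "x \<in> {1..Suc m'}"
      show "x \<in> c' ` {1..Suc m}"
      proof (cases "x = Suc m'")
        case True then show ?thesis by (auto simp: c'_def)
      next
        case False
        with x have "x \<in> c ` {1..m}" using ih(4) by auto
        then obtain j where "j \<in> {1..m}" "x = c j" by auto
        then show ?thesis by (intro image_eqI[of _ _ j]) (auto simp: c'_def)
      qed
    qed
    moreover have "card H * n ^ (Suc m - Suc m') \<le> card (carrier G) ^ Suc m"
      using mult_right_mono[OF ih(7), of "card (carrier G)"] cardH True by (simp add: mult_ac)
    moreover have "Suc m' \<le> Suc m" "\<forall>j. j \<notin> {1..Suc m} \<longrightarrow> c' j = 0" "\<forall>j. c' j \<le> Suc m'" "\<forall>j. \<tau>' j \<in> iso G G"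
      using ih(1,2,3,5) by (auto simp: c'_def \<tau>'_def iso_set_refl le_SucI)
    ultimately show ?thesis using mem by blast
  next
    case False
    \<comment> \<open>A proper fibre loses a factor of at least \<open>n\<close>, which pays for the
      increase of \<open>m - m'\<close> by one.\<close>
    then have Ln: "card L * n \<le> card (carrier G)" using index_bound subL by auto
    have cost: "card H * n ^ (Suc m - m') \<le> card (carrier G) ^ Suc m"
    proof -
      have "card H * n ^ (Suc m - m') = (card K * n ^ (m - m')) * (card L * n)"
        using cardH ih(1) by (simp add: Suc_diff_le mult_ac)
      also have "\<dots> \<le> card (carrier G) ^ m * card (carrier G)" using ih(7) Ln by (rule mult_mono) auto
      finally show ?thesis by (simp add: mult.commute)
    qed
    \<comment> \<open>It remains to name the class \<open>b\<close> and the twist of the last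
      coordinate. The requirement is multiplicative in the tuple, so one-class tuples suffice;
      \<open>b = 0\<close> makes the coordinate trivial.\<close>
    have finish: ?thesis
      if b: "b \<le> m'" and th: "\<theta> \<in> iso G G" and gen: "\<And>b' h. b' \<in> {1..m'} \<Longrightarrow> h \<in> carrier G \<Longrightarrow>
          (?d ((\<lambda>j. \<one>)(b' := h)))(Suc m := \<theta> (((\<lambda>j. \<one>)(b' := h)) b)) \<in> H" for b \<theta>
    proof -
      have "(?d w)(Suc m := \<theta> (w b)) \<in> H" if w: "w \<in> carrier (tuple_group G m')" for w
        using w
      proof (rule tuple_induct)
        show "(?d (\<lambda>j. \<one>))(Suc m := \<theta> \<one>) \<in> H"
          using HD(2) diag_tuple_one[of \<tau>] ih(5) iso_one[OF th] by (simp add: fun_upd_idem)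
        show "\<And>b' h. b' \<in> {1..m'} \<Longrightarrow> h \<in> carrier G \<Longrightarrow>
          (?d ((\<lambda>j. \<one>)(b' := h)))(Suc m := \<theta> (((\<lambda>j. \<one>)(b' := h)) b)) \<in> H" by (rule gen)
        show "(?d (\<lambda>j. u j \<otimes> v j))(Suc m := \<theta> (u b \<otimes> v b)) \<in> H"
          if "u \<in> carrier (tuple_group G m')" "v \<in> carrier (tuple_group G m')"
            "(?d u)(Suc m := \<theta> (u b)) \<in> H" "(?d v)(Suc m := \<theta> (v b)) \<in> H" for u v
        proof -
          have "\<theta> (u b \<otimes> v b) = \<theta> (u b) \<otimes> \<theta> (v b)"
            using th tuple_closed[OF that(1)] tuple_closed[OF that(2)] by (auto simp: iso_def hom_def)
          then show ?thesis using upd[OF that(3,4)] dmult[OF that(1,2)] by simp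
        qed
      qed
      moreover have "(?d w)(Suc m := \<theta> (w b)) = diag_tuple G (Suc m) (c(Suc m := b)) (\<tau>(Suc m := \<theta>)) w" for w
        by (auto simp: diag_tuple_def fun_eq_iff)
      ultimately have mem: "\<And>w. w \<in> carrier (tuple_group G m') \<Longrightarrow>
          diag_tuple G (Suc m) (c(Suc m := b)) (\<tau>(Suc m := \<theta>)) w \<in> H" by metis
      have "{1..m'} \<subseteq> (c(Suc m := b)) ` {1..Suc m}"
      proof
        fix x assume "x \<in> {1..m'}"
        then obtain j where "j \<in> {1..m}" "x = c j" using ih(4) by auto
        then show "x \<in> (c(Suc m := b)) ` {1..Suc m}" by (intro image_eqI[of _ _ j]) auto
      qed
      moreover have "m' \<le> Suc m" "\<forall>j. j \<notin> {1..Suc m} \<longrightarrow> (c(Suc m := b)) j = 0"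
        "\<forall>j. (c(Suc m := b)) j \<le> m'" "\<forall>j. (\<tau>(Suc m := \<theta>)) j \<in> iso G G"
        using ih(1,2,3,5) b th by auto
      ultimately show ?thesis using mem cost by blast
    qed
    define sg where "sg = (\<lambda>b h. (\<lambda>j::nat. \<one>)(b := h))"
    have sgc: "sg b h \<in> carrier (tuple_group G m')" if "b \<in> {1..m'}" "h \<in> carrier G" for b h
      using that by (auto simp: sg_def mem_tuple_group)
    have sgm: "sg b (h \<otimes> h') = (\<lambda>j. sg b h j \<otimes> sg b h' j)" for b h h'
      by (auto simp: sg_def fun_eq_iff)
    have sgi: "sg b (inv h) = (\<lambda>j. inv (sg b h j))" for b h
      by (auto simp: sg_def fun_eq_iff)
    define R where "R = (\<lambda>b. {(h, g). h \<in> carrier G \<and> g \<in> carrier G \<and> (?d (sg b h))(Suc m := g) \<in> H})"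
    \<comment> \<open>Every diagonal tuple lies in the projection \<open>K\<close> and therefore has
      some extension to \<open>H\<close>, so \<open>R b\<close> projects onto \<open>G\<close>. If
      extension by the unit fails even once, \<open>R b\<close> is the graph of an
      automorphism.\<close>
    have autom: "\<exists>\<theta>\<in>iso G G. R b = {(a, \<theta> a) |a. a \<in> carrier G}"
      if b: "b \<in> {1..m'}" and h: "h \<in> carrier G" "(?d (sg b h))(Suc m := \<one>) \<notin> H" for b h
    proof (rule graph_of_automorphism[where h = h])
      show "R b \<subseteq> carrier G \<times> carrier G" "h \<in> carrier G" "(h, \<one>) \<notin> R b" using h by (auto simp: R_def)
      show "(a \<otimes> x, g \<otimes> y) \<in> R b" if "(a, g) \<in> R b" "(x, y) \<in> R b" for a g x y
        using that upd[of "?d (sg b a)" g "?d (sg b x)" y] dmult[OF sgc[OF b] sgc[OF b]]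
        by (auto simp: R_def sgm)
      show "(inv a, inv g) \<in> R b" if "(a, g) \<in> R b" for a g
        using that updi[of "?d (sg b a)" g] diag_tuple_inv[OF ih(5) sgc[OF b]]
        by (auto simp: R_def sgi)
      show "\<exists>g. (a, g) \<in> R b" if "a \<in> carrier G" for a
        using ext[OF sgc[OF b that]] that by (auto simp: R_def)
    qed
    show ?thesis
    proof (cases "\<exists>b\<in>{1..m'}. \<exists>h\<in>carrier G. (?d (sg b h))(Suc m := \<one>) \<notin> H")
      case False
      then show ?thesis
        by (intro finish[of 0 "\<lambda>x. x"]) (auto simp: iso_set_refl sg_def)
    next
      case True
      then obtain b h where b: "b \<in> {1..m'}" "h \<in> carrier G" "(?d (sg b h))(Suc m := \<one>) \<notin> H" by auto
      obtain \<theta> where th: "\<theta> \<in> iso G G" "R b = {(a, \<theta> a) |a. a \<in> carrier G}" using autom[OF b] by auto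
      have thR: "(?d (sg b a))(Suc m := \<theta> a) \<in> H" if "a \<in> carrier G" for a
      proof -
        have "(a, \<theta> a) \<in> R b" using th(2) that by auto
        then show ?thesis by (auto simp: R_def)
      qed
      have L1: "L \<subseteq> {\<one>}"
      proof
        fix g assume g: "g \<in> L"
        have "?d (sg b \<one>) = (\<lambda>j. \<one>)" using diag_tuple_one[OF ih(5)] by (simp add: sg_def fun_upd_idem)
        then have "(\<one>, g) \<in> R b" using g by (auto simp: R_def L_def)
        then have "g = \<theta> \<one>" using th(2) by auto
        then show "g \<in> {\<one>}" using iso_one[OF th(1)] by simp
      qed
      \<comment> \<open>At most one class can influence the last coordinate. Tuples supported on
        different classes commute, and as \<open>L\<close> is trivial the last coordinates they
        determine commute too; two automorphisms with commuting images would make \<open>G\<close>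
        abelian.\<close>
      have other: "(?d (sg b' h'))(Suc m := \<one>) \<in> H" if b': "b' \<in> {1..m'}" "b' \<noteq> b" "h' \<in> carrier G" for b' h'
      proof (rule ccontr)
        assume "(?d (sg b' h'))(Suc m := \<one>) \<notin> H"
        then obtain \<theta>' where th': "\<theta>' \<in> iso G G" "R b' = {(a, \<theta>' a) |a. a \<in> carrier G}"
          using autom[OF b'(1,3)] by auto
        have th'R: "(?d (sg b' a))(Suc m := \<theta>' a) \<in> H" if "a \<in> carrier G" for a
        proof -
          have "(a, \<theta>' a) \<in> R b'" using th'(2) that by auto
          then show ?thesis by (auto simp: R_def)
        qed
        have comm: "\<theta> x \<otimes> \<theta>' y = \<theta>' y \<otimes> \<theta> x" if xy: "x \<in> carrier G" "y \<in> carrier G" for x y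
        proof -
          let ?u = "?d (sg b x)" and ?v = "?d (sg b' y)"
          have cc: "\<theta> x \<in> carrier G" "\<theta>' y \<in> carrier G"
            using th(1) th'(1) xy by (auto simp: iso_def hom_def)
          have uv: "?u j \<otimes> ?v j = ?v j \<otimes> ?u j" for j
          proof -
            have "(\<lambda>j. sg b x j \<otimes> sg b' y j) = (\<lambda>j. sg b' y j \<otimes> sg b x j)"
              using b'(2) xy by (auto simp: sg_def fun_eq_iff)
            then show ?thesis
              using dmult[OF sgc[OF b(1) xy(1)] sgc[OF b'(1) xy(2)]] dmult[OF sgc[OF b'(1) xy(2)] sgc[OF b(1) xy(1)]]
              by metis
          qed
          have 1: "(\<lambda>j. ?u j \<otimes> ?v j)(Suc m := \<theta> x \<otimes> \<theta>' y) \<in> H"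
            using upd[OF thR[OF xy(1)] th'R[OF xy(2)]] .
          have "(\<lambda>j. ?v j \<otimes> ?u j)(Suc m := \<theta>' y \<otimes> \<theta> x) \<in> H"
            using upd[OF th'R[OF xy(2)] thR[OF xy(1)]] .
          then have 2: "(\<lambda>j. ?u j \<otimes> ?v j)(Suc m := \<theta>' y \<otimes> \<theta> x) \<in> H" using uv by simp
          have "(\<lambda>j. inv (?u j \<otimes> ?v j) \<otimes> (?u j \<otimes> ?v j))(Suc m := inv (\<theta> x \<otimes> \<theta>' y) \<otimes> (\<theta>' y \<otimes> \<theta> x)) \<in> H"
            by (rule upd[OF updi[OF 1] 2])
          moreover have "(\<lambda>j. inv (?u j \<otimes> ?v j) \<otimes> (?u j \<otimes> ?v j)) = (\<lambda>j. \<one>)"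
            using dc[OF sgc[OF b(1) xy(1)]] dc[OF sgc[OF b'(1) xy(2)]] by simp
          ultimately have "inv (\<theta> x \<otimes> \<theta>' y) \<otimes> (\<theta>' y \<otimes> \<theta> x) \<in> L" using cc by (simp add: L_def)
          then have "inv (\<theta> x \<otimes> \<theta>' y) \<otimes> (\<theta>' y \<otimes> \<theta> x) = \<one>" using L1 by auto
          then show ?thesis using cc by (metis inv_equality inv_inv inv_closed m_closed)
        qed
        obtain x y where xy: "x \<in> carrier G" "y \<in> carrier G" "x \<otimes> y \<noteq> y \<otimes> x" using not_comm by auto
        have "x \<in> \<theta> ` carrier G" "y \<in> \<theta>' ` carrier G"
          using th(1) th'(1) xy by (auto simp: iso_def bij_betw_def)
        then show False using comm xy by auto
      qed
      have "(?d ((\<lambda>j. \<one>)(b' := h)))(Suc m := \<theta> (((\<lambda>j. \<one>)(b' := h)) b)) \<in> H"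
        if "b' \<in> {1..m'}" "h \<in> carrier G" for b' h
        using that thR[of h] other[of b' h] iso_one[OF th(1)] by (cases "b' = b") (auto simp: sg_def)
      then show ?thesis using b(1) by (intro finish[of b \<theta>] th(1)) auto
    qed
  qed
qed

end

section \<open>Trees in a path with merged vertices\<close>

text \<open>Edge \<open>i\<close> joins the classes of the path vertices \<open>i - 1\<close> and \<open>i\<close>; class \<open>0\<close> is the root,
  on which gauge transformations are trivial.\<close>

definition ends :: "(nat \<Rightarrow> nat) \<Rightarrow> nat \<Rightarrow> nat set" where
  "ends c i = {c (i - 1), c i}"

definition tail_of :: "nat \<Rightarrow> bool \<Rightarrow> nat" where "tail_of e b = (if b then e - 1 else e)"
definition head_of :: "nat \<Rightarrow> bool \<Rightarrow> nat" where "head_of e b = (if b then e else e - 1)"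

text \<open>The tree is recorded with its order of growth because a gauge transformation is
  transported along it vertex by vertex. \<open>R\<close> holds the classes where the transformation
  has to stay trivial, and \<open>e\<close> is the edge on which the two inputs differ.\<close>

inductive grown_tree :: "nat \<Rightarrow> (nat \<Rightarrow> nat) \<Rightarrow> nat set \<Rightarrow> nat \<Rightarrow> nat \<Rightarrow> nat set \<Rightarrow> nat set \<Rightarrow> bool"
  for q c R e a where
  base: "grown_tree q c R e a {} {a}"
| step: "grown_tree q c R e a E V \<Longrightarrow> i \<in> {1..q} \<Longrightarrow> i \<notin> E \<Longrightarrow> i \<noteq> e \<Longrightarrow> ends c i = {v, w} \<Longrightarrow>
    v \<in> V \<Longrightarrow> w \<notin> V \<Longrightarrow> w \<notin> R \<Longrightarrow> grown_tree q c R e a (insert i E) (insert w V)"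

text \<open>Both ends of such an edge already carry prescribed gauge values, so nothing is left to
  adjust there and the transformation may become visible.\<close>

definition closing_edge where
  "closing_edge q c R e E V g \<longleftrightarrow> g \<in> {1..q} \<and> g \<notin> E \<and> g \<noteq> e \<and> ends c g \<subseteq> V \<union> R \<and> ends c g \<inter> V \<noteq> {}"

text \<open>Starting along the oriented edge \<open>(e, b)\<close>, one must use at least \<open>k\<close> edges to reach the
  root, to come back to the tail, or to close a cycle.\<close>

definition far :: "nat \<Rightarrow> (nat \<Rightarrow> nat) \<Rightarrow> nat \<Rightarrow> bool \<Rightarrow> nat \<Rightarrow> bool" where
  "far q c e b k \<longleftrightarrow> k \<le> 1 \<or> (c (head_of e b) \<notin> {0, c (tail_of e b)} \<and>
     (\<forall>E V g. grown_tree q c {0, c (tail_of e b)} e (c (head_of e b)) E V \<longrightarrow>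
        closing_edge q c {0, c (tail_of e b)} e E V g \<longrightarrow> k \<le> card E + 2))"

lemma ends_tail_head: "ends c e = {c (tail_of e b), c (head_of e b)}"
  by (auto simp: ends_def tail_of_def head_of_def)

lemma ends_comp: "ends (d \<circ> c) i = d ` ends c i"
  by (simp add: ends_def)

lemma grown_tree_basic:
  assumes "grown_tree q c R e a E V"
  shows "finite E \<and> finite V \<and> a \<in> V \<and> card V = card E + 1 \<and> E \<subseteq> {1..q} \<and> e \<notin> E
    \<and> (\<forall>i\<in>E. ends c i \<subseteq> V) \<and> V \<subseteq> insert a (\<Union>i\<in>E. ends c i) \<and> V \<inter> R \<subseteq> {a}"
  using assms
proof induction
  case (step E V i v w)
  then show ?case by auto
qed auto

lemma bij_betw_fun_upd:
  assumes "bij_betw f A B" "x \<notin> A" "y \<notin> B"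
  shows "bij_betw (f(x := y)) (insert x A) (insert y B)"
proof -
  have "bij_betw (f(x := y)) A B"
    using assms(1,2) by (subst bij_betw_cong[of A _ f]) auto
  then have "bij_betw (f(x := y)) (A \<union> {x}) (B \<union> {(f(x := y)) x})"
    using assms by (intro notIn_Un_bij_betw) auto
  then show ?thesis by simp
qed

text \<open>Root the tree at \<open>p\<close> and match each edge to the end farther from
  \<open>p\<close>. If \<open>p\<close> is the newest leaf, the new edge takes \<open>v\<close>, and
  the induction hypothesis is used with \<open>v\<close> as the free vertex.\<close>

lemma grown_tree_assignment:
  assumes "grown_tree q c R e a E V" "p \<in> V"
  shows "\<exists>\<iota>. bij_betw \<iota> E (V - {p}) \<and> (\<forall>i\<in>E. \<iota> i \<in> ends c i)"
  using assms
proof (induction arbitrary: p)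
  case base
  then show ?case by (auto simp: bij_betw_def)
next
  case (step E V i v w)
  show ?case
  proof (cases "p = w")
    case True
    obtain \<iota> where \<iota>: "bij_betw \<iota> E (V - {v})" "\<forall>i\<in>E. \<iota> i \<in> ends c i" using step.IH[OF step.hyps(6)] by auto
    have "bij_betw (\<iota>(i := v)) (insert i E) (insert v (V - {v}))"
      using \<iota>(1) step.hyps(3) by (intro bij_betw_fun_upd) auto
    moreover have "insert v (V - {v}) = insert w V - {p}" using step.hyps True by auto
    moreover have "\<forall>j\<in>insert i E. (\<iota>(i := v)) j \<in> ends c j" using \<iota>(2) step.hyps(5) by auto
    ultimately show ?thesis by metis
  next
    case False
    then obtain \<iota> where \<iota>: "bij_betw \<iota> E (V - {p})" "\<forall>i\<in>E. \<iota> i \<in> ends c i"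
      using step.IH[of p] step.prems by auto
    have "bij_betw (\<iota>(i := w)) (insert i E) (insert w (V - {p}))"
      using \<iota>(1) step.hyps(3,7) by (intro bij_betw_fun_upd) auto
    moreover have "insert w (V - {p}) = insert w V - {p}" using False by auto
    moreover have "\<forall>j\<in>insert i E. (\<iota>(i := w)) j \<in> ends c j" using \<iota>(2) step.hyps(5) by auto
    ultimately show ?thesis by metis
  qed
qed

text \<open>Growth is stopped just before it first enters \<open>B\<close>; the edge that would
  enter becomes the closing edge. This lets a later witness be cut off where it meets classes that
  earlier ones have used.\<close>

lemma grown_tree_truncate:
  assumes "grown_tree q c R e a E V" "a \<notin> B"
  shows "V \<inter> B = {} \<or> (\<exists>E' V' g. grown_tree q c R e a E' V' \<and> V' \<inter> B = {} \<and> closing_edge q c B e E' V' g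
    \<and> card E' + 1 \<le> card E)"
  using assms
proof induction
  case (step E V i v w)
  show ?case
  proof (cases "V \<inter> B = {}")
    case True
    show ?thesis
    proof (cases "w \<in> B")
      case True
      then have "closing_edge q c B e E V i" using step.hyps by (auto simp: closing_edge_def)
      then show ?thesis using step.hyps(1,3) \<open>V \<inter> B = {}\<close> grown_tree_basic[OF step.hyps(1)]
        by (intro disjI2 exI[of _ E] exI[of _ V] exI[of _ i]) auto
    next
      case False then show ?thesis using True by auto
    qed
  next
    case False
    then obtain E' V' g where "grown_tree q c R e a E' V' \<and> V' \<inter> B = {} \<and> closing_edge q c B e E' V' g
      \<and> card E' + 1 \<le> card E" using step by auto
    then show ?thesis using step.hyps(3) grown_tree_basic[OF step.hyps(1)]
      by (intro disjI2 exI[of _ E'] exI[of _ V'] exI[of _ g]) auto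
  qed
qed auto

text \<open>A short witness relative to a larger barrier \<open>B\<close>. Its tree edges match all
  its vertices except one end of the closing edge, and the closing edge takes that end. Hence
  \<open>F\<close> has as many edges as \<open>W\<close> has classes, and adding \<open>f\<close>
  gives a surplus of one edge.\<close>

lemma not_far_truncate:
  assumes "\<not> far q c f b k" "0 \<in> B" "c (tail_of f b) \<in> B"
  shows "\<exists>F W \<iota>. F \<subseteq> {1..q} - {f} \<and> finite W \<and> W \<inter> B = {} \<and> bij_betw \<iota> F W \<and> card F + 1 < k
    \<and> (\<forall>i\<in>F. \<iota> i \<in> ends c i \<and> ends c i \<subseteq> W \<union> B) \<and> c (head_of f b) \<in> W \<union> B"
proof -
  define z a where "z = c (tail_of f b)" and "a = c (head_of f b)"
  have k: "1 < k" using assms(1) by (auto simp: far_def)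
  show ?thesis
  proof (cases "a \<in> B")
    case True
    then show ?thesis using k
      by (intro exI[of _ "{}"] exI[of _ "\<lambda>_. 0"]) (auto simp: a_def bij_betw_def)
  next
    case False
    with assms(2,3) have "a \<noteq> 0" "a \<noteq> z" unfolding z_def by metis+
    then have "a \<notin> {0, z}" by simp
    then obtain E V g where g: "grown_tree q c {0, z} f a E V" "closing_edge q c {0, z} f E V g" "card E + 2 < k"
      using assms(1) k by (auto simp: far_def z_def a_def not_le)
    obtain E' V' g' where g': "grown_tree q c {0, z} f a E' V'" "V' \<inter> B = {}" "closing_edge q c B f E' V' g'"
      "card E' + 2 < k"
    proof (cases "V \<inter> B = {}")
      case True
      have "closing_edge q c B f E V g" using g(2) assms(2,3) by (auto simp: closing_edge_def z_def)
      then show ?thesis using that g True by auto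
    next
      case False
      then show ?thesis using grown_tree_truncate[OF g(1) \<open>a \<notin> B\<close>] g(3) that by force
    qed
    \<comment> \<open>This end of the closing edge is the vertex that the tree matching leaves
      free.\<close>
    obtain v where v: "v \<in> ends c g'" "v \<in> V'" using g'(3) by (auto simp: closing_edge_def)
    obtain \<iota> where \<iota>: "bij_betw \<iota> E' (V' - {v})" "\<forall>i\<in>E'. \<iota> i \<in> ends c i"
      using grown_tree_assignment[OF g'(1) v(2)] by auto
    note b = grown_tree_basic[OF g'(1)]
    have gE: "g' \<notin> E'" using g'(3) by (auto simp: closing_edge_def)
    have "bij_betw (\<iota>(g' := v)) (insert g' E') (insert v (V' - {v}))"
      using \<iota>(1) gE by (intro bij_betw_fun_upd) auto
    then have "bij_betw (\<iota>(g' := v)) (insert g' E') V'" using v(2) by (simp only: insert_Diff)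
    moreover have "\<forall>i\<in>insert g' E'. (\<iota>(g' := v)) i \<in> ends c i \<and> ends c i \<subseteq> V' \<union> B"
      using \<iota>(2) v b g'(3) gE by (auto simp: closing_edge_def)
    moreover have "insert g' E' \<subseteq> {1..q} - {f}" using b g'(3) by (auto simp: closing_edge_def)
    moreover have "card (insert g' E') + 1 < k" using b gE g'(4) by simp
    moreover have "finite V'" "c (head_of f b) \<in> V' \<union> B" using b by (auto simp: a_def)
    ultimately show ?thesis using g'(2) by metis
  qed
qed

text \<open>An edge of \<open>E\<close> that touches a largest tree inside \<open>E\<close> without
  belonging to it would either extend the tree or close it. Closing is impossible: \<open>e\<close>,
  the tree and this edge make up at most \<open>card E + 1\<close> edges, fewer than
  \<open>k\<close>.\<close>

lemma maximal_grown_tree: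
  assumes "finite E" "a \<notin> R" and E: "E \<subseteq> {1..q} - {e}"
    and no: "\<forall>E' V g. grown_tree q c R e a E' V \<longrightarrow> closing_edge q c R e E' V g \<longrightarrow> k \<le> card E' + 2"
    and k: "card E + 1 < k"
  shows "\<exists>E' V. grown_tree q c R e a E' V \<and> E' \<subseteq> E \<and> (\<forall>g\<in>E - E'. ends c g \<inter> V = {})"
proof -
  define P where "P = (\<lambda>E'. (\<exists>V. grown_tree q c R e a E' V) \<and> E' \<subseteq> E)"
  have "P {}" by (auto simp: P_def intro: grown_tree.base)
  moreover have "\<forall>y. P y \<longrightarrow> card y \<le> card E" using assms(1) card_mono by (auto simp: P_def)
  ultimately obtain E' where E': "P E'" "\<And>y. P y \<Longrightarrow> card y \<le> card E'"
    using ex_has_greatest_nat[of P "{}" card "Suc (card E)"] by (auto simp: less_Suc_eq_le)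
  then obtain V where V: "grown_tree q c R e a E' V" "E' \<subseteq> E" by (auto simp: P_def)
  note b = grown_tree_basic[OF V(1)]
  have "ends c g \<inter> V = {}" if g: "g \<in> E - E'" for g
  proof (rule ccontr)
    assume ne: "ends c g \<inter> V \<noteq> {}"
    show False
    proof (cases "ends c g \<subseteq> V \<union> R")
      case True
      then have "closing_edge q c R e E' V g" using g E ne by (auto simp: closing_edge_def)
      with no V(1) have "k \<le> card E' + 2" by blast
      moreover have "card E' < card E" using g V(2) assms(1) by (intro psubset_card_mono) auto
      ultimately show False using k by simp
    next
      case False
      with ne obtain v w where "ends c g = {v, w}" "v \<in> V" "w \<notin> V" "w \<notin> R"
        by (auto simp: ends_def insert_commute)
      then have "grown_tree q c R e a (insert g E') (insert w V)"
        using V(1) g E by (intro grown_tree.step[of q c R e a E' V g v w]) auto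
      then have "P (insert g E')" using g V(2) by (auto simp: P_def)
      from E'(2)[OF this] show False using g b by simp
    qed
  qed
  then show ?thesis using V by blast
qed

text \<open>If the claim fails, \<open>m - m' + 1\<close> short witnesses in the merged graph can be glued: the edges of each
  outnumber its new merged classes by one, whereas in the unmerged graph all edges can be matched
  injectively to incident classes, missing a class of the tree that contains the head of \<open>e\<close>.\<close>

lemma far_after_merging:
  assumes far: "far q c e b k" and eS: "e \<in> S" and Sq: "S \<subseteq> {1..q}"
    and SP: "\<And>E V. 1 < k \<Longrightarrow> grown_tree q c {0, c (tail_of e b)} e (c (head_of e b)) E V \<Longrightarrow>
        \<exists>f\<in>S. f \<noteq> e \<and> f \<notin> E \<and> ends c f \<inter> V \<noteq> {}"
    and c: "\<And>j. c j \<le> m" and d: "d 0 = 0" "\<And>j. d j \<le> m'" "{1..m'} \<subseteq> d ` {1..m}" "m' \<le> m"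
    and k': "(m - m' + 1) * (k' - 1) < k"
  shows "\<exists>f\<in>S. \<exists>b'. far q (d \<circ> c) f b' k'"
proof (rule ccontr)
  assume "\<not> ?thesis"
  then have nf: "\<not> far q (d \<circ> c) f b' k'" if "f \<in> S" for f b' using that by auto
  from this[OF eS] have k2: "1 < k'" unfolding far_def by (meson not_le)
  define z a where "z = c (tail_of e b)" and "a = c (head_of e b)"
  define R where "R = {0, z}"
  define RH where "RH = {0, d z}"
  define t where "t = m - m'"
  have dR: "v \<in> R \<Longrightarrow> d v \<in> RH" for v using d(1) by (auto simp: R_def RH_def)
  have k1: "1 < k"
  proof -
    have "1 \<le> (m - m' + 1) * (k' - 1)" using k2 by simp
    then show ?thesis using k' by linarith
  qed
  have aR: "a \<notin> R" and noc: "\<forall>E V g. grown_tree q c R e a E V \<longrightarrow> closing_edge q c R e E V g \<longrightarrow> k \<le> card E + 2"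
    using far k1 by (auto simp: far_def z_def a_def R_def)
  \<comment> \<open>State after gluing \<open>j\<close> witnesses: \<open>E\<close> holds their
    edges other than \<open>e\<close>, and \<open>HH\<close> the merged classes they have added. In
    \<open>card E + 1\<close> the extra edge is \<open>e\<close>; each witness contributes a surplus
    of one edge and at most \<open>k' - 1\<close> edges. The map matches \<open>E\<close> to
    incident classes of the unmerged graph.\<close>
  define Inv where "Inv = (\<lambda>j E HH \<iota>. E \<subseteq> {1..q} - {e} \<and> finite HH \<and> HH \<subseteq> {1..m'} - RH
      \<and> (\<forall>i\<in>E. d ` ends c i \<subseteq> HH \<union> RH) \<and> d a \<in> HH \<union> RH \<and> card E + 1 = card HH + j
      \<and> card E + 1 \<le> j * (k' - 1) \<and> inj_on \<iota> E \<and> (\<forall>i\<in>E. \<iota> i \<in> ends c i - R))"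
  have lift: "\<exists>\<kappa>. inj_on \<kappa> F \<and> (\<forall>i\<in>F. \<kappa> i \<in> ends c i - R \<and> d (\<kappa> i) \<in> W)"
    if "bij_betw \<iota> F W" "W \<inter> RH = {}" "\<forall>i\<in>F. \<iota> i \<in> ends (d \<circ> c) i" for F W \<iota>
  proof -
    have "\<forall>i\<in>F. \<exists>v. v \<in> ends c i \<and> d v = \<iota> i" using that(3) unfolding ends_comp by (metis imageE)
    then obtain \<kappa> where \<kappa>: "\<forall>i\<in>F. \<kappa> i \<in> ends c i \<and> d (\<kappa> i) = \<iota> i" by metis
    have w: "\<iota> i \<in> W" if "i \<in> F" for i using \<open>bij_betw \<iota> F W\<close> that by (auto simp: bij_betw_def)
    have "inj_on \<kappa> F" using that(1) \<kappa> unfolding bij_betw_def inj_on_def by metis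
    moreover have "\<forall>i\<in>F. \<kappa> i \<in> ends c i - R \<and> d (\<kappa> i) \<in> W"
      using \<kappa> w dR that(2) by (metis DiffI disjoint_iff)
    ultimately show ?thesis by blast
  qed
  have Wm: "W \<subseteq> {1..m'} - RH" if bij: "bij_betw \<iota> F W" "W \<inter> RH = {}" "\<forall>i\<in>F. \<iota> i \<in> ends (d \<circ> c) i" for F W \<iota>
  proof
    fix x assume x: "x \<in> W"
    then obtain i where "i \<in> F" "x = \<iota> i" using bij_betw_imp_surj_on[OF bij(1)] by blast
    then have "x \<le> m'" using bij(3) d(2) by (auto simp: ends_def)
    moreover have "x \<notin> RH" using x bij(2) by auto
    ultimately show "x \<in> {1..m'} - RH" by (cases "x = 0") (auto simp: RH_def)
  qed
  have inv1: "\<exists>E HH \<iota>. Inv 1 E HH \<iota>"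
  proof -
    obtain F W \<iota> where F: "F \<subseteq> {1..q} - {e}" "finite W" "W \<inter> RH = {}" "bij_betw \<iota> F W" "card F + 1 < k'"
      "\<forall>i\<in>F. \<iota> i \<in> ends (d \<circ> c) i \<and> ends (d \<circ> c) i \<subseteq> W \<union> RH" "(d \<circ> c) (head_of e b) \<in> W \<union> RH"
      using not_far_truncate[OF nf[OF eS, of b], of RH] by (auto simp: RH_def z_def)
    have F6: "\<forall>i\<in>F. \<iota> i \<in> ends (d \<circ> c) i" "\<forall>i\<in>F. d ` ends c i \<subseteq> W \<union> RH"
      using F(6) unfolding ends_comp by blast+
    obtain \<kappa> where \<kappa>: "inj_on \<kappa> F" "\<forall>i\<in>F. \<kappa> i \<in> ends c i - R \<and> d (\<kappa> i) \<in> W"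
      using lift[OF F(4,3) F6(1)] by blast
    have "d a \<in> W \<union> RH" "card F + 1 = card W + 1" "card F + 1 \<le> 1 * (k' - 1)"
      using F(5,7) bij_betw_same_card[OF F(4)] by (auto simp: a_def)
    then have "Inv 1 F W \<kappa>"
      unfolding Inv_def using F(1,2) \<kappa> Wm[OF F(4,3) F6(1)] F6(2) by blast
    then show ?thesis by blast
  qed
  have key: "j \<le> t \<and> (\<exists>E HH \<iota>. Inv (Suc j) E HH \<iota>)" if j: "j \<le> t + 1" and inv: "Inv j E HH \<iota>" for j E HH \<iota>
  proof -
    have I: "E \<subseteq> {1..q} - {e}" "finite HH" "HH \<subseteq> {1..m'} - RH" "\<And>i. i \<in> E \<Longrightarrow> d ` ends c i \<subseteq> HH \<union> RH"
      "d a \<in> HH \<union> RH" "card E + 1 = card HH + j" "card E + 1 \<le> j * (k' - 1)" "inj_on \<iota> E"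
      "\<And>i. i \<in> E \<Longrightarrow> \<iota> i \<in> ends c i - R" using inv by (auto simp: Inv_def)
    have finE: "finite E" using I(1) by (meson finite_Diff finite_atLeastAtMost finite_subset)
    have "card E + 1 < k"
      using I(7) mult_right_mono[OF j, of "k' - 1"] k' by (simp add: t_def)
    from maximal_grown_tree[OF finE aR I(1) noc this]
    obtain EA VA where A: "grown_tree q c R e a EA VA" "EA \<subseteq> E" "\<forall>g\<in>E - EA. ends c g \<inter> VA = {}"
      by blast
    have aVA: "a \<in> VA" and VE: "VA \<subseteq> insert a (\<Union>i\<in>EA. ends c i)" and VRa: "VA \<inter> R \<subseteq> {a}"
      using grown_tree_basic[OF A(1)] by simp_all
    have VR: "VA \<inter> R = {}" using VRa aR by blast
    have VH: "d v \<in> HH \<union> RH" if "v \<in> VA" for v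
    proof -
      have "v = a \<or> (\<exists>i\<in>EA. v \<in> ends c i)" using VE that by blast
      then show ?thesis using I(4,5) A(2) by blast
    qed
    \<comment> \<open>Inside the tree at \<open>a\<close> the matching can be re-rooted to miss any
      chosen \<open>p\<close>. The other edges of \<open>E\<close> do not touch the tree, so their
      old values cannot collide with the new ones.\<close>
    have free: "\<exists>\<iota>'. inj_on \<iota>' E \<and> (\<forall>i\<in>E. \<iota>' i \<in> ends c i - R) \<and> p \<notin> \<iota>' ` E" if p: "p \<in> VA" for p
    proof -
      obtain \<alpha> where \<alpha>: "bij_betw \<alpha> EA (VA - {p})" "\<forall>i\<in>EA. \<alpha> i \<in> ends c i"
        using grown_tree_assignment[OF A(1) p] by auto
      define \<iota>' where "\<iota>' = (\<lambda>i. if i \<in> EA then \<alpha> i else \<iota> i)"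
      have in1: "\<iota>' i \<in> VA - {p}" if "i \<in> EA" for i using \<alpha>(1) that by (auto simp: \<iota>'_def bij_betw_def)
      have in2: "\<iota>' i \<notin> VA" if "i \<in> E" "i \<notin> EA" for i
        using A(3) I(9)[OF that(1)] that by (auto simp: \<iota>'_def)
      have "inj_on \<iota>' E"
      proof (rule inj_onI)
        fix x y assume xy: "x \<in> E" "y \<in> E" "\<iota>' x = \<iota>' y"
        have iff: "x \<in> EA \<longleftrightarrow> y \<in> EA" using xy in1 in2 by (metis DiffD1)
        show "x = y"
        proof (cases "x \<in> EA")
          case True
          then show ?thesis using iff xy(3) \<alpha>(1) unfolding \<iota>'_def bij_betw_def inj_on_def by metis
        next
          case False
          then show ?thesis using iff xy inj_onD[OF I(8)] unfolding \<iota>'_def by metis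
        qed
      qed
      moreover have "\<forall>i\<in>E. \<iota>' i \<in> ends c i - R"
        using I(9) \<alpha>(2) in1 VR by (auto simp: \<iota>'_def)
      moreover have "p \<notin> \<iota>' ` E" using in1 in2 p by auto
      ultimately show ?thesis by blast
    qed
    \<comment> \<open>The matched classes together with the free class \<open>a\<close> are
      \<open>card E + 1\<close> unmerged classes lying over \<open>HH\<close> or the roots. Since
      only \<open>t\<close> classes disappear by merging, at most \<open>card HH + t\<close> classes
      lie there, while the invariant gives \<open>card E + 1 = card HH + j\<close>.\<close>
    have jt: "j \<le> t"
    proof -
      define X where "X = {v \<in> {1..m} - R. d v \<in> HH \<union> RH}"
      define Y where "Y = {v \<in> {1..m} - R. d v \<notin> HH \<union> RH}"
      have fin: "finite X" "finite Y" by (auto simp: X_def Y_def)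
      obtain \<iota>' where \<iota>': "inj_on \<iota>' E" "\<forall>i\<in>E. \<iota>' i \<in> ends c i - R" "a \<notin> \<iota>' ` E" using free[OF aVA] by auto
      have sub: "\<iota>' ` E \<subseteq> X"
      proof
        fix x assume "x \<in> \<iota>' ` E"
        then obtain i where i: "i \<in> E" "x \<in> ends c i" "x \<notin> R" using \<iota>'(2) by auto
        then have "x \<le> m" "x \<noteq> 0" using c by (auto simp: ends_def R_def)
        then show "x \<in> X" using i I(4)[OF i(1)] by (auto simp: X_def)
      qed
      have "a \<in> X" using aR c[of "head_of e b"] I(5) by (auto simp: X_def R_def a_def)
      then have "card (insert a (\<iota>' ` E)) \<le> card X" using sub fin by (intro card_mono) auto
      then have cX: "card E + 1 \<le> card X" using \<iota>'(1,3) finE by (simp add: card_image)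
      have "{1..m'} - RH - HH \<subseteq> d ` Y"
      proof
        fix x assume x: "x \<in> {1..m'} - RH - HH"
        then obtain v where v: "v \<in> {1..m}" "d v = x" using d(3) by auto
        then have "v \<notin> R" using dR x by auto
        then show "x \<in> d ` Y" using v x by (auto simp: Y_def)
      qed
      then have "card ({1..m'} - RH - HH) \<le> card Y"
        by (meson card_image_le card_mono fin(2) finite_imageI le_trans)
      then have cY: "card ({1..m'} - RH) \<le> card Y + card HH"
        using card_Diff_subset[of HH "{1..m'} - RH"] I(2,3) card_mono[of "{1..m'} - RH" HH] by simp
      have "X \<union> Y = {1..m} - R" "X \<inter> Y = {}" by (auto simp: X_def Y_def)
      then have cXY: "card X + card Y = card ({1..m} - R)" using card_Un_disjoint[OF fin] by simp
      have "card ({1..m} - R) \<le> card ({1..m'} - RH) + t"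
      proof -
        have Rz: "card ({1..n} - {0, x}) = (if x = 0 then n else n - 1)" if "x \<le> n" for n x :: nat
        proof (cases "x = 0")
          case False
          have "{1..n} - {0, x} = {1..n} - {x}" by auto
          then show ?thesis using False that by simp
        qed simp
        have "z \<le> m" "d z \<le> m'" using c d(2) by (auto simp: z_def)
        then show ?thesis using Rz[of z m] Rz[of "d z" m'] d(1,4) by (auto simp: R_def RH_def t_def)
      qed
      then have "card X \<le> card HH + t" using cY cXY by linarith
      then show ?thesis using cX I(6) by linarith
    qed
    have "\<exists>E HH \<iota>. Inv (Suc j) E HH \<iota>"
    proof -
      \<comment> \<open>The sensitive edge at the tree starts the next witness. It is oriented away
        from a tree vertex \<open>p\<close>, so that its tail lies in the barrier \<open>B\<close>
        of everything built so far.\<close>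
      obtain f where f: "f \<in> S" "f \<noteq> e" "f \<notin> EA" "ends c f \<inter> VA \<noteq> {}"
        using SP[OF k1 A(1)[unfolded R_def z_def a_def]] by blast
      then have fE: "f \<notin> E" using A(3) by auto
      obtain p where p: "p \<in> ends c f" "p \<in> VA" using f by auto
      have "c (tail_of f (p = c (f - 1))) = p" using p(1) by (auto simp: ends_def tail_of_def)
      then obtain b' where b': "c (tail_of f b') = p" by blast
      define B where "B = HH \<union> RH"
      have B: "0 \<in> B" "(d \<circ> c) (tail_of f b') \<in> B" using VH[OF p(2)] b' by (auto simp: B_def RH_def)
      obtain F W \<beta> where F: "F \<subseteq> {1..q} - {f}" "finite W" "W \<inter> B = {}" "bij_betw \<beta> F W" "card F + 1 < k'"
        "\<forall>i\<in>F. \<beta> i \<in> ends (d \<circ> c) i \<and> ends (d \<circ> c) i \<subseteq> W \<union> B" "(d \<circ> c) (head_of f b') \<in> W \<union> B"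
        using not_far_truncate[OF nf[OF f(1), of b'] B] by blast
      have WR: "W \<inter> RH = {}" using F(3) by (auto simp: B_def)
      have F6: "\<forall>i\<in>F. \<beta> i \<in> ends (d \<circ> c) i" using F(6) by blast
      obtain \<kappa> where \<kappa>: "inj_on \<kappa> F" "\<forall>i\<in>F. \<kappa> i \<in> ends c i - R \<and> d (\<kappa> i) \<in> W" using lift[OF F(4) WR F6] by blast
      have finF: "finite F" using F(1) by (meson finite_Diff finite_atLeastAtMost finite_subset)
      \<comment> \<open>Every edge of a witness is matched to a class in \<open>W\<close>, hence has
        an end outside \<open>B\<close>. This separates the new edges from \<open>E\<close> and from
        \<open>e\<close>, whose ends all lie in \<open>B\<close> after merging.\<close>
      have touch: "i \<notin> F" if "d ` ends c i \<subseteq> B" for i using \<kappa>(2) that F(3) by blast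
      have eF: "e \<notin> F"
        using I(5) by (intro touch) (auto simp: ends_tail_head[of c e b] B_def RH_def a_def z_def)
      have EF: "E \<inter> F = {}" using touch I(4) by (auto simp: B_def)
      have fF: "f \<notin> F" using F(1) by auto
      obtain \<iota>' where \<iota>': "inj_on \<iota>' E" "\<forall>i\<in>E. \<iota>' i \<in> ends c i - R" "p \<notin> \<iota>' ` E" using free[OF p(2)] by auto
      \<comment> \<open>The edge \<open>f\<close> takes the freed class \<open>p\<close>; the edges
        of \<open>F\<close> take classes over \<open>W\<close>, which lie over nothing used before.
        So the matching stays injective.\<close>
      define E2 where "E2 = insert f (E \<union> F)"
      define \<iota>2 where "\<iota>2 = (\<lambda>i. if i = f then p else if i \<in> E then \<iota>' i else \<kappa> i)"
      have dE: "d (\<iota>' i) \<in> B" if "i \<in> E" for i using \<iota>'(2) I(4) that by (auto simp: B_def)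
      have dp: "d p \<in> B" using VH[OF p(2)] by (simp add: B_def)
      have ne1: "\<iota>' x \<noteq> \<kappa> y" if "x \<in> E" "y \<in> F" for x y
        using dE[OF that(1)] \<kappa>(2) that(2) F(3) by (metis disjoint_iff)
      have ne2: "p \<noteq> \<kappa> y" if "y \<in> F" for y
        using dp \<kappa>(2) that F(3) by (metis disjoint_iff)
      have "inj_on \<iota>2 E2"
      proof (rule inj_onI)
        fix x y assume xy: "x \<in> E2" "y \<in> E2" "\<iota>2 x = \<iota>2 y"
        have xs: "x = f \<or> x \<in> E \<or> x \<in> F" "y = f \<or> y \<in> E \<or> y \<in> F" using xy by (auto simp: E2_def)
        have v: "\<iota>2 f = p" "\<And>i. i \<in> E \<Longrightarrow> \<iota>2 i = \<iota>' i" "\<And>i. i \<in> F \<Longrightarrow> \<iota>2 i = \<kappa> i"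
          using fE fF EF by (auto simp: \<iota>2_def)
        have ne3: "p \<noteq> \<iota>' i" if "i \<in> E" for i using \<iota>'(3) that by auto
        show "x = y"
          using xs xy(3) ne1 ne2 ne3 v inj_onD[OF \<iota>'(1)] inj_onD[OF \<kappa>(1)] by metis
      qed
      moreover have "\<forall>i\<in>E2. \<iota>2 i \<in> ends c i - R"
        using \<iota>'(2) \<kappa>(2) p VR by (auto simp: E2_def \<iota>2_def)
      moreover have "card E2 = card E + card F + 1"
        using finE finF EF fE fF by (simp add: E2_def card_Un_disjoint)
      moreover have "card (HH \<union> W) = card HH + card F"
        using I(2) F(2,3) bij_betw_same_card[OF F(4)] by (subst card_Un_disjoint) (auto simp: B_def)
      moreover have "E2 \<subseteq> {1..q} - {e}" using I(1) F(1) eF f(1,2) Sq by (auto simp: E2_def)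
      moreover have "finite (HH \<union> W)" "HH \<union> W \<subseteq> {1..m'} - RH" using I(2,3) F(2) Wm[OF F(4) WR F6] by auto
      moreover have "\<forall>i\<in>E2. d ` ends c i \<subseteq> HH \<union> W \<union> RH"
      proof
        fix i assume "i \<in> E2"
        then consider "i = f" | "i \<in> E" | "i \<in> F" by (auto simp: E2_def)
        then show "d ` ends c i \<subseteq> HH \<union> W \<union> RH"
        proof cases
          case 1
          then show ?thesis using B(2) F(7) by (auto simp: ends_tail_head[of c f b'] B_def)
        next
          case 2 then show ?thesis using I(4) by auto
        next
          case 3
          then have "d ` ends c i \<subseteq> W \<union> B" using F(6) by (auto simp: ends_comp)
          then show ?thesis by (auto simp: B_def)
        qed
      qed
      moreover have "d a \<in> HH \<union> W \<union> RH" using I(5) by auto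
      moreover have "card E + card F + 1 + 1 = card HH + card F + Suc j" using I(6) by simp
      moreover have "card E + card F + 1 + 1 \<le> Suc j * (k' - 1)" using I(7) F(5) by simp
      ultimately have "Inv (Suc j) E2 (HH \<union> W) \<iota>2" by (simp add: Inv_def)
      then show ?thesis by blast
    qed
    with jt show ?thesis by blast
  qed
  have "j \<le> t \<Longrightarrow> \<exists>E HH \<iota>. Inv (Suc j) E HH \<iota>" for j
  proof (induction j)
    case 0 then show ?case using inv1 by simp
  next
    case (Suc j)
    then obtain E HH \<iota> where "Inv (Suc j) E HH \<iota>" by auto
    then show ?case using key[of "Suc j" E HH \<iota>] Suc.prems by auto
  qed
  from this[of t] obtain E HH \<iota> where "Inv (Suc t) E HH \<iota>" by blast
  then show False using key[of "Suc t" E HH \<iota>] by simp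
qed

section \<open>Gauge transformations\<close>

context group
begin

text \<open>A gauge transformation \<open>u\<close> lies in the tuple group of length \<open>q - 1\<close>, hence is trivial at the end
  vertices \<open>0\<close> and \<open>q\<close> of the path.\<close>

definition gauge :: "(nat \<Rightarrow> 'a) \<Rightarrow> (nat \<Rightarrow> 'a) \<Rightarrow> nat \<Rightarrow> 'a" where
  "gauge u M = (\<lambda>i. inv (u i) \<otimes> M i \<otimes> u (i - 1))"

lemma gauge_closed:
  assumes "u \<in> carrier (tuple_group G (q - 1))" "M \<in> carrier (tuple_group G q)" "q \<ge> 1"
  shows "gauge u M \<in> carrier (tuple_group G q)"
  using assms unfolding mem_tuple_group gauge_def by (auto simp: not_le)

lemma gauge_mult:
  assumes "u \<in> carrier (tuple_group G m)" "v \<in> carrier (tuple_group G m)" "M \<in> carrier (tuple_group G q)"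
  shows "gauge (\<lambda>j. u j \<otimes> v j) M = gauge v (gauge u M)"
  using assms by (auto simp: gauge_def mem_tuple_group fun_eq_iff inv_mult_group m_assoc)

lemma gauge_one:
  assumes "M \<in> carrier (tuple_group G q)"
  shows "gauge (\<lambda>j. \<one>) M = M"
  using assms by (auto simp: gauge_def mem_tuple_group fun_eq_iff)

text \<open>Translating the summation variable by \<open>u0\<close> absorbs the gauge change.
  Averages over \<open>U\<close> therefore see an input only up to gauge transformations in
  \<open>U\<close>.\<close>

lemma card_gauge_orbit:
  assumes U: "subgroup U (tuple_group G (q - 1))" and u0: "u0 \<in> U" and M: "M \<in> carrier (tuple_group G q)"
  shows "card {u \<in> U. \<psi> (gauge u (gauge u0 M))} = card {u \<in> U. \<psi> (gauge u M)}"
proof -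
  note D = subgroup_tupleD[OF U]
  have c: "u j \<in> carrier G" if "u \<in> U" for u j using tuple_closed[OF D(1)[OF that]] .
  have "bij_betw (\<lambda>u j. u0 j \<otimes> u j) {u \<in> U. \<psi> (gauge u (gauge u0 M))} {u \<in> U. \<psi> (gauge u M)}"
  proof (rule bij_betw_byWitness[where f' = "\<lambda>u j. inv (u0 j) \<otimes> u j"])
    show "\<forall>a\<in>{u \<in> U. \<psi> (gauge u (gauge u0 M))}. (\<lambda>j. inv (u0 j) \<otimes> (u0 j \<otimes> a j)) = a"
      using c u0 by (auto simp: m_assoc[symmetric])
    show 1: "\<forall>a'\<in>{u \<in> U. \<psi> (gauge u M)}. (\<lambda>j. u0 j \<otimes> (inv (u0 j) \<otimes> a' j)) = a'"
      using c u0 by (auto simp: m_assoc[symmetric])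
    have g: "gauge (\<lambda>j. u0 j \<otimes> u j) M = gauge u (gauge u0 M)" if "u \<in> U" for u
      using gauge_mult[OF D(1)[OF u0] D(1)[OF that] M] .
    show "(\<lambda>u j. u0 j \<otimes> u j) ` {u \<in> U. \<psi> (gauge u (gauge u0 M))} \<subseteq> {u \<in> U. \<psi> (gauge u M)}"
      using g D(3)[OF u0] by auto
    show "(\<lambda>u j. inv (u0 j) \<otimes> u j) ` {u \<in> U. \<psi> (gauge u M)} \<subseteq> {u \<in> U. \<psi> (gauge u (gauge u0 M))}"
    proof clarify
      fix u assume u: "u \<in> U" "\<psi> (gauge u M)"
      define v where "v = (\<lambda>j. inv (u0 j) \<otimes> u j)"
      have v: "v \<in> U" unfolding v_def using D(3)[OF D(4)[OF u0] u(1)] .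
      have "(\<lambda>j. u0 j \<otimes> v j) = u" using c u0 u by (auto simp: v_def m_assoc[symmetric])
      then have "gauge v (gauge u0 M) = gauge u M" using g[OF v] by simp
      then show "v \<in> U \<and> \<psi> (gauge v (gauge u0 M))" using v u by simp
    qed
  qed
  then show ?thesis by (rule bij_betw_same_card)
qed

definition sensitive :: "nat \<Rightarrow> ((nat \<Rightarrow> 'a) \<Rightarrow> 'c) \<Rightarrow> nat set" where
  "sensitive q F = {f \<in> {1..q}. \<exists>N\<in>carrier (tuple_group G q). \<exists>N'\<in>carrier (tuple_group G q).
      (\<forall>i. i \<noteq> f \<longrightarrow> N i = N' i) \<and> F N \<noteq> F N'}"

lemma insensitive_set:
  assumes "finite D" "D \<subseteq> {1..q}" "D \<inter> sensitive q F = {}"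
    and "N \<in> carrier (tuple_group G q)" "N' \<in> carrier (tuple_group G q)" "\<And>i. i \<notin> D \<Longrightarrow> N i = N' i"
  shows "F N = F N'"
  using assms
proof (induction D arbitrary: N)
  case empty
  then have "N = N'" by auto
  then show ?case by simp
next
  case (insert f D)
  define N1 where "N1 = N(f := N' f)"
  have N1: "N1 \<in> carrier (tuple_group G q)"
    using insert.prems(1,3,4) by (auto simp: N1_def mem_tuple_group)
  have "F N1 = F N'"
  proof (rule insert.IH)
    show "D \<subseteq> {1..q}" "D \<inter> sensitive q F = {}" "N' \<in> carrier (tuple_group G q)" using insert.prems by auto
    show "N1 i = N' i" if "i \<notin> D" for i using insert.prems(5)[of i] that by (auto simp: N1_def)
  qed (rule N1)
  moreover have "F N = F N1"
  proof (rule ccontr)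
    assume "F N \<noteq> F N1"
    moreover have "\<forall>i. i \<noteq> f \<longrightarrow> N i = N1 i" by (simp add: N1_def)
    ultimately have "f \<in> sensitive q F" using insert.prems(1,3) N1 unfolding sensitive_def by blast
    then show False using insert.prems by auto
  qed
  ultimately show ?case by simp
qed

lemma diag_tuple_all:
  assumes "\<And>j. \<tau> j \<in> iso G G" "\<And>j. j \<notin> {1..m} \<Longrightarrow> c j = 0" "w 0 = \<one>"
  shows "diag_tuple G m c \<tau> w j = \<tau> j (w (c j))"
  using assms(2)[of j] assms(3) iso_one[OF assms(1)] by (auto simp: diag_tuple_def)

text \<open>Parallel transport: demanding that the new edge keep its value determines
  \<open>w\<close> at the new vertex from its value at the old end. This can be met since the new
  vertex avoids \<open>R\<close>, in particular class \<open>0\<close>, and the twists are onto;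
  edges treated earlier do not contain the new vertex.\<close>

lemma parallel_gauge:
  assumes tree: "grown_tree q c R e a E V" and R: "a \<notin> R" "0 \<in> R"
    and \<sigma>: "\<And>j. \<sigma> j \<in> iso G G" and c: "\<And>j. j \<notin> {1..q - 1} \<Longrightarrow> c j = 0" "\<And>j. c j \<le> m"
    and am: "a \<le> m" and g: "g \<in> carrier G" and N: "N \<in> carrier (tuple_group G q)"
  shows "\<exists>w\<in>carrier (tuple_group G m). w a = g \<and> (\<forall>v. v \<notin> V \<longrightarrow> w v = \<one>)
    \<and> (\<forall>i\<in>E. gauge (diag_tuple G (q - 1) c \<sigma> w) N i = N i)"
  using tree
proof induction
  case base
  have "a \<noteq> 0" using R by metis
  then show ?case using g am by (intro bexI[of _ "(\<lambda>j. \<one>)(a := g)"]) (auto simp: mem_tuple_group)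
next
  case (step E V i v x)
  note b = grown_tree_basic[OF step.hyps(1)]
  obtain w where w: "w \<in> carrier (tuple_group G m)" "w a = g" "\<forall>v. v \<notin> V \<longrightarrow> w v = \<one>"
    "\<forall>i\<in>E. gauge (diag_tuple G (q - 1) c \<sigma> w) N i = N i" using step.IH by auto
  have \<sigma>inv: "\<exists>y\<in>carrier G. \<sigma> j y = h" if "h \<in> carrier G" for h j
    using \<sigma>[of j] that by (auto simp: iso_def bij_betw_def image_iff) (metis imageE)
  have \<sigma>c: "\<sigma> j (w v) \<in> carrier G" for j v
    using \<sigma>[of j] tuple_closed[OF w(1)] by (auto simp: iso_def hom_def)
  have Nc: "N j \<in> carrier G" for j using tuple_closed[OF N] .
  have "x \<noteq> 0" using step.hyps(8) R(2) by metis
  moreover have "x \<le> m" "v \<noteq> x"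
    using step.hyps(5-7) c(2)[of i] c(2)[of "i - 1"] by (auto simp: ends_def doubleton_eq_iff)
  ultimately have x: "x \<noteq> 0" "x \<le> m" "v \<noteq> x" by auto
  have dd: "diag_tuple G (q - 1) c \<sigma> w' j = \<sigma> j (w' (c j))" if "w' 0 = \<one>" for w' j
    using \<sigma> c(1) that by (intro diag_tuple_all) auto
  have w0: "w 0 = \<one>" using w(1) by (auto simp: mem_tuple_group)
  have xa: "x \<noteq> a" using b step.hyps(7) by auto
  have "\<exists>y\<in>carrier G. gauge (diag_tuple G (q - 1) c \<sigma> (w(x := y))) N i = N i"
  proof -
    have "(c (i - 1) = v \<and> c i = x) \<or> (c (i - 1) = x \<and> c i = v)"
      using step.hyps(5) by (auto simp: ends_def doubleton_eq_iff)
    then show ?thesis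
    proof
      assume cv: "c (i - 1) = v \<and> c i = x"
      obtain y where y: "y \<in> carrier G" "\<sigma> i y = N i \<otimes> \<sigma> (i - 1) (w v) \<otimes> inv (N i)"
        using \<sigma>inv[of "N i \<otimes> \<sigma> (i - 1) (w v) \<otimes> inv (N i)" i] Nc \<sigma>c by auto
      have "gauge (diag_tuple G (q - 1) c \<sigma> (w(x := y))) N i
          = inv (N i \<otimes> \<sigma> (i - 1) (w v) \<otimes> inv (N i)) \<otimes> N i \<otimes> \<sigma> (i - 1) (w v)"
        using dd[of "w(x := y)"] w0 x y(2) cv by (simp add: gauge_def)
      also have "\<dots> = N i" using Nc \<sigma>c by (simp add: inv_mult_group m_assoc)
      finally show ?thesis using y by auto
    next
      assume cv: "c (i - 1) = x \<and> c i = v"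
      obtain y where y: "y \<in> carrier G" "\<sigma> (i - 1) y = inv (N i) \<otimes> \<sigma> i (w v) \<otimes> N i"
        using \<sigma>inv[of "inv (N i) \<otimes> \<sigma> i (w v) \<otimes> N i" "i - 1"] Nc \<sigma>c by auto
      have "gauge (diag_tuple G (q - 1) c \<sigma> (w(x := y))) N i
          = inv (\<sigma> i (w v)) \<otimes> N i \<otimes> (inv (N i) \<otimes> \<sigma> i (w v) \<otimes> N i)"
        using dd[of "w(x := y)"] w0 x y(2) cv by (simp add: gauge_def)
      also have "\<dots> = inv (\<sigma> i (w v)) \<otimes> (N i \<otimes> inv (N i)) \<otimes> \<sigma> i (w v) \<otimes> N i"
        using Nc \<sigma>c by (simp only: m_assoc inv_closed m_closed)
      also have "\<dots> = N i" using Nc \<sigma>c by simp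
      finally show ?thesis using y by auto
    qed
  qed
  then obtain y where y: "y \<in> carrier G" "gauge (diag_tuple G (q - 1) c \<sigma> (w(x := y))) N i = N i" by auto
  have "gauge (diag_tuple G (q - 1) c \<sigma> (w(x := y))) N j = N j" if j: "j \<in> E" for j
  proof -
    have "ends c j \<subseteq> V" using b j by blast
    then have "c j \<noteq> x" "c (j - 1) \<noteq> x" using step.hyps(7) by (auto simp: ends_def)
    then have "gauge (diag_tuple G (q - 1) c \<sigma> (w(x := y))) N j = gauge (diag_tuple G (q - 1) c \<sigma> w) N j"
      using dd[of "w(x := y)"] dd[of w] w0 x by (simp add: gauge_def)
    then show ?thesis using w(4) j by simp
  qed
  then have "\<forall>j\<in>insert i E. gauge (diag_tuple G (q - 1) c \<sigma> (w(x := y))) N j = N j" using y(2) by blast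
  moreover have "w(x := y) \<in> carrier (tuple_group G m)" using w(1) y(1) x by (auto simp: mem_tuple_group)
  moreover have "(w(x := y)) a = g" "\<forall>v. v \<notin> insert x V \<longrightarrow> (w(x := y)) v = \<one>" using w(2,3) xa by auto
  ultimately show ?case by blast
qed

end

text \<open>\<open>P U k M M'\<close> says that \<open>M\<close> and \<open>M'\<close> look alike modulo
  the gauge group \<open>U\<close> as long as fewer than \<open>k\<close> coordinates are inspected.\<close>

definition (in group) indistinguishability ::
  "nat \<Rightarrow> nat \<Rightarrow> ((nat \<Rightarrow> 'a) set \<Rightarrow> nat \<Rightarrow> (nat \<Rightarrow> 'a) \<Rightarrow> (nat \<Rightarrow> 'a) \<Rightarrow> bool) \<Rightarrow> bool" where
  "indistinguishability n q P \<longleftrightarrow>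
    (\<forall>U k M M'. P U k M M' \<longrightarrow> k \<ge> 1 \<and> subgroup U (tuple_group G (q - 1)) \<and>
       M \<in> carrier (tuple_group G q) \<and> M' \<in> carrier (tuple_group G q)) \<and>
    (\<forall>U k M M'. P U k M M' \<longrightarrow> k \<ge> 2 \<longrightarrow> (\<forall>i\<in>{1..q}. (\<exists>u\<in>U. gauge u M i = M' i) \<or>
       carrier G \<subseteq> (\<lambda>u. u i) ` U \<or> carrier G \<subseteq> (\<lambda>u. u (i - 1)) ` U)) \<and>
    (\<forall>U k M M' \<psi> H. P U k M M' \<longrightarrow>
       card {u \<in> U. \<psi> (gauge u M)} \<noteq> card {u \<in> U. \<psi> (gauge u M')} \<longrightarrow>
       subgroup H (tuple_group G (q - 1)) \<longrightarrow> H \<subseteq> U \<longrightarrow>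
       (\<exists>t k' U' N N'. U' \<subseteq> H \<and> card H * n ^ t \<le> card U \<and> k \<le> (t + 1) * k' \<and>
          P U' k' N N' \<and> \<psi> N \<noteq> \<psi> N'))"

text \<open>The last two facts are what literals and gates consume. The alternatives in the literal
  fact admit a coordinate where the inputs do differ: if all of \<open>G\<close> acts at one end of
  that edge, a literal invariant under \<open>U\<close> cannot notice the difference. In the gate
  fact the group shrinks to \<open>U'\<close>, but only the index of \<open>H\<close> is
  charged.\<close>

lemma (in group) indistinguishabilityD:
  assumes "indistinguishability n q P" "P U k M M'"
  shows "1 \<le> k" "subgroup U (tuple_group G (q - 1))" "M \<in> carrier (tuple_group G q)" "M' \<in> carrier (tuple_group G q)"
    and "2 \<le> k \<Longrightarrow> i \<in> {1..q} \<Longrightarrow>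
      (\<exists>u\<in>U. gauge u M i = M' i) \<or> carrier G \<subseteq> (\<lambda>u. u i) ` U \<or> carrier G \<subseteq> (\<lambda>u. u (i - 1)) ` U"
    and "card {u \<in> U. \<psi> (gauge u M)} \<noteq> card {u \<in> U. \<psi> (gauge u M')} \<Longrightarrow>
      subgroup H (tuple_group G (q - 1)) \<Longrightarrow> H \<subseteq> U \<Longrightarrow>
      \<exists>t k' U' N N'. U' \<subseteq> H \<and> card H * n ^ t \<le> card U \<and> k \<le> (t + 1) * k' \<and> P U' k' N N' \<and> \<psi> N \<noteq> \<psi> N'"
  using assms(1)[unfolded indistinguishability_def, THEN conjunct1, rule_format, OF assms(2)]
    assms(1)[unfolded indistinguishability_def, THEN conjunct2, THEN conjunct1, rule_format, OF assms(2)]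
    assms(1)[unfolded indistinguishability_def, THEN conjunct2, THEN conjunct2, rule_format, OF assms(2)]
  by simp_all

text \<open>That every class \<open>1, ..., m\<close> is hit by \<open>c\<close> makes the
  parametrisation of \<open>U\<close> injective, so that \<open>U\<close> has order
  \<open>card (carrier G) ^ m\<close>, the number against which stabilizers are measured.\<close>

definition (in group) diag_state where
  "diag_state q U k M M' \<longleftrightarrow> 1 \<le> k \<and> M \<in> carrier (tuple_group G q) \<and> M' \<in> carrier (tuple_group G q) \<and>
    (\<exists>m c \<sigma> e b. (\<forall>j. j \<notin> {1..q - 1} \<longrightarrow> c j = 0) \<and> (\<forall>j. c j \<le> m) \<and> {1..m} \<subseteq> c ` {1..q - 1} \<and>
      (\<forall>j. \<sigma> j \<in> iso G G) \<and> U = diag_tuple G (q - 1) c \<sigma> ` carrier (tuple_group G m) \<and>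
      e \<in> {1..q} \<and> far q c e b k \<and> (\<forall>i. i \<noteq> e \<longrightarrow> M i = M' i))"

context group
begin

lemma inj_on_diag_tuple:
  assumes "\<And>j. \<sigma> j \<in> iso G G" "{1..m} \<subseteq> c ` {1..r}"
  shows "inj_on (diag_tuple G r c \<sigma>) (carrier (tuple_group G m))"
proof (rule inj_onI)
  fix u v assume uv: "u \<in> carrier (tuple_group G m)" "v \<in> carrier (tuple_group G m)"
    "diag_tuple G r c \<sigma> u = diag_tuple G r c \<sigma> v"
  show "u = v"
  proof
    fix x
    show "u x = v x"
    proof (cases "x \<in> {1..m}")
      case True
      then obtain j where j: "j \<in> {1..r}" "c j = x" using assms(2) by auto
      then have "\<sigma> j (u x) = \<sigma> j (v x)" using fun_cong[OF uv(3), of j] by (simp add: diag_tuple_def)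
      then show ?thesis using assms(1)[of j] tuple_closed[OF uv(1)] tuple_closed[OF uv(2)]
        by (auto simp: iso_def bij_betw_def dest: inj_onD)
    next
      case False
      then show ?thesis using uv by (simp add: mem_tuple_group)
    qed
  qed
qed

lemma subgroup_diag_image:
  assumes "\<And>j. \<sigma> j \<in> iso G G"
  shows "subgroup (diag_tuple G r c \<sigma> ` carrier (tuple_group G m)) (tuple_group G r)"
proof (rule subgroup_tupleI)
  interpret T: group "tuple_group G m" by (rule group_tuple_group)
  have d1: "diag_tuple G r c \<sigma> w \<in> carrier (tuple_group G r)" if "w \<in> carrier (tuple_group G m)" for w
    using diag_tuple_closed[of \<sigma>, OF assms that] .
  show "diag_tuple G r c \<sigma> ` carrier (tuple_group G m) \<subseteq> carrier (tuple_group G r)" using d1 by auto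
  show "(\<lambda>j. \<one>) \<in> diag_tuple G r c \<sigma> ` carrier (tuple_group G m)"
    using T.one_closed assms by (intro image_eqI[of _ _ "\<lambda>j. \<one>"]) (simp_all add: diag_tuple_one)
  show "(\<lambda>j. u j \<otimes> v j) \<in> diag_tuple G r c \<sigma> ` carrier (tuple_group G m)"
    if uv: "u \<in> diag_tuple G r c \<sigma> ` carrier (tuple_group G m)" "v \<in> diag_tuple G r c \<sigma> ` carrier (tuple_group G m)" for u v
  proof -
    obtain x y where xy: "x \<in> carrier (tuple_group G m)" "y \<in> carrier (tuple_group G m)"
      "u = diag_tuple G r c \<sigma> x" "v = diag_tuple G r c \<sigma> y" using uv by auto
    have "(\<lambda>j. x j \<otimes> y j) \<in> carrier (tuple_group G m)" using T.m_closed[OF xy(1,2)] by simp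
    then show ?thesis unfolding xy(3,4) using assms xy(1,2)
      by (intro image_eqI[of _ _ "\<lambda>j. x j \<otimes> y j"]) (simp_all add: diag_tuple_mult)
  qed
  show "(\<lambda>j. inv (u j)) \<in> diag_tuple G r c \<sigma> ` carrier (tuple_group G m)"
    if u: "u \<in> diag_tuple G r c \<sigma> ` carrier (tuple_group G m)" for u
  proof -
    obtain x where x: "x \<in> carrier (tuple_group G m)" "u = diag_tuple G r c \<sigma> x" using u by auto
    have "(\<lambda>j. inv (x j)) \<in> carrier (tuple_group G m)"
      using T.inv_closed[OF x(1)] inv_tuple_group[OF x(1)] by simp
    then show ?thesis unfolding x(2) using assms x(1)
      by (intro image_eqI[of _ _ "\<lambda>j. inv (x j)"]) (simp_all add: diag_tuple_inv)
  qed
qed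

lemma iso_compose: "f \<in> iso G G \<Longrightarrow> g \<in> iso G G \<Longrightarrow> f \<circ> g \<in> iso G G"
  by (auto simp: iso_def hom_def Pi_iff intro: bij_betw_trans)

end

text \<open>\<open>k'\<close> is \<open>k / (t + 1)\<close> rounded up: the least value for the
  second claim, which the size bounds need, and the greatest for the third, which the gluing
  argument needs.\<close>

lemma ceiling_quotient:
  fixes k t :: nat
  assumes "1 \<le> k"
  defines "k' \<equiv> (k + t) div (t + 1)"
  shows "1 \<le> k'" "k \<le> (t + 1) * k'" "(t + 1) * (k' - 1) < k"
proof -
  have m: "(k + t) mod (t + 1) < t + 1" by simp
  have e: "(t + 1) * k' + (k + t) mod (t + 1) = k + t" unfolding k'_def by (rule mult_div_mod_eq)
  show "k \<le> (t + 1) * k'" using e m by linarith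
  then show 1: "1 \<le> k'" using assms(1) by (cases k') auto
  have "(t + 1) * (k' - 1) = (t + 1) * k' - (t + 1)" by (simp add: diff_mult_distrib2)
  then show "(t + 1) * (k' - 1) < k" using e assms(1) by linarith
qed

section \<open>One gate in the nonabelian case\<close>

context nonabelian_simple_group
begin

lemma diag_state_step:
  assumes st: "diag_state q U k M M'"
    and ne: "card {u \<in> U. \<psi> (gauge u M)} \<noteq> card {u \<in> U. \<psi> (gauge u M')}"
    and H: "subgroup H (tuple_group G (q - 1))" "H \<subseteq> U"
  shows "\<exists>t k' U' N N'. U' \<subseteq> H \<and> card H * n ^ t \<le> card U \<and> k \<le> (t + 1) * k' \<and>
          diag_state q U' k' N N' \<and> \<psi> N \<noteq> \<psi> N'"
proof -
  obtain m c \<sigma> e b where k: "1 \<le> k" and M: "M \<in> carrier (tuple_group G q)" "M' \<in> carrier (tuple_group G q)"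
    and c: "\<And>j. j \<notin> {1..q - 1} \<Longrightarrow> c j = 0" "\<And>j. c j \<le> m" "{1..m} \<subseteq> c ` {1..q - 1}"
    and \<sigma>: "\<And>j. \<sigma> j \<in> iso G G" and U: "U = diag_tuple G (q - 1) c \<sigma> ` carrier (tuple_group G m)"
    and e: "e \<in> {1..q}" "far q c e b k" "\<And>i. i \<noteq> e \<Longrightarrow> M i = M' i"
    using st unfolding diag_state_def by blast
  let ?d = "diag_tuple G (q - 1) c \<sigma>"
  have q: "1 \<le> q" using e by auto
  have subU: "subgroup U (tuple_group G (q - 1))" unfolding U using \<sigma> by (rule subgroup_diag_image)
  note HD = subgroup_tupleD[OF H(1)]
  have UC: "u \<in> U \<Longrightarrow> u \<in> carrier (tuple_group G (q - 1))" for u using subgroup_tupleD(1)[OF subU] .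
  \<comment> \<open>The average over \<open>U\<close> is treated as a function of the input in its
    own right; edges it ignores may be changed freely when the two inputs are compared.\<close>
  define F where "F = (\<lambda>N. card {u \<in> U. \<psi> (gauge u N)})"
  define S where "S = sensitive q F"
  have eS: "e \<in> S" unfolding S_def sensitive_def F_def using e(1,3) M ne by blast
  have dd: "?d w j = \<sigma> j (w (c j))" if "w 0 = \<one>" for w j
    using \<sigma> c(1) that by (intro diag_tuple_all) auto
  interpret T: group "tuple_group G m" by (rule group_tuple_group)
  \<comment> \<open>If no sensitive edge left the tree, the difference at \<open>e\<close> could be
    gauged away: transport along the tree turns \<open>M'\<close> into an input that differs from
    \<open>M\<close> only on edges ignored by \<open>F\<close>, contradicting
    \<open>ne\<close>.\<close>
  have SP: "\<exists>f\<in>S. f \<noteq> e \<and> f \<notin> E \<and> ends c f \<inter> V \<noteq> {}"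
    if k1: "1 < k" and tree: "grown_tree q c {0, c (tail_of e b)} e (c (head_of e b)) E V" for E V
  proof (rule ccontr)
    assume "\<not> ?thesis"
    then have no: "\<And>f. f \<in> S \<Longrightarrow> f \<noteq> e \<Longrightarrow> f \<notin> E \<Longrightarrow> ends c f \<inter> V = {}" by blast
    define a z where "a = c (head_of e b)" and "z = c (tail_of e b)"
    have aR: "a \<notin> {0, z}" using e(2) k1 by (auto simp: far_def a_def z_def)
    have tree': "grown_tree q c {0, z} e a E V" using tree by (simp add: a_def z_def)
    have VR: "V \<inter> {0, z} \<subseteq> {a}" and eE: "e \<notin> E" using grown_tree_basic[OF tree'] by simp_all
    have zV: "z \<notin> V" using VR aR by blast
    have Mc: "M i \<in> carrier G" "M' i \<in> carrier G" for i using tuple_closed M by auto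
    \<comment> \<open>The value at the head that turns \<open>M' e\<close> into \<open>M e\<close>
      while the tail stays trivial. The head is on the left or on the right of the edge label
      according to the orientation.\<close>
    define h where "h = (if b then M' e \<otimes> inv (M e) else inv (M' e) \<otimes> M e)"
    have hc: "h \<in> carrier G" using Mc by (auto simp: h_def)
    then have "h \<in> \<sigma> (head_of e b) ` carrier G" using \<sigma>[of "head_of e b"] by (simp add: iso_def bij_betw_def)
    then obtain g where g: "g \<in> carrier G" "\<sigma> (head_of e b) g = h" by auto
    have "\<exists>w\<in>carrier (tuple_group G m). w a = g \<and> (\<forall>v. v \<notin> V \<longrightarrow> w v = \<one>)
        \<and> (\<forall>i\<in>E. gauge (?d w) M' i = M' i)"
    proof (rule parallel_gauge[OF tree' aR])
      show "a \<le> m" using c(2) by (simp add: a_def)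
    qed (use \<sigma> c(1,2) g(1) M(2) in auto)
    then obtain w where w: "w \<in> carrier (tuple_group G m)" "w a = g" "\<forall>v. v \<notin> V \<longrightarrow> w v = \<one>"
      "\<forall>i\<in>E. gauge (?d w) M' i = M' i" by blast
    have w0: "w 0 = \<one>" using w(1) by (auto simp: mem_tuple_group)
    define u where "u = ?d w"
    have uU: "u \<in> U" using w(1) by (auto simp: u_def U)
    have ue: "u (head_of e b) = h" "u (tail_of e b) = \<one>"
      using dd[of w, OF w0] w(2,3) g(2) zV iso_one[OF \<sigma>] by (auto simp: u_def a_def z_def)
    have ge: "gauge u M' e = M e"
    proof (cases b)
      case True
      then show ?thesis using ue Mc
        by (simp add: gauge_def head_of_def tail_of_def h_def inv_mult_group m_assoc)
    next
      case False
      then show ?thesis using ue Mc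
        by (simp add: gauge_def head_of_def tail_of_def h_def m_assoc[symmetric])
    qed
    define D where "D = {i \<in> {1..q}. i \<noteq> e \<and> i \<notin> E \<and> ends c i \<inter> V \<noteq> {}}"
    have gC: "gauge u M' \<in> carrier (tuple_group G q)" using gauge_closed[OF UC[OF uU] M(2) q] .
    have "M i = gauge u M' i" if "i \<notin> D" for i
    proof -
      consider "i \<notin> {1..q}" | "i = e" | "i \<in> E" | "i \<noteq> e" "ends c i \<inter> V = {}" using \<open>i \<notin> D\<close> by (auto simp: D_def)
      then show ?thesis
      proof cases
        case 1
        then show ?thesis using M(1) gC by (simp add: mem_tuple_group)
      next
        case 2 then show ?thesis using ge by simp
      next
        case 3
        then have "M i = M' i" using e(3) eE by metis
        then show ?thesis using w(4) 3 by (simp add: u_def)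
      next
        case 4
        then have "w (c i) = \<one>" "w (c (i - 1)) = \<one>" using w(3) by (auto simp: ends_def)
        then have "u i = \<one>" "u (i - 1) = \<one>" using dd[of w, OF w0] iso_one[OF \<sigma>] by (auto simp: u_def)
        then show ?thesis using e(3)[OF 4(1)] Mc by (simp add: gauge_def)
      qed
    qed
    moreover have "D \<inter> sensitive q F = {}" using no by (auto simp: D_def S_def)
    moreover have "finite D" "D \<subseteq> {1..q}" by (auto simp: D_def)
    ultimately have "F M = F (gauge u M')"
      using insensitive_set[of D q F M "gauge u M'"] M(1) gC by blast
    also have "\<dots> = F M'" unfolding F_def using card_gauge_orbit[OF subU uU M(2)] .
    finally show False using ne by (simp add: F_def)
  qed
  \<comment> \<open>Goursat's lemma is applied to the parameters: \<open>H\<close> is pulled back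
    along the injective map \<open>?d\<close>, and the two class maps are composed
    afterwards.\<close>
  define H' where "H' = {w \<in> carrier (tuple_group G m). ?d w \<in> H}"
  have subH': "subgroup H' (tuple_group G m)"
  proof (rule subgroup_tupleI)
    show "(\<lambda>j. \<one>) \<in> H'" using T.one_closed HD(2) \<sigma> by (simp add: H'_def diag_tuple_one)
    show "(\<lambda>j. u j \<otimes> v j) \<in> H'" if "u \<in> H'" "v \<in> H'" for u v
      using that HD(3)[of "?d u" "?d v"] diag_tuple_mult[of \<sigma> u m v "q - 1" c] \<sigma> T.m_closed[of u v]
      by (simp add: H'_def)
    show "(\<lambda>j. inv (u j)) \<in> H'" if "u \<in> H'" for u
      using that HD(4)[of "?d u"] diag_tuple_inv[of \<sigma> u m "q - 1" c] \<sigma> T.inv_closed[of u] inv_tuple_group[of u m]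
      by (simp add: H'_def)
  qed (auto simp: H'_def)
  obtain m' d \<tau> where g: "m' \<le> m" "\<And>j. j \<notin> {1..m} \<Longrightarrow> d j = 0" "\<And>j. d j \<le> m'" "{1..m'} \<subseteq> d ` {1..m}"
    "\<And>j. \<tau> j \<in> iso G G" "\<And>w. w \<in> carrier (tuple_group G m') \<Longrightarrow> diag_tuple G m d \<tau> w \<in> H'"
    "card H' * n ^ (m - m') \<le> card (carrier G) ^ m"
    using twisted_diagonal_in_subgroup[OF subH'] by blast
  have injd: "inj_on ?d (carrier (tuple_group G m))" using \<sigma> c(3) by (rule inj_on_diag_tuple)
  have "?d ` H' = H" using H(2) by (auto simp: H'_def U)
  then have cH: "card H = card H'" using card_image[OF inj_on_subset[OF injd, of H']] by (auto simp: H'_def)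
  have cU: "card U = card (carrier G) ^ m"
    using card_image[OF injd] card_tuple_group[OF finite_carrier] by (simp add: U)
  define t where "t = m - m'"
  define k' where "k' = (k + t) div (t + 1)"
  note kk = ceiling_quotient[OF k, of t, folded k'_def]
  have "\<exists>f\<in>S. \<exists>b'. far q (d \<circ> c) f b' k'"
  proof (rule far_after_merging)
    show "far q c e b k" "e \<in> S" by fact+
    show "S \<subseteq> {1..q}" by (auto simp: S_def sensitive_def)
    show "c j \<le> m" "d j \<le> m'" for j by (fact c(2) g(3))+
    show "d 0 = 0" "{1..m'} \<subseteq> d ` {1..m}" "m' \<le> m" using g(1,2,4) by auto
    show "(m - m' + 1) * (k' - 1) < k" using kk(3) by (simp add: t_def)
  qed (rule SP)
  then obtain f b' where f: "f \<in> S" "far q (d \<circ> c) f b' k'" by blast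
  then obtain N N' where N: "N \<in> carrier (tuple_group G q)" "N' \<in> carrier (tuple_group G q)"
    "\<And>i. i \<noteq> f \<Longrightarrow> N i = N' i" "F N \<noteq> F N'" by (auto simp: S_def sensitive_def)
  \<comment> \<open>Different averages mean that a single \<open>u\<close> separates the pair.
    Gauging both inputs by it keeps them equal off \<open>f\<close>.\<close>
  have "\<exists>u\<in>U. \<psi> (gauge u N) \<noteq> \<psi> (gauge u N')"
  proof (rule ccontr)
    assume "\<not> ?thesis"
    then have "{u \<in> U. \<psi> (gauge u N)} = {u \<in> U. \<psi> (gauge u N')}" by blast
    then show False using N(4) by (simp add: F_def)
  qed
  then obtain u where u: "u \<in> U" "\<psi> (gauge u N) \<noteq> \<psi> (gauge u N')" by auto
  define \<rho> where "\<rho> = (\<lambda>j. \<sigma> j \<circ> \<tau> (c j))"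
  have \<rho>: "\<rho> j \<in> iso G G" for j using iso_compose[OF \<sigma> g(5)] by (simp add: \<rho>_def)
  have dc0: "(d \<circ> c) j = 0" if "j \<notin> {1..q - 1}" for j using c(1)[OF that] g(2)[of 0] by simp
  have comp: "diag_tuple G (q - 1) (d \<circ> c) \<rho> w = ?d (diag_tuple G m d \<tau> w)"
    if w: "w \<in> carrier (tuple_group G m')" for w
  proof
    fix j
    have w0: "w 0 = \<one>" using w by (auto simp: mem_tuple_group)
    have 1: "diag_tuple G m d \<tau> w x = \<tau> x (w (d x))" for x
      using g(2,5) w0 by (intro diag_tuple_all) auto
    have "diag_tuple G m d \<tau> w 0 = \<one>" by (simp add: diag_tuple_def)
    from dd[of "diag_tuple G m d \<tau> w" j, OF this] 1[of "c j"]
    have "?d (diag_tuple G m d \<tau> w) j = \<rho> j (w ((d \<circ> c) j))" by (simp add: \<rho>_def)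
    moreover have "diag_tuple G (q - 1) (d \<circ> c) \<rho> w j = \<rho> j (w ((d \<circ> c) j))"
      using \<rho> dc0 w0 by (intro diag_tuple_all) auto
    ultimately show "diag_tuple G (q - 1) (d \<circ> c) \<rho> w j = ?d (diag_tuple G m d \<tau> w) j" by simp
  qed
  define U' where "U' = diag_tuple G (q - 1) (d \<circ> c) \<rho> ` carrier (tuple_group G m')"
  have "U' \<subseteq> H"
  proof
    fix x assume "x \<in> U'"
    then obtain w where w: "w \<in> carrier (tuple_group G m')" "x = ?d (diag_tuple G m d \<tau> w)"
      using comp by (auto simp: U'_def)
    then show "x \<in> H" using g(6)[OF w(1)] by (simp add: H'_def)
  qed
  moreover have "card H * n ^ t \<le> card U" using g(7) cH cU by (simp add: t_def)
  moreover have "diag_state q U' k' (gauge u N) (gauge u N')"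
  proof -
    have "{1..m'} \<subseteq> (d \<circ> c) ` {1..q - 1}"
    proof
      fix x assume "x \<in> {1..m'}"
      then obtain y where y: "y \<in> {1..m}" "x = d y" using g(4) by auto
      then obtain j where "j \<in> {1..q - 1}" "y = c j" using c(3) by auto
      then show "x \<in> (d \<circ> c) ` {1..q - 1}" using y by auto
    qed
    moreover have "\<forall>i. i \<noteq> f \<longrightarrow> gauge u N i = gauge u N' i" using N(3) by (simp add: gauge_def)
    moreover have "f \<in> {1..q}" using f(1) by (auto simp: S_def sensitive_def)
    moreover have "gauge u N \<in> carrier (tuple_group G q)" "gauge u N' \<in> carrier (tuple_group G q)"
      using gauge_closed[OF UC[OF u(1)] _ q] N(1,2) by auto
    moreover have "\<forall>j. j \<notin> {1..q - 1} \<longrightarrow> (d \<circ> c) j = 0" "\<forall>j. (d \<circ> c) j \<le> m'" using dc0 g(3) by auto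
    ultimately show ?thesis unfolding diag_state_def using kk(1) \<rho> f(2) U'_def by blast
  qed
  ultimately show ?thesis using kk(2) u(2) by blast
qed

text \<open>Off \<open>e\<close> the inputs agree and the unit serves. At \<open>e\<close>, farness
  with \<open>k\<close> at least \<open>2\<close> keeps the head out of class \<open>0\<close>, so
  the gauge value at the head is arbitrary.\<close>

lemma diag_state_leaf:
  assumes "diag_state q U k M M'" "2 \<le> k" "i \<in> {1..q}"
  shows "(\<exists>u\<in>U. gauge u M i = M' i) \<or> carrier G \<subseteq> (\<lambda>u. u i) ` U \<or> carrier G \<subseteq> (\<lambda>u. u (i - 1)) ` U"
proof -
  obtain m c \<sigma> e b where M: "M \<in> carrier (tuple_group G q)" "M' \<in> carrier (tuple_group G q)"
    and c: "\<And>j. j \<notin> {1..q - 1} \<Longrightarrow> c j = 0" "\<And>j. c j \<le> m"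
    and \<sigma>: "\<And>j. \<sigma> j \<in> iso G G" and U: "U = diag_tuple G (q - 1) c \<sigma> ` carrier (tuple_group G m)"
    and e: "far q c e b k" "\<And>i. i \<noteq> e \<Longrightarrow> M i = M' i"
    using assms(1) unfolding diag_state_def by blast
  show ?thesis
  proof (cases "i = e")
    case False
    have "(\<lambda>j. \<one>) \<in> U"
      using subgroup_tupleD(2)[OF subgroup_diag_image[of \<sigma>]] \<sigma> unfolding U by blast
    then show ?thesis using e(2)[OF False] gauge_one[OF M(1)] by (intro disjI1 bexI[of _ "\<lambda>j. \<one>"]) auto
  next
    case True
    define j where "j = head_of e b"
    have a: "c j \<noteq> 0" using e(1) assms(2) by (auto simp: far_def j_def)
    have "carrier G \<subseteq> (\<lambda>u. u j) ` U"
    proof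
      fix g assume g: "g \<in> carrier G"
      then have "g \<in> \<sigma> j ` carrier G" using \<sigma>[of j] by (simp add: iso_def bij_betw_def)
      then obtain y where y: "y \<in> carrier G" "\<sigma> j y = g" by auto
      define w where "w = (\<lambda>x::nat. \<one>)(c j := y)"
      have w: "w \<in> carrier (tuple_group G m)" using y a c(2) by (auto simp: w_def mem_tuple_group)
      have "diag_tuple G (q - 1) c \<sigma> w j = \<sigma> j (w (c j))"
        using \<sigma> c(1) a by (intro diag_tuple_all) (auto simp: w_def)
      then have "diag_tuple G (q - 1) c \<sigma> w j = g" using y by (simp add: w_def)
      then show "g \<in> (\<lambda>u. u j) ` U" using w unfolding U by (metis imageI)
    qed
    then show ?thesis using True by (auto simp: j_def head_of_def split: if_splits)
  qed
qed

lemma indistinguishability_diag_state: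
  "indistinguishability n q (diag_state q)"
  unfolding indistinguishability_def
proof (intro conjI allI impI)
  fix U k M M' assume st: "diag_state q U k M M'"
  then show "1 \<le> k" "M \<in> carrier (tuple_group G q)" "M' \<in> carrier (tuple_group G q)"
    by (auto simp: diag_state_def)
  show "subgroup U (tuple_group G (q - 1))"
    using st subgroup_diag_image unfolding diag_state_def by metis
next
  fix U k M M' assume "diag_state q U k M M'" "2 \<le> k"
  then show "\<forall>i\<in>{1..q}. (\<exists>u\<in>U. gauge u M i = M' i) \<or>
       carrier G \<subseteq> (\<lambda>u. u i) ` U \<or> carrier G \<subseteq> (\<lambda>u. u (i - 1)) ` U"
    using diag_state_leaf by blast
next
  fix U k M M' \<psi> H
  assume "diag_state q U k M M'" "card {u \<in> U. \<psi> (gauge u M)} \<noteq> card {u \<in> U. \<psi> (gauge u M')}"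
    "subgroup H (tuple_group G (q - 1))" "H \<subseteq> U"
  then show "\<exists>t k' U' N N'. U' \<subseteq> H \<and> card H * n ^ t \<le> card U \<and> k \<le> (t + 1) * k' \<and>
          diag_state q U' k' N N' \<and> \<psi> N \<noteq> \<psi> N'"
    by (rule diag_state_step)
qed

text \<open>Vertices \<open>0\<close> and \<open>q\<close> both have class \<open>0\<close>, so the
  path is a cycle through the root. Starting at vertex \<open>1\<close> with edge \<open>1\<close>
  forbidden, the only possible growth is to the right.\<close>

lemma path_grown_tree:
  assumes "grown_tree q (\<lambda>j. if j \<in> {1..q - 1} then j else 0) {0} 1 1 E V" "2 \<le> q"
  shows "E = {2..card E + 1} \<and> V = {1..card E + 1} \<and> card E + 1 \<le> q - 1"
  using assms
proof induction
  case base then show ?case by auto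
next
  case (step E V i v w)
  define r where "r = card E + 1"
  have ih: "E = {2..r}" "V = {1..r}" "r \<le> q - 1" using step by (auto simp: r_def)
  have i: "i = r + 1" "w = r + 1" "r + 1 \<le> q - 1"
    using step.hyps(2-8) ih step.prems
    by (auto simp: ends_def doubleton_eq_iff split: if_splits)
  have "finite E" using ih(1) by (metis finite_atLeastAtMost)
  then have "card (insert i E) = r" using card_insert_disjoint[OF _ step.hyps(3)] unfolding r_def by presburger
  moreover have "1 \<le> r" by (simp add: r_def)
  then have "insert i E = {2..r + 1}" "insert w V = {1..r + 1}" unfolding ih(1,2) i(1,2) by auto
  ultimately show ?case using i(3) by metis
qed

lemma diag_state_initial:
  assumes "1 \<le> q" "M \<in> carrier (tuple_group G q)" "M' \<in> carrier (tuple_group G q)" "\<And>i. i \<noteq> 1 \<Longrightarrow> M i = M' i"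
  shows "diag_state q (carrier (tuple_group G (q - 1))) q M M'"
proof -
  define c where "c = (\<lambda>j. if j \<in> {1..q - 1} then j else 0)"
  have far: "far q c 1 True q"
  proof (cases "q \<le> 1")
    case True then show ?thesis by (simp add: far_def)
  next
    case False
    have h: "c (head_of 1 True) = 1" "c (tail_of 1 True) = 0" using False by (auto simp: c_def head_of_def tail_of_def)
    have "q \<le> card E + 2" if t: "grown_tree q c {0} 1 1 E V" "closing_edge q c {0} 1 E V g" for E V g
    proof -
      \<comment> \<open>Nothing closes before the growth has passed all inner vertices, so the
        closing edge is edge \<open>q\<close>. The tree then has \<open>q - 2\<close> edges; edge
        \<open>1\<close> and edge \<open>q\<close> account for the other two.\<close>
      define r where "r = card E + 1"
      have ih: "E = {2..r}" "V = {1..r}" "r \<le> q - 1"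
        using path_grown_tree[of q E V] t(1) False unfolding c_def r_def by simp_all
      have g: "g \<in> {1..q}" "g \<notin> E" "g \<noteq> 1" "{c (g - 1), c g} \<subseteq> V \<union> {0}" "{c (g - 1), c g} \<inter> V \<noteq> {}"
        using t(2) by (simp_all only: closing_edge_def ends_def simp_thms)
      have gr: "r < g" using g(1-3) ih(1) by auto
      then have "c g \<notin> V" by (auto simp: c_def ih(2))
      then have "c (g - 1) \<in> V" using g(5) by auto
      then have "g = r + 1" using gr by (auto simp: c_def ih(2) split: if_splits)
      moreover have "c g = 0" using \<open>c g \<notin> V\<close> g(4) by auto
      ultimately have "\<not> r + 1 \<le> q - 1" by (auto simp: c_def split: if_splits)
      then show ?thesis using r_def by linarith
    qed
    then show ?thesis unfolding far_def h insert_absorb2 by simp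
  qed
  have U: "carrier (tuple_group G (q - 1)) = diag_tuple G (q - 1) c (\<lambda>j x. x) ` carrier (tuple_group G (q - 1))"
  proof -
    have "diag_tuple G (q - 1) c (\<lambda>j x. x) w = w" if "w \<in> carrier (tuple_group G (q - 1))" for w
      using that by (auto simp: diag_tuple_def c_def mem_tuple_group fun_eq_iff)
    then show ?thesis by (auto simp: image_iff)
  qed
  have c: "{1..q - 1} \<subseteq> c ` {1..q - 1}" "\<forall>j. j \<notin> {1..q - 1} \<longrightarrow> c j = 0" "\<forall>j. c j \<le> q - 1"
    by (auto simp: c_def image_iff)
  have i: "\<forall>j::nat. (\<lambda>x. x) \<in> iso G G" by (simp add: iso_set_refl)
  have e: "1 \<in> {1..q}" "\<forall>i. i \<noteq> 1 \<longrightarrow> M i = M' i" using assms by auto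
  show ?thesis unfolding diag_state_def
    by (rule conjI[OF assms(1) conjI[OF assms(2) conjI[OF assms(3)]]],
        rule exI[of _ "q - 1"], rule exI[of _ c], rule exI[of _ "\<lambda>j x. x"], rule exI[of _ 1], rule exI[of _ True],
        intro conjI c U i e far)
qed

end

section \<open>Abelian simple groups\<close>

locale abelian_simple_group = index_bounded_group + simple_group +
  assumes comm: "x \<in> carrier G \<Longrightarrow> y \<in> carrier G \<Longrightarrow> x \<otimes> y = y \<otimes> x"
begin

text \<open>Sylow's theorem with exponent \<open>1\<close> supplies a subgroup of prime order; it is
  normal by commutativity, hence all of \<open>G\<close>. The bound on \<open>n\<close> is the index
  bound for the trivial subgroup.\<close>

lemma prime_order: "prime (card (carrier G))" and degree_le_order: "n \<le> card (carrier G)"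
proof -
  have "order G \<noteq> 1" using order_gt_one by simp
  then obtain p where p: "prime p" "p dvd order G" using prime_factor_nat by blast
  then obtain m where "order G = p ^ 1 * m" by auto
  from sylow_thm[OF p(1) is_group this finite_carrier]
  obtain H where H: "subgroup H G" "card H = p" by auto
  have "H \<lhd> G"
  proof (rule normal_invI[OF H(1)])
    fix x h assume "x \<in> carrier G" "h \<in> H"
    moreover from this have "h \<in> carrier G" using subgroup.mem_carrier[OF H(1)] by simp
    ultimately show "x \<otimes> h \<otimes> inv x \<in> H" using comm[of x h] by (simp add: m_assoc)
  qed
  then have "H = carrier G \<or> H = {\<one>}" by (rule no_real_normal_subgroup)
  moreover have "p \<noteq> 1" using p(1) by auto
  ultimately have "H = carrier G" using H(2) by auto
  then show "prime (card (carrier G))" using H(2) p(1) by simp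
  have "{\<one>} \<noteq> carrier G" using simple_not_triv by auto
  then show "n \<le> card (carrier G)" using index_bound[OF triv_subgroup] by simp
qed

text \<open>Both orders are powers of the prime order of \<open>G\<close>, so a strict inclusion has
  index at least this prime, which is at least \<open>n\<close>.\<close>

lemma tuple_subgroup_index:
  assumes "subgroup A (tuple_group G m)" "subgroup B (tuple_group G m)" "A \<subset> B"
  shows "card A * n \<le> card B"
proof -
  interpret T: group "tuple_group G m" by (rule group_tuple_group)
  let ?p = "card (carrier G)"
  have fin: "finite (carrier (tuple_group G m))" "card (carrier (tuple_group G m)) = ?p ^ m"
    using card_tuple_group[OF finite_carrier] by auto
  have finB: "finite B" using finite_subset[OF subgroup.subset[OF assms(2)] fin(1)] .
  have "card B dvd ?p ^ m" using T.lagrange[OF assms(2)] fin(2) by (metis dvd_triv_right order_def)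
  then obtain i where i: "card B = ?p ^ i" using divides_primepow_nat[OF prime_order] by blast
  have "card A dvd ?p ^ m" using T.lagrange[OF assms(1)] fin(2) by (metis dvd_triv_right order_def)
  then obtain j where j: "card A = ?p ^ j" using divides_primepow_nat[OF prime_order] by blast
  have p1: "1 < ?p" using prime_order prime_gt_1_nat by blast
  have "card A < card B" using psubset_card_mono[OF finB assms(3)] .
  then have "j < i" using i j p1 by simp
  then have "?p ^ Suc j \<le> ?p ^ i" using p1 by (intro power_increasing) auto
  moreover have "card A * n \<le> ?p ^ Suc j" using j degree_le_order by (simp add: mult.commute)
  ultimately show ?thesis using i by linarith
qed

text \<open>No merged path is available for an abelian group, so the state speaks directly about the
  sets of coordinates that may be inspected.\<close>

definition blind_state where
  "blind_state q U k M M' \<longleftrightarrow> 1 \<le> k \<and> 1 \<le> q \<and> subgroup U (tuple_group G (q - 1)) \<and>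
     M \<in> carrier (tuple_group G q) \<and> M' \<in> carrier (tuple_group G q) \<and>
     (\<forall>T\<subseteq>{1..q}. card T < k \<longrightarrow> (\<exists>u\<in>U. \<forall>i\<in>T. gauge u M i = M' i))"

lemma gauge_comm:
  assumes "u \<in> carrier (tuple_group G m)" "v \<in> carrier (tuple_group G m)" "M \<in> carrier (tuple_group G q)"
  shows "gauge u (gauge v M) = gauge v (gauge u M)"
proof -
  have "(\<lambda>j. u j \<otimes> v j) = (\<lambda>j. v j \<otimes> u j)"
    using comm tuple_closed[OF assms(1)] tuple_closed[OF assms(2)] by auto
  then show ?thesis using gauge_mult[OF assms] gauge_mult[OF assms(2,1,3)] by simp
qed

text \<open>By commutativity \<open>M\<close> cancels: the transformations fixing a coordinate form
  the same subgroup for every input.\<close>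

lemma gauge_fix_iff:
  assumes "u \<in> carrier (tuple_group G m)" "M \<in> carrier (tuple_group G q)"
  shows "gauge u M i = M i \<longleftrightarrow> u i = u (i - 1)"
proof -
  have c: "u j \<in> carrier G" "M j \<in> carrier G" for j
    using tuple_closed[OF assms(1)] tuple_closed[OF assms(2)] by auto
  have "gauge u M i = M i \<otimes> (inv (u i) \<otimes> u (i - 1))"
    using c comm[of "inv (u i)" "M i"] by (simp add: gauge_def m_assoc[symmetric])
  then have "gauge u M i = M i \<longleftrightarrow> inv (u i) \<otimes> u (i - 1) = \<one>" using c by (simp add: l_cancel_one)
  also have "\<dots> \<longleftrightarrow> u i = u (i - 1)" using c
    by (metis inv_closed inv_equality inv_inv l_inv)
  finally show ?thesis .
qed

text \<open>Coordinates are collected in rounds of at most \<open>k' - 1\<close>, as long as a round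
  shrinks the product of \<open>H\<close> with the part of \<open>U\<close> fixing the collected
  coordinates. A shrinkage has index at least \<open>n\<close>, and the product always contains
  \<open>H\<close>, so at most \<open>t\<close> rounds occur and fewer than
  \<open>k' - 1 + 1\<close> further coordinates still keep the total below \<open>k\<close>.\<close>

lemma blind_state_step:
  assumes st: "blind_state q U k M M'"
    and ne: "card {u \<in> U. \<psi> (gauge u M)} \<noteq> card {u \<in> U. \<psi> (gauge u M')}"
    and H: "subgroup H (tuple_group G (q - 1))" "H \<subseteq> U"
  shows "\<exists>t k' U' N N'. U' \<subseteq> H \<and> card H * n ^ t \<le> card U \<and> k \<le> (t + 1) * k' \<and>
          blind_state q U' k' N N' \<and> \<psi> N \<noteq> \<psi> N'"
proof -
  have k: "1 \<le> k" and q: "1 \<le> q" and subU: "subgroup U (tuple_group G (q - 1))"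
    and M: "M \<in> carrier (tuple_group G q)" "M' \<in> carrier (tuple_group G q)"
    and blind: "\<And>T. T \<subseteq> {1..q} \<Longrightarrow> card T < k \<Longrightarrow> \<exists>u\<in>U. \<forall>i\<in>T. gauge u M i = M' i"
    using st by (auto simp: blind_state_def)
  note UD = subgroup_tupleD[OF subU]
  note HD = subgroup_tupleD[OF H(1)]
  have finU: "finite U"
    using finite_subset[OF subgroup.subset[OF subU]] card_tuple_group[OF finite_carrier] by blast
  have Uc: "u j \<in> carrier G" if "u \<in> U" for u j using tuple_closed[OF UD(1)[OF that]] .
  have cH: "1 \<le> card H" using HD(2) finite_subset[OF H(2) finU] by (metis One_nat_def Suc_leI card_gt_0_iff empty_iff)
  \<comment> \<open>The condition on \<open>s\<close> says that \<open>s\<close> fixes the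
    coordinates in \<open>T\<close> of every input.\<close>
  define SH where "SH = (\<lambda>T. {(\<lambda>j. s j \<otimes> h j) |s h. s \<in> U \<and> (\<forall>i\<in>T. s i = s (i - 1)) \<and> h \<in> H})"
  have subSH: "subgroup (SH T) (tuple_group G (q - 1))" for T
  proof (rule subgroup_tupleI)
    show "SH T \<subseteq> carrier (tuple_group G (q - 1))"
    proof
      fix x assume "x \<in> SH T"
      then obtain s h where "x = (\<lambda>j. s j \<otimes> h j)" "s \<in> U" "h \<in> H" by (auto simp: SH_def)
      then show "x \<in> carrier (tuple_group G (q - 1))" using UD(1)[OF UD(3)[of s h]] H(2) by auto
    qed
    show "(\<lambda>j. \<one>) \<in> SH T" using UD(2) HD(2) unfolding SH_def by force
    show "(\<lambda>j. x j \<otimes> y j) \<in> SH T" if xy: "x \<in> SH T" "y \<in> SH T" for x y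
    proof -
      obtain s h where x: "x = (\<lambda>j. s j \<otimes> h j)" "s \<in> U" "\<forall>i\<in>T. s i = s (i - 1)" "h \<in> H" using xy(1) by (auto simp: SH_def)
      obtain s' h' where y: "y = (\<lambda>j. s' j \<otimes> h' j)" "s' \<in> U" "\<forall>i\<in>T. s' i = s' (i - 1)" "h' \<in> H" using xy(2) by (auto simp: SH_def)
      have hU: "h \<in> U" "h' \<in> U" using x y H(2) by auto
      have "x j \<otimes> y j = (s j \<otimes> s' j) \<otimes> (h j \<otimes> h' j)" for j
      proof -
        have c: "s j \<in> carrier G" "s' j \<in> carrier G" "h j \<in> carrier G" "h' j \<in> carrier G"
          using Uc x(2) y(2) hU by auto
        have "(s j \<otimes> h j) \<otimes> (s' j \<otimes> h' j) = s j \<otimes> (h j \<otimes> s' j) \<otimes> h' j" using c by (simp add: m_assoc)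
        also have "\<dots> = s j \<otimes> (s' j \<otimes> h j) \<otimes> h' j" using c comm[of "h j" "s' j"] by simp
        also have "\<dots> = (s j \<otimes> s' j) \<otimes> (h j \<otimes> h' j)" using c by (simp add: m_assoc)
        finally show ?thesis using x(1) y(1) by simp
      qed
      moreover have "(\<lambda>j. s j \<otimes> s' j) \<in> U" "(\<lambda>j. h j \<otimes> h' j) \<in> H" using UD(3) HD(3) x y by auto
      moreover have "\<forall>i\<in>T. s i \<otimes> s' i = s (i - 1) \<otimes> s' (i - 1)" using x(3) y(3) by auto
      ultimately show ?thesis unfolding SH_def
        by (intro CollectI exI[of _ "\<lambda>j. s j \<otimes> s' j"] exI[of _ "\<lambda>j. h j \<otimes> h' j"]) auto
    qed
    show "(\<lambda>j. inv (x j)) \<in> SH T" if xy: "x \<in> SH T" for x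
    proof -
      obtain s h where x: "x = (\<lambda>j. s j \<otimes> h j)" "s \<in> U" "\<forall>i\<in>T. s i = s (i - 1)" "h \<in> H" using xy(1) by (auto simp: SH_def)
      have hU: "h \<in> U" using x H(2) by auto
      have "inv (x j) = inv (s j) \<otimes> inv (h j)" for j
        using Uc[OF x(2), of j] Uc[OF hU, of j] comm x(1) by (simp add: inv_mult_group)
      moreover have "(\<lambda>j. inv (s j)) \<in> U" "(\<lambda>j. inv (h j)) \<in> H" using UD(4) HD(4) x by auto
      moreover have "\<forall>i\<in>T. inv (s i) = inv (s (i - 1))" using x(3) by auto
      ultimately show ?thesis unfolding SH_def
        by (intro CollectI exI[of _ "\<lambda>j. inv (s j)"] exI[of _ "\<lambda>j. inv (h j)"]) auto
    qed
  qed
  have SHU: "SH T \<subseteq> U" for T using UD(3) H(2) by (auto simp: SH_def)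
  have HSH: "H \<subseteq> SH T" for T
  proof
    fix h assume h: "h \<in> H"
    then have "h = (\<lambda>j. \<one> \<otimes> h j)" using Uc H(2) by auto
    then show "h \<in> SH T" using h UD(2) unfolding SH_def
      by (intro CollectI exI[of _ "\<lambda>j. \<one>"] exI[of _ h]) auto
  qed
  have SHmono: "SH (T \<union> T') \<subseteq> SH T" for T T' unfolding SH_def by blast
  have bound: "s \<le> card U" if "card H * n ^ s \<le> card U" for s
  proof -
    have "s < 2 ^ s" by simp
    also have "(2::nat) ^ s \<le> n ^ s" using degree_ge_2 by (intro power_mono) auto
    also have "\<dots> \<le> card H * n ^ s" using cH by simp
    finally show ?thesis using that by simp
  qed
  have "card H * n ^ 0 \<le> card U" using card_mono[OF finU H(2)] by simp
  \<comment> \<open>The largest exponent that the index of \<open>H\<close> allows, so that it also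
    bounds the number of rounds. A maximum exists because \<open>s < 2 ^ s <= n ^ s\<close>.\<close>
  then obtain t where t: "card H * n ^ t \<le> card U" "\<And>s. card H * n ^ s \<le> card U \<Longrightarrow> s \<le> t"
    using Nat.ex_has_greatest_nat[of "\<lambda>s. card H * n ^ s \<le> card U" 0 "card U"] bound by blast
  define k' where "k' = (k + t) div (t + 1)"
  note kk = ceiling_quotient[OF k, of t, folded k'_def]
  \<comment> \<open>\<open>Q s\<close> records that \<open>s\<close> rounds have been carried out,
    each having cost a factor \<open>n\<close>.\<close>
  define Q where "Q = (\<lambda>s. \<exists>T\<subseteq>{1..q}. card T \<le> s * (k' - 1) \<and> card (SH T) * n ^ s \<le> card U)"
  have "Q 0" using card_mono[OF finU SHU[of "{}"]] by (auto simp: Q_def)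
  moreover have Qt: "s \<le> t" if "Q s" for s
  proof -
    from that obtain T where "card (SH T) * n ^ s \<le> card U" unfolding Q_def by blast
    moreover have "card H \<le> card (SH T)" using card_mono[OF finite_subset[OF SHU finU] HSH] .
    then have "card H * n ^ s \<le> card (SH T) * n ^ s" by simp
    ultimately show ?thesis using t(2) by (meson order_trans)
  qed
  ultimately obtain s where s: "Q s" "\<And>s'. Q s' \<Longrightarrow> s' \<le> s"
    using Nat.ex_has_greatest_nat[of Q 0 t] by blast
  then obtain T0 where T0: "T0 \<subseteq> {1..q}" "card T0 \<le> s * (k' - 1)" "card (SH T0) * n ^ s \<le> card U"
    by (auto simp: Q_def)
  have small: "card T0 + card T < k" if "card T < k'" for T :: "nat set"
  proof -
    have "card T0 + card T \<le> s * (k' - 1) + (k' - 1)" using T0(2) that by linarith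
    also have "\<dots> = (s + 1) * (k' - 1)" by simp
    also have "\<dots> \<le> (t + 1) * (k' - 1)" using Qt[OF s(1)] by (intro mult_right_mono) auto
    finally show ?thesis using kk(3) by linarith
  qed
  have stable: "SH (T0 \<union> T) = SH T0" if T: "T \<subseteq> {1..q}" "card T < k'" for T
  proof (rule ccontr)
    assume "SH (T0 \<union> T) \<noteq> SH T0"
    then have "SH (T0 \<union> T) \<subset> SH T0" using SHmono by blast
    then have "card (SH (T0 \<union> T)) * n \<le> card (SH T0)" by (rule tuple_subgroup_index[OF subSH subSH])
    then have "card (SH (T0 \<union> T)) * n * n ^ s \<le> card (SH T0) * n ^ s" by (rule mult_right_mono) simp
    then have "card (SH (T0 \<union> T)) * n ^ Suc s \<le> card U" using T0(3) unfolding power_Suc mult.assoc by (rule le_trans)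
    moreover have "card (T0 \<union> T) \<le> Suc s * (k' - 1)"
      using card_Un_le[of T0 T] T0(2) T(2) by simp
    ultimately have "Q (Suc s)" using T0(1) T(1) unfolding Q_def by (intro exI[of _ "T0 \<union> T"]) auto
    then show False using s(2) by fastforce
  qed
  obtain v where v: "v \<in> U" "\<forall>i\<in>T0. gauge v M i = M' i"
    using blind[OF T0(1)] small[of "{}"] kk(1) by auto
  define v' where "v' = (\<lambda>j. inv (v j))"
  have v': "v' \<in> U" using UD(4)[OF v(1)] by (simp add: v'_def)
  \<comment> \<open>\<open>M'\<close> moved within its \<open>U\<close>-orbit so that it agrees with
    \<open>M\<close> on the collected coordinates; averages over \<open>U\<close> do not
    change.\<close>
  define Y where "Y = gauge v' M'"
  have YC: "Y \<in> carrier (tuple_group G q)" using gauge_closed[OF UD(1)[OF v'] M(2) q] by (simp add: Y_def)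
  have cong: "gauge u A i = gauge u B i" if "A i = B i" for u A B i using that by (simp add: gauge_def)
  have v'v: "gauge v' (gauge v M) = M"
  proof -
    have "(\<lambda>j. v j \<otimes> v' j) = (\<lambda>j. \<one>)" using Uc[OF v(1)] by (simp add: v'_def)
    then show ?thesis using gauge_mult[OF UD(1)[OF v(1)] UD(1)[OF v'] M(1)] gauge_one[OF M(1)] by simp
  qed
  have YT0: "Y i = M i" if "i \<in> T0" for i
    using cong[of "gauge v M" i M' v'] v(2) that v'v by (simp add: Y_def)
  \<comment> \<open>A transformation \<open>x\<close> in \<open>U\<close> taking \<open>M\<close> to
    \<open>Y\<close> on both \<open>T0\<close> and \<open>T\<close> fixes \<open>T0\<close>, hence
    lies in \<open>SH T0\<close>. By stability it splits as \<open>y\<close> times \<open>h\<close>,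
    where \<open>y\<close> fixes \<open>T0\<close> and \<open>T\<close> and \<open>h\<close> lies in
    \<open>H\<close>; then \<open>h\<close> alone takes \<open>M\<close> to \<open>Y\<close> on
    \<open>T\<close>.\<close>
  have blindH: "\<exists>h\<in>H. \<forall>i\<in>T. gauge h M i = Y i" if T: "T \<subseteq> {1..q}" "card T < k'" for T
  proof -
    have "card (T0 \<union> T) < k" using small[OF T(2)] card_Un_le[of T0 T] by linarith
    then obtain r where r: "r \<in> U" "\<forall>i\<in>T0 \<union> T. gauge r M i = M' i" using blind[of "T0 \<union> T"] T0(1) T(1) by auto
    define x where "x = (\<lambda>j. r j \<otimes> v' j)"
    have xU: "x \<in> U" using UD(3)[OF r(1) v'] by (simp add: x_def)
    have gx: "gauge x M i = Y i" if "i \<in> T0 \<union> T" for i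
    proof -
      have "gauge x M = gauge v' (gauge r M)"
        unfolding x_def using gauge_mult[OF UD(1)[OF r(1)] UD(1)[OF v'] M(1)] .
      then show ?thesis using cong[of "gauge r M" i M' v'] r(2) that by (simp add: Y_def)
    qed
    have "\<forall>i\<in>T0. x i = x (i - 1)"
      using gx YT0 gauge_fix_iff[OF UD(1)[OF xU] M(1)] by (metis UnI1)
    moreover have "x = (\<lambda>j. x j \<otimes> \<one>)" using Uc[OF xU] by simp
    ultimately have "x \<in> SH T0" using xU HD(2) unfolding SH_def
      by (intro CollectI exI[of _ x] exI[of _ "\<lambda>j. \<one>"]) auto
    then have "x \<in> SH (T0 \<union> T)" using stable[OF T] by simp
    then obtain y h where y: "x = (\<lambda>j. y j \<otimes> h j)" "y \<in> U" "\<forall>i\<in>T0 \<union> T. y i = y (i - 1)" "h \<in> H"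
      by (auto simp: SH_def)
    have "gauge h M i = Y i" if i: "i \<in> T" for i
    proof -
      have hC: "h \<in> carrier (tuple_group G (q - 1))" using y(4) HD(1) by auto
      have "gauge y M i = M i" using gauge_fix_iff[OF UD(1)[OF y(2)] M(1)] y(3) i by auto
      then have "gauge h (gauge y M) i = gauge h M i" by (rule cong)
      moreover have "gauge x M = gauge h (gauge y M)"
        unfolding y(1) using gauge_mult[OF UD(1)[OF y(2)] hC M(1)] .
      ultimately show ?thesis using gx[of i] i by simp
    qed
    then show ?thesis using y(4) by auto
  qed
  have "card {u \<in> U. \<psi> (gauge u Y)} = card {u \<in> U. \<psi> (gauge u M')}"
    unfolding Y_def using card_gauge_orbit[OF subU v' M(2)] .
  then have "card {u \<in> U. \<psi> (gauge u M)} \<noteq> card {u \<in> U. \<psi> (gauge u Y)}" using ne by simp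
  then have "\<exists>u\<in>U. \<psi> (gauge u M) \<noteq> \<psi> (gauge u Y)" by (metis (mono_tags, lifting) Collect_cong)
  then obtain u where u: "u \<in> U" "\<psi> (gauge u M) \<noteq> \<psi> (gauge u Y)" by auto
  have "blind_state q H k' (gauge u M) (gauge u Y)"
    unfolding blind_state_def
  proof (intro conjI allI impI)
    show "1 \<le> k'" "1 \<le> q" "subgroup H (tuple_group G (q - 1))" by fact+
    show "gauge u M \<in> carrier (tuple_group G q)" "gauge u Y \<in> carrier (tuple_group G q)"
      using gauge_closed[OF UD(1)[OF u(1)] _ q] M(1) YC by auto
    fix T assume T: "T \<subseteq> {1..q}" "card T < k'"
    then obtain h where h: "h \<in> H" "\<forall>i\<in>T. gauge h M i = Y i" using blindH by blast
    have "gauge h (gauge u M) i = gauge u Y i" if "i \<in> T" for i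
      using gauge_comm[OF HD(1)[OF h(1)] UD(1)[OF u(1)] M(1)] cong[of "gauge h M" i Y u] h(2) that by simp
    then show "\<exists>x\<in>H. \<forall>i\<in>T. gauge x (gauge u M) i = gauge u Y i" using h(1) by blast
  qed
  then show ?thesis using t(1) kk(2) u(2) by blast
qed

lemma indistinguishability_blind_state:
  "indistinguishability n q (blind_state q)"
  unfolding indistinguishability_def
proof (intro conjI allI impI)
  fix U k M M' assume st: "blind_state q U k M M'"
  then show "1 \<le> k" "M \<in> carrier (tuple_group G q)" "M' \<in> carrier (tuple_group G q)"
    "subgroup U (tuple_group G (q - 1))"
    by (auto simp: blind_state_def)
next
  fix U k M M' assume st: "blind_state q U k M M'" "2 \<le> k"
  show "\<forall>i\<in>{1..q}. (\<exists>u\<in>U. gauge u M i = M' i) \<or>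
       carrier G \<subseteq> (\<lambda>u. u i) ` U \<or> carrier G \<subseteq> (\<lambda>u. u (i - 1)) ` U"
  proof
    fix i assume "i \<in> {1..q}"
    then have "{i} \<subseteq> {1..q}" "card {i} < k" using st(2) by auto
    then have "\<exists>u\<in>U. \<forall>j\<in>{i}. gauge u M j = M' j" using st(1) unfolding blind_state_def by blast
    then show "(\<exists>u\<in>U. gauge u M i = M' i) \<or>
       carrier G \<subseteq> (\<lambda>u. u i) ` U \<or> carrier G \<subseteq> (\<lambda>u. u (i - 1)) ` U" by blast
  qed
next
  fix U k M M' \<psi> H
  assume "blind_state q U k M M'" "card {u \<in> U. \<psi> (gauge u M)} \<noteq> card {u \<in> U. \<psi> (gauge u M')}"
    "subgroup H (tuple_group G (q - 1))" "H \<subseteq> U"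
  then show "\<exists>t k' U' N N'. U' \<subseteq> H \<and> card H * n ^ t \<le> card U \<and> k \<le> (t + 1) * k' \<and>
          blind_state q U' k' N N' \<and> \<psi> N \<noteq> \<psi> N'"
    by (rule blind_state_step)
qed

text \<open>The difference at edge \<open>1\<close> is pushed along the path to an edge
  \<open>i0\<close> that is not inspected, by a transformation that is constant on the vertices
  before \<open>i0\<close>.\<close>

lemma blind_state_initial:
  assumes "1 \<le> q" and M: "M \<in> carrier (tuple_group G q)" "M' \<in> carrier (tuple_group G q)"
    and eq: "\<And>i. i \<noteq> 1 \<Longrightarrow> M i = M' i"
  shows "blind_state q (carrier (tuple_group G (q - 1))) q M M'"
  unfolding blind_state_def
proof (intro conjI allI impI)
  interpret T: group "tuple_group G (q - 1)" by (rule group_tuple_group)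
  show "subgroup (carrier (tuple_group G (q - 1))) (tuple_group G (q - 1))" by (rule T.subgroup_self)
  fix T assume T: "T \<subseteq> {1..q}" "card T < q"
  have "T \<noteq> {1..q}" using T(2) by auto
  then obtain i0 where i0: "i0 \<in> {1..q}" "i0 \<notin> T" using T(1) by blast
  have Mc: "M i \<in> carrier G" "M' i \<in> carrier G" for i using tuple_closed M by auto
  define g where "g = M 1 \<otimes> inv (M' 1)"
  have gc: "g \<in> carrier G" using Mc by (simp add: g_def)
  define u where "u = (\<lambda>j. if 1 \<le> j \<and> j < i0 then g else \<one>)"
  have u: "u \<in> carrier (tuple_group G (q - 1))" using gc i0(1) by (auto simp: u_def mem_tuple_group)
  have "gauge u M i = M' i" if i: "i \<in> T" for i
  proof (cases "i = 1")
    case True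
    then have "1 < i0" using i i0 by (cases "i0 = 1") auto
    then have "gauge u M 1 = inv g \<otimes> M 1" using gc Mc by (simp add: gauge_def u_def)
    also have "\<dots> = M' 1" using Mc by (simp add: g_def inv_mult_group m_assoc)
    finally show ?thesis using True by simp
  next
    case False
    have "i \<noteq> i0" "1 \<le> i" using i i0(2) T(1) by auto
    then have "u i = u (i - 1)" using False by (auto simp: u_def)
    then have "gauge u M i = M i" using gauge_fix_iff[OF u M(1), of i] by blast
    then show ?thesis using eq[OF False] by simp
  qed
  then show "\<exists>u\<in>carrier (tuple_group G (q - 1)). \<forall>i\<in>T. gauge u M i = M' i" using u by blast
qed (use assms in auto)

end

section \<open>Invariant formulas\<close>

lemma tc_eval_map: "tc_eval x (map_tc \<pi> \<Phi>) = tc_eval (x \<circ> \<pi>) \<Phi>"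
proof (induction \<Phi>)
  case (TMaj cs)
  have "image_mset (tc_eval x \<circ> map_tc \<pi>) cs = image_mset (tc_eval (x \<circ> \<pi>)) cs"
  proof (rule image_mset_cong)
    fix y assume "y \<in># cs"
    then show "(tc_eval x \<circ> map_tc \<pi>) y = tc_eval (x \<circ> \<pi>) y"
      unfolding comp_apply[of "tc_eval x"] by (rule TMaj.IH)
  qed
  then show ?case by (simp add: multiset.map_comp comp_def)
qed auto

lemma tc_size_map: "tc_size (map_tc \<pi> \<Phi>) = tc_size \<Phi>"
proof (induction \<Phi>)
  case (TMaj cs)
  then have "image_mset tc_size (image_mset (map_tc \<pi>) cs) = image_mset tc_size cs"
    by (auto simp: multiset.map_comp intro!: image_mset_cong)
  then show ?case by simp
qed auto

lemma tc_depth_child: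
  assumes "\<psi> \<in># cs"
  shows "tc_depth \<psi> + 1 \<le> tc_depth (TMaj cs)"
  using assms by (auto intro!: Max_ge)

lemma sum_mset_ge_sum:
  fixes f :: "'a \<Rightarrow> nat"
  assumes "A \<subseteq> set_mset M"
  shows "sum f A \<le> (\<Sum>x\<in>#M. f x)"
proof -
  have "mset_set A \<subseteq># mset_set (set_mset M)"
    using assms by (simp add: subset_imp_msubset_mset_set)
  then have "mset_set A \<subseteq># M" using mset_set_set_mset_msubset[of M] by (rule subset_mset.order_trans)
  then obtain D where "M = mset_set A + D" by (auto simp: mset_subset_eq_exists_conv)
  then show ?thesis by (simp add: sum_unfold_sum_mset)
qed

lemma size_filter_sum: "size (filter_mset (\<lambda>b. b) (image_mset p cs)) = (\<Sum>x\<in>#cs. of_bool (p x) :: nat)"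
  by (induction cs) auto

section \<open>Exponent inequalities for a single gate\<close>

lemma log_bound_step:
  fixes n k t k' :: nat
  assumes "2 \<le> n" "1 \<le> k" "1 \<le> k'" "k \<le> (t + 1) * k'"
  shows "real n powr log 2 k \<le> real n ^ t * real n powr log 2 k'"
proof -
  have "real k \<le> real (t + 1) * real k'" using assms(4) by (metis of_nat_le_iff of_nat_mult)
  then have "log 2 (real k) \<le> log 2 (real (t + 1) * real k')"
    using assms(2,3) by (subst log_le_cancel_iff) auto
  also have "\<dots> = log 2 (real (t + 1)) + log 2 (real k')" using assms by (subst log_mult) auto
  \<comment> \<open>The base \<open>2\<close> originates here: \<open>t + 1 <= 2 ^ t\<close>, with
    equality at \<open>t = 1\<close>, so halving \<open>k\<close> for one factor \<open>n\<close> is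
    the best exchange.\<close>
  also have "log 2 (real (t + 1)) \<le> log 2 (2 ^ t)"
  proof -
    have "t < 2 ^ t" by simp
    then have "t + 1 \<le> 2 ^ t" by linarith
    then have "real (t + 1) \<le> 2 ^ t" by (metis of_nat_le_iff of_nat_numeral of_nat_power)
    then show ?thesis by (subst log_le_cancel_iff) auto
  qed
  also have "log 2 (2 ^ t) = real t" by (simp add: log_nat_power)
  finally have "log 2 (real k) \<le> real t + log 2 (real k')" by simp
  then have "real n powr log 2 k \<le> real n powr (real t + log 2 k')"
    using assms by (intro powr_mono) auto
  also have "\<dots> = real n ^ t * real n powr log 2 k'" using assms by (simp add: powr_add powr_realpow)
  finally show ?thesis .
qed

text \<open>The weighted arithmetic-geometric mean inequality, with weights \<open>1\<close> and \<open>d\<close>.\<close>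

lemma depth_exponent_step:
  fixes k t k' d :: nat
  assumes "1 \<le> k" "1 \<le> k'" "k \<le> (t + 1) * k'" "1 \<le> d"
  shows "real (d + 1) * (real k powr (1 / real (d + 1)) - 1) \<le> real t + real d * (real k' powr (1 / real d) - 1)"
proof -
  \<comment> \<open>In these terms \<open>(d + 1) * y <= s + d * r\<close> is to be derived from
    \<open>y ^ (d + 1) <= s * r ^ d\<close>; the bound \<open>ln x <= x - 1\<close> is applied to
    \<open>s / y\<close> and \<open>r / y\<close>.\<close>
  define y where "y = real k powr (1 / real (d + 1))"
  define r where "r = real k' powr (1 / real d)"
  define s where "s = real (t + 1)"
  have pos: "0 < y" "0 < r" "0 < s" using assms by (auto simp: y_def r_def s_def)
  have ly: "ln y = ln (real k) / real (d + 1)" using assms by (simp add: y_def ln_powr)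
  have lr: "ln r = ln (real k') / real d" using assms by (simp add: r_def ln_powr)
  have "ln (real k) \<le> ln (s * real k')"
  proof -
    have "real k \<le> s * real k'" using assms(3) unfolding s_def by (metis of_nat_le_iff of_nat_mult)
    then show ?thesis using assms pos by (subst ln_le_cancel_iff) auto
  qed
  also have "\<dots> = ln s + ln (real k')" using assms pos by (simp add: ln_mult)
  finally have "real (d + 1) * ln y \<le> ln s + real d * ln r" using assms ly lr by simp
  then have "0 \<le> ln (s / y) + real d * ln (r / y)"
    using pos by (simp add: ln_div algebra_simps)
  also have "\<dots> \<le> (s / y - 1) + real d * (r / y - 1)"
    using pos by (intro add_mono mult_left_mono ln_le_minus_one) auto
  finally have "0 \<le> y * ((s / y - 1) + real d * (r / y - 1))" using pos by simp
  also have "\<dots> = s - y + real d * (r - y)" using pos by (simp add: algebra_simps)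
  finally have "real (d + 1) * (y - 1) \<le> real t + real d * (r - 1)" by (simp add: s_def algebra_simps)
  then show ?thesis unfolding y_def r_def .
qed

lemma depth_bound_step:
  fixes n k t k' d :: nat
  assumes "2 \<le> n" "1 \<le> k" "1 \<le> k'" "k \<le> (t + 1) * k'" "1 \<le> d"
  shows "real n powr (real (d + 1) * (real k powr (1 / real (d + 1)) - 1))
    \<le> real n ^ t * real n powr (real d * (real k' powr (1 / real d) - 1))"
proof -
  have "real n powr (real (d + 1) * (real k powr (1 / real (d + 1)) - 1))
      \<le> real n powr (real t + real d * (real k' powr (1 / real d) - 1))"
    using depth_exponent_step[OF assms(2-5)] assms(1) by (intro powr_mono) auto
  also have "\<dots> = real n ^ t * real n powr (real d * (real k' powr (1 / real d) - 1))"
    using assms by (simp add: powr_add powr_realpow)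
  finally show ?thesis .
qed

section \<open>Inputs of the word problem and the gauge action on them\<close>

primrec prefix_perm :: "(nat \<Rightarrow> nat \<Rightarrow> nat) \<Rightarrow> nat \<Rightarrow> nat \<Rightarrow> nat" where
  "prefix_perm M 0 = id"
| "prefix_perm M (Suc j) = M (Suc j) \<circ> prefix_perm M j"

locale word_problem =
  fixes n q :: nat and G :: "(nat \<Rightarrow> nat) set"
  assumes subgroup_G: "subgroup G (sym_group n)" and q: "1 \<le> q"
begin

sublocale gr: group "perm_grp n G"
  unfolding perm_grp_def using subgroup.subgroup_is_group[OF subgroup_G sym_group_is_group] .

lemma perm_grp_simps [simp]:
  "carrier (perm_grp n G) = G" "mult (perm_grp n G) = (\<circ>)" "one (perm_grp n G) = id"
  by (simp_all add: perm_grp_def sym_group_def)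

lemma permutes_G: "g \<in> G \<Longrightarrow> g permutes {1..n}"
  using subgroup.subset[OF subgroup_G] by (auto simp: sym_group_def)

lemma finite_G: "finite G"
  using finite_subset[OF _ finite_permutations[of "{1..n}"]] permutes_G by auto

abbreviation "inputs \<equiv> carrier (tuple_group (perm_grp n G) q)"
abbreviation "gauges \<equiv> carrier (tuple_group (perm_grp n G) (q - 1))"

definition assignment :: "(nat \<Rightarrow> nat \<Rightarrow> nat) \<Rightarrow> nat \<times> nat \<times> nat \<Rightarrow> bool" where
  "assignment M v \<longleftrightarrow> v \<in> word_vars n q \<and> M (fst v) (fst (snd v)) = snd (snd v)"

lemma tuple_in_G: "u \<in> carrier (tuple_group (perm_grp n G) m) \<Longrightarrow> u j \<in> G"
  using gr.tuple_closed by fastforce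

lemma word_perm_eq:
  assumes "u \<in> gauges" "(i, a, b) \<in> word_vars n q"
  shows "word_perm n q u (i, a, b) = (i, u (i - 1) a, u i b)" "(i, u (i - 1) a, u i b) \<in> word_vars n q"
proof -
  have "(if 1 \<le> j \<and> j \<le> q - 1 then u j else id) = u j" for j
    using assms(1) by (auto simp: gr.mem_tuple_group)
  then show "word_perm n q u (i, a, b) = (i, u (i - 1) a, u i b)"
    using assms(2) by (simp add: word_perm_def Let_def)
  have "u j permutes {1..n}" for j using permutes_G tuple_in_G[OF assms(1)] by blast
  then show "(i, u (i - 1) a, u i b) \<in> word_vars n q"
    using assms(2) permutes_in_image by (fastforce simp: word_vars_def)
qed

lemma word_perm_outside: "v \<notin> word_vars n q \<Longrightarrow> word_perm n q u v = v"
  by (cases v) (auto simp: word_perm_def Let_def)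

lemma word_perm_mult:
  assumes "u \<in> gauges" "v \<in> gauges"
  shows "word_perm n q (\<lambda>j. u j \<circ> v j) = word_perm n q u \<circ> word_perm n q v"
proof
  interpret T: group "tuple_group (perm_grp n G) (q - 1)" by (rule gr.group_tuple_group)
  have uv: "(\<lambda>j. u j \<circ> v j) \<in> gauges" using T.m_closed[OF assms] by simp
  fix x :: "nat \<times> nat \<times> nat" obtain i a b where x: "x = (i, a, b)" by (cases x)
  show "word_perm n q (\<lambda>j. u j \<circ> v j) x = (word_perm n q u \<circ> word_perm n q v) x"
  proof (cases "x \<in> word_vars n q")
    case True
    then show ?thesis using x word_perm_eq[OF uv] word_perm_eq[OF assms(2)] word_perm_eq[OF assms(1)] by simp
  next
    case False
    then show ?thesis using word_perm_outside by simp
  qed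
qed

lemma word_perm_id: "word_perm n q (\<lambda>j. id) = id"
  by (auto simp: word_perm_def Let_def fun_eq_iff)

text \<open>The source of the formula for \<open>gauge\<close>: the relabelled variable is true iff
  \<open>M i (u (i - 1) a) = u i b\<close>, and solving for \<open>b\<close> gives the gauged
  permutation. Invariance of a formula thus becomes invariance of its values under gauge
  transformations.\<close>

lemma assignment_gauge:
  assumes u: "u \<in> gauges" and M: "M \<in> inputs"
  shows "assignment (gr.gauge u M) = assignment M \<circ> word_perm n q u"
proof
  fix x :: "nat \<times> nat \<times> nat" obtain i a b where x: "x = (i, a, b)" by (cases x)
  show "assignment (gr.gauge u M) x = (assignment M \<circ> word_perm n q u) x"
  proof (cases "x \<in> word_vars n q")
    case True
    have ui: "u i \<in> G" using tuple_in_G[OF u] .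
    have l: "(inv\<^bsub>perm_grp n G\<^esub> (u i)) (u i y) = y" "u i ((inv\<^bsub>perm_grp n G\<^esub> (u i)) y) = y" for y
      using gr.l_inv[of "u i"] gr.r_inv[of "u i"] ui by (auto simp: fun_eq_iff)
    have "gr.gauge u M i a = b \<longleftrightarrow> M i (u (i - 1) a) = u i b"
      unfolding gr.gauge_def using l by (auto simp: comp_def)
    then show ?thesis using True x word_perm_eq[OF u] by (simp add: assignment_def)
  next
    case False
    then show ?thesis using word_perm_outside by (simp add: assignment_def)
  qed
qed

lemma eval_map_gauge:
  assumes "u \<in> gauges" "M \<in> inputs"
  shows "tc_eval (assignment M) (map_tc (word_perm n q u) \<Phi>) = tc_eval (assignment (gr.gauge u M)) \<Phi>"
  using assignment_gauge[OF assms] by (simp add: tc_eval_map)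

section \<open>Stabilizers, orbits and the size of invariant formulas\<close>

definition stabilizer :: "(nat \<Rightarrow> nat \<Rightarrow> nat) set \<Rightarrow> (nat \<times> nat \<times> nat) tc \<Rightarrow> (nat \<Rightarrow> nat \<Rightarrow> nat) set" where
  "stabilizer U \<psi> = {u \<in> U. map_tc (word_perm n q u) \<psi> = \<psi>}"

lemma map_word_perm_mult:
  assumes "u \<in> gauges" "v \<in> gauges"
  shows "map_tc (word_perm n q (\<lambda>j. u j \<circ> v j)) \<psi> = map_tc (word_perm n q u) (map_tc (word_perm n q v) \<psi>)"
  using word_perm_mult[OF assms] by (simp add: tc.map_comp)

lemma map_word_perm_inv:
  assumes "u \<in> gauges" "map_tc (word_perm n q u) \<psi> = \<chi>"
  shows "map_tc (word_perm n q (\<lambda>j. inv\<^bsub>perm_grp n G\<^esub> (u j))) \<chi> = \<psi>"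
proof -
  interpret T: group "tuple_group (perm_grp n G) (q - 1)" by (rule gr.group_tuple_group)
  let ?v = "\<lambda>j. inv\<^bsub>perm_grp n G\<^esub> (u j)"
  have v: "?v \<in> gauges" using T.inv_closed[OF assms(1)] gr.inv_tuple_group[OF assms(1)] by simp
  have "(\<lambda>j. ?v j \<circ> u j) = (\<lambda>j. id)"
    using gr.l_inv tuple_in_G[OF assms(1)] by (metis perm_grp_simps)
  then show ?thesis
    using map_word_perm_mult[OF v assms(1), of \<psi>] assms(2) by (simp add: word_perm_id tc.map_id0)
qed

lemma subgroup_stabilizer:
  assumes U: "subgroup U (tuple_group (perm_grp n G) (q - 1))"
  shows "subgroup (stabilizer U \<psi>) (tuple_group (perm_grp n G) (q - 1))"
proof (rule gr.subgroup_tupleI)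
  note D = gr.subgroup_tupleD[OF U]
  show "stabilizer U \<psi> \<subseteq> gauges" using D(1) by (auto simp: stabilizer_def)
  show "(\<lambda>j. \<one>\<^bsub>perm_grp n G\<^esub>) \<in> stabilizer U \<psi>"
    using D(2) by (simp add: stabilizer_def word_perm_id tc.map_id0)
  show "(\<lambda>j. u j \<otimes>\<^bsub>perm_grp n G\<^esub> v j) \<in> stabilizer U \<psi>" if "u \<in> stabilizer U \<psi>" "v \<in> stabilizer U \<psi>" for u v
    using that D(3)[of u v] map_word_perm_mult[OF D(1) D(1), of u v \<psi>] by (simp add: stabilizer_def)
  show "(\<lambda>j. inv\<^bsub>perm_grp n G\<^esub> (u j)) \<in> stabilizer U \<psi>" if "u \<in> stabilizer U \<psi>" for u
    using that D(4)[of u] map_word_perm_inv[OF D(1), of u \<psi> \<psi>] by (simp add: stabilizer_def)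
qed

lemma card_orbit_stabilizer:
  assumes U: "subgroup U (tuple_group (perm_grp n G) (q - 1))" and fin: "finite U"
  shows "card U \<le> card ((\<lambda>u. map_tc (word_perm n q u) \<psi>) ` U) * card (stabilizer U \<psi>)"
proof -
  note D = gr.subgroup_tupleD[OF U]
  let ?f = "\<lambda>u. map_tc (word_perm n q u) \<psi>"
  have finS: "finite (stabilizer U \<psi>)" using fin by (simp add: stabilizer_def)
  have fibre: "card {u \<in> U. ?f u = \<chi>} \<le> card (stabilizer U \<psi>)" if chi: "\<chi> \<in> ?f ` U" for \<chi>
  proof -
    obtain u0 where u0: "u0 \<in> U" "?f u0 = \<chi>" using chi by auto
    let ?g = "\<lambda>u j. inv\<^bsub>perm_grp n G\<^esub> (u0 j) \<otimes>\<^bsub>perm_grp n G\<^esub> u j"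
    have "?g u \<in> stabilizer U \<psi>" if u: "u \<in> U" "?f u = \<chi>" for u
    proof -
      have "?g u \<in> U" using D(3)[OF D(4)[OF u0(1)] u(1)] .
      moreover have "map_tc (word_perm n q (?g u)) \<psi> = \<psi>"
        using map_word_perm_mult[OF D(1)[OF D(4)[OF u0(1)]] D(1)[OF u(1)], of \<psi>]
          map_word_perm_inv[OF D(1)[OF u0(1)] u0(2)] u(2) by simp
      ultimately show ?thesis by (simp add: stabilizer_def)
    qed
    then have "?g ` {u \<in> U. ?f u = \<chi>} \<subseteq> stabilizer U \<psi>" by blast
    moreover have "inj_on ?g {u \<in> U. ?f u = \<chi>}"
    proof (rule inj_onI)
      fix u v assume uv: "u \<in> {u \<in> U. ?f u = \<chi>}" "v \<in> {u \<in> U. ?f u = \<chi>}" "?g u = ?g v"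
      show "u = v"
      proof
        fix j
        have "u j \<in> G" "v j \<in> G" "u0 j \<in> G" using uv u0 tuple_in_G[OF D(1)] by auto
        then have "u0 j \<circ> inv\<^bsub>perm_grp n G\<^esub> (u0 j) = id" using gr.r_inv[of "u0 j"] by simp
        moreover have "inv\<^bsub>perm_grp n G\<^esub> (u0 j) \<circ> u j = inv\<^bsub>perm_grp n G\<^esub> (u0 j) \<circ> v j"
          using fun_cong[OF uv(3), of j] by simp
        ultimately show "u j = v j" by (metis comp_assoc id_comp)
      qed
    qed
    ultimately show ?thesis using finS by (meson card_inj_on_le)
  qed
  have "card U = (\<Sum>\<chi>\<in>?f ` U. card {u \<in> U. ?f u = \<chi>})"
    using fin by (subst card_eq_sum, subst sum.image_gen[of U _ ?f]) auto
  also have "\<dots> \<le> (\<Sum>\<chi>\<in>?f ` U. card (stabilizer U \<psi>))" using fibre by (rule sum_mono)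
  finally show ?thesis by simp
qed

text \<open>Invariance is required only under the current group \<open>U\<close>, since a child is
  invariant only under a subgroup. The clause for depth \<open>0\<close> serves gates with
  \<open>d = 1\<close>, whose children have no bound with exponent
  \<open>1 / (d - 1)\<close>.\<close>

lemma formula_size_bound:
  assumes n2: "2 \<le> n" and ind: "gr.indistinguishability n q P"
    and "P U k M M'" "\<forall>u\<in>U. map_tc (word_perm n q u) \<Phi> = \<Phi>"
    "tc_eval (assignment M) \<Phi> \<noteq> tc_eval (assignment M') \<Phi>"
  shows "(tc_depth \<Phi> = 0 \<longrightarrow> k = 1) \<and> real n powr log 2 (real k) \<le> real (tc_size \<Phi>) \<and>
    (\<forall>d\<ge>1. tc_depth \<Phi> \<le> d \<longrightarrow> real n powr (real d * (real k powr (1 / real d) - 1)) \<le> real (tc_size \<Phi>))"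
  using assms(3-5)
proof (induction \<Phi> arbitrary: U k M M')
  case (TConst c)
  then show ?case by simp
next
  case (TLit v p)
  have basic: "1 \<le> k" "subgroup U (tuple_group (perm_grp n G) (q - 1))" "M \<in> inputs" "M' \<in> inputs"
    by (fact gr.indistinguishabilityD(1-4)[where P = P and U = U and k = k and M = M and M' = M', OF ind TLit.prems(1)])+
  note D = gr.subgroup_tupleD[OF basic(2)]
  have "k = 1"
  proof (rule ccontr)
    assume "k \<noteq> 1"
    then have k2: "2 \<le> k" using basic(1) by simp
    have ne: "assignment M v \<noteq> assignment M' v" using TLit.prems(3) by auto
    obtain i a b where v: "v = (i, a, b)" by (cases v)
    have vv: "v \<in> word_vars n q" using ne by (auto simp: assignment_def)
    then have i: "i \<in> {1..q}" by (simp add: v word_vars_def)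
    have fix_v: "u (i - 1) a = a" "u i b = b" if "u \<in> U" for u
      using TLit.prems(2) that word_perm_eq[OF D(1)[OF that]] vv v by auto
    have pi: "M i permutes {1..n}" "M' i permutes {1..n}"
      by (fact permutes_G[OF tuple_in_G[OF basic(3)]] permutes_G[OF tuple_in_G[OF basic(4)]])+
    have GM: "M i \<in> G" "M' i \<in> G" by (fact tuple_in_G[OF basic(3)] tuple_in_G[OF basic(4)])+
    \<comment> \<open>In the last two cases all of \<open>G\<close> fixes the row or the column
      index of the literal. So do \<open>M i\<close> and \<open>M' i\<close>, and the literal takes
      the same value on both inputs.\<close>
    consider (1) "\<exists>u\<in>U. gr.gauge u M i = M' i" | (2) "G \<subseteq> (\<lambda>u. u i) ` U" | (3) "G \<subseteq> (\<lambda>u. u (i - 1)) ` U"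
      using gr.indistinguishabilityD(5)[where P = P and U = U and k = k and M = M and M' = M', OF ind TLit.prems(1) k2 i] unfolding perm_grp_simps by blast
    then show False
    proof cases
      case 1
      then obtain u where u: "u \<in> U" "gr.gauge u M i = M' i" by auto
      have "assignment (gr.gauge u M) v = assignment M' v" using u(2) by (simp add: assignment_def v)
      moreover have "assignment (gr.gauge u M) v = assignment M v"
        using assignment_gauge[OF D(1)[OF u(1)] basic(3)] word_perm_eq[OF D(1)[OF u(1)]] fix_v[OF u(1)] vv v
        by simp
      ultimately show False using ne by simp
    next
      case 2
      have "g b = b" if gG: "g \<in> G" for g
      proof -
        obtain u where "u \<in> U" "g = u i" using 2 gG by blast
        then show ?thesis using fix_v(2) by simp
      qed
      then have "M i b = b" "M' i b = b" using GM by simp_all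
      then have "M i a = b \<longleftrightarrow> a = b" "M' i a = b \<longleftrightarrow> a = b"
        using injD[OF permutes_inj[OF pi(1)], of a b] injD[OF permutes_inj[OF pi(2)], of a b] by auto
      then show False using ne by (simp add: assignment_def v)
    next
      case 3
      have "g a = a" if gG: "g \<in> G" for g
      proof -
        obtain u where "u \<in> U" "g = u (i - 1)" using 3 gG by blast
        then show ?thesis using fix_v(1) by simp
      qed
      then have "M i a = a" "M' i a = a" using GM by simp_all
      then show False using ne by (simp add: assignment_def v)
    qed
  qed
  then show ?case using n2 by simp
next
  case (TMaj cs)
  have basic: "1 \<le> k" "subgroup U (tuple_group (perm_grp n G) (q - 1))" "M \<in> inputs" "M' \<in> inputs"
    by (fact gr.indistinguishabilityD(1-4)[where P = P and U = U and k = k and M = M and M' = M', OF ind TMaj.prems(1)])+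
  note D = gr.subgroup_tupleD[OF basic(2)]
  have finU: "finite U"
    using finite_subset[OF subgroup.subset[OF basic(2)]] gr.card_tuple_group finite_G by simp
  have U0: "card U > 0" using D(2) finU by (auto simp: card_gt_0_iff)
  have inv: "image_mset (map_tc (word_perm n q u)) cs = cs" if "u \<in> U" for u
    using TMaj.prems(2) that by auto
  define cnt where "cnt = (\<lambda>N. \<Sum>\<psi>\<in>#cs. of_bool (tc_eval (assignment N) \<psi>) :: nat)"
  \<comment> \<open>Each \<open>u\<close> in \<open>U\<close> permutes the multiset of children, so
    the number of true children may be averaged over \<open>U\<close>. If the numbers for two inputs
    differ, so does the contribution of some child.\<close>
  have cnt: "card U * cnt N = (\<Sum>\<psi>\<in>#cs. card {u \<in> U. tc_eval (assignment (gr.gauge u N)) \<psi>})" if N: "N \<in> inputs" for N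
  proof -
    have "cnt N = (\<Sum>\<psi>\<in>#cs. of_bool (tc_eval (assignment (gr.gauge u N)) \<psi>))" if u: "u \<in> U" for u
    proof -
      have "cnt N = (\<Sum>\<psi>\<in>#image_mset (map_tc (word_perm n q u)) cs. of_bool (tc_eval (assignment N) \<psi>))"
        unfolding cnt_def inv[OF u] ..
      then show ?thesis using eval_map_gauge[OF D(1)[OF u] N] by (simp add: multiset.map_comp comp_def)
    qed
    then have "(\<Sum>u\<in>U. cnt N) = (\<Sum>u\<in>U. \<Sum>\<psi>\<in>#cs. of_bool (tc_eval (assignment (gr.gauge u N)) \<psi>))"
      by (intro sum.cong) auto
    then have "card U * cnt N = (\<Sum>u\<in>U. \<Sum>\<psi>\<in>#cs. of_bool (tc_eval (assignment (gr.gauge u N)) \<psi>))"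
      by simp
    also have "\<dots> = (\<Sum>\<psi>\<in>#cs. \<Sum>u\<in>U. of_bool (tc_eval (assignment (gr.gauge u N)) \<psi>))"
      by (induction cs) (simp_all add: sum.distrib)
    also have "\<dots> = (\<Sum>\<psi>\<in>#cs. card {u \<in> U. tc_eval (assignment (gr.gauge u N)) \<psi>})"
      using finU by (simp add: sum.If_cases of_bool_def Int_def)
    finally show ?thesis .
  qed
  have "cnt M \<noteq> cnt M'" using TMaj.prems(3) by (auto simp: size_filter_sum cnt_def)
  then have "card U * cnt M \<noteq> card U * cnt M'" using U0 by simp
  then have "\<exists>\<psi>\<in>#cs. card {u \<in> U. tc_eval (assignment (gr.gauge u M)) \<psi>} \<noteq> card {u \<in> U. tc_eval (assignment (gr.gauge u M')) \<psi>}"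
    unfolding cnt[OF basic(3)] cnt[OF basic(4)] by (metis (mono_tags, lifting) image_mset_cong)
  then obtain \<psi> where \<psi>: "\<psi> \<in># cs"
    "card {u \<in> U. tc_eval (assignment (gr.gauge u M)) \<psi>} \<noteq> card {u \<in> U. tc_eval (assignment (gr.gauge u M')) \<psi>}"
    by auto
  define H where "H = stabilizer U \<psi>"
  have subH: "subgroup H (tuple_group (perm_grp n G) (q - 1))" unfolding H_def by (rule subgroup_stabilizer[OF basic(2)])
  have HU: "H \<subseteq> U" by (auto simp: H_def stabilizer_def)
  obtain t k' U' N N' where s: "U' \<subseteq> H" "card H * n ^ t \<le> card U" "k \<le> (t + 1) * k'"
    "P U' k' N N'" "tc_eval (assignment N) \<psi> \<noteq> tc_eval (assignment N') \<psi>"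
    using gr.indistinguishabilityD(6)[where P = P and U = U and k = k and M = M and M' = M', OF ind TMaj.prems(1), of "\<lambda>N. tc_eval (assignment N) \<psi>", OF \<psi>(2) subH HU]
    by blast
  have "\<forall>u\<in>U'. map_tc (word_perm n q u) \<psi> = \<psi>" using s(1) by (auto simp: H_def stabilizer_def)
  note ih = TMaj.IH[OF \<psi>(1) s(4) this s(5)]
  have k': "1 \<le> k'" using gr.indistinguishabilityD(1)[where P = P and U = U' and k = k' and M = N and M' = N', OF ind s(4)] .
  \<comment> \<open>The translates of the child are distinct children of equal size; their number is
    at least the index of the stabilizer, hence at least \<open>n ^ t\<close>.\<close>
  define Orb where "Orb = (\<lambda>u. map_tc (word_perm n q u) \<psi>) ` U"
  have "Orb \<subseteq> set_mset cs"
  proof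
    fix x assume "x \<in> Orb"
    then obtain u where u: "u \<in> U" "x = map_tc (word_perm n q u) \<psi>" by (auto simp: Orb_def)
    have "x \<in># image_mset (map_tc (word_perm n q u)) cs" using u(2) \<psi>(1) by auto
    then show "x \<in># cs" using inv[OF u(1)] by simp
  qed
  then have "sum tc_size Orb \<le> tc_size (TMaj cs)" using sum_mset_ge_sum[of Orb cs tc_size] by simp
  moreover have "sum tc_size Orb = card Orb * tc_size \<psi>"
    using sum_constant[of "tc_size \<psi>" Orb] by (subst sum.cong[of Orb Orb _ "\<lambda>_. tc_size \<psi>"]) (auto simp: Orb_def tc_size_map)
  moreover have "n ^ t \<le> card Orb"
  proof -
    have "card H * n ^ t \<le> card H * card Orb"
      using le_trans[OF s(2) card_orbit_stabilizer[OF basic(2) finU, of \<psi>]]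
      unfolding H_def Orb_def by (simp only: mult.commute)
    moreover have "card H > 0"
      using gr.subgroup_tupleD(2)[OF subH] finite_subset[OF HU finU] by (auto simp: card_gt_0_iff)
    ultimately show ?thesis by simp
  qed
  ultimately have "n ^ t * tc_size \<psi> \<le> tc_size (TMaj cs)" by (metis le_trans mult_le_mono1)
  then have size: "real n ^ t * real (tc_size \<psi>) \<le> real (tc_size (TMaj cs))"
    by (metis of_nat_le_iff of_nat_mult of_nat_power)
  have nt: "0 \<le> real n ^ t" by simp
  show ?case
  proof (intro conjI allI impI)
    show "k = 1" if "tc_depth (TMaj cs) = 0" using that by simp
    have "real n powr log 2 (real k) \<le> real n ^ t * real n powr log 2 (real k')"
      using log_bound_step[OF n2 basic(1) k' s(3)] .
    also have "\<dots> \<le> real n ^ t * real (tc_size \<psi>)" using ih nt by (intro mult_left_mono) auto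
    finally show "real n powr log 2 (real k) \<le> real (tc_size (TMaj cs))" using size by linarith
    fix d :: nat assume d: "1 \<le> d" "tc_depth (TMaj cs) \<le> d"
    show "real n powr (real d * (real k powr (1 / real d) - 1)) \<le> real (tc_size (TMaj cs))"
    proof (cases "d = 1")
      case True
      \<comment> \<open>Here the child is a leaf, so \<open>k' = 1\<close> and
        \<open>k - 1 <= t\<close>. The unrestricted bound at \<open>k' = 1\<close> says that this
        leaf has size at least \<open>1\<close>.\<close>
      then have "tc_depth \<psi> = 0" using tc_depth_child[OF \<psi>(1)] d(2) by simp
      then have k1: "k' = 1" using ih by blast
      then have "real k \<le> real t + 1" using s(3) by (metis mult.right_neutral of_nat_1 of_nat_add of_nat_le_iff)
      then have "real n powr (real d * (real k powr (1 / real d) - 1)) \<le> real n powr real t"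
        using True n2 basic(1) by (intro powr_mono) auto
      also have "\<dots> = real n ^ t * 1" using n2 by (simp add: powr_realpow)
      also have "\<dots> \<le> real n ^ t * real (tc_size \<psi>)"
        using ih k1 nt n2 by (intro mult_left_mono) auto
      finally show ?thesis using size by linarith
    next
      case False
      define d' where "d' = d - 1"
      have d': "1 \<le> d'" "d = d' + 1" using False d(1) by (auto simp: d'_def)
      have "tc_depth \<psi> \<le> d'" using tc_depth_child[OF \<psi>(1)] d(2) d'(2) by linarith
      then have "real n powr (real d' * (real k' powr (1 / real d') - 1)) \<le> real (tc_size \<psi>)" using ih d'(1) by blast
      then have "real n ^ t * real n powr (real d' * (real k' powr (1 / real d') - 1)) \<le> real n ^ t * real (tc_size \<psi>)"
        using nt by (rule mult_left_mono)
      then show ?thesis using depth_bound_step[OF n2 basic(1) k' s(3) d'(1)] size unfolding d'(2) by linarith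
    qed
  qed
qed

text \<open>The matrix of \<open>g\<close> has its ones at the positions \<open>(a, g a)\<close>, so
  the first matrix of a product acts first; this is the order of composition in
  \<open>prefix_perm\<close>.\<close>

lemma mat_prefix_assignment:
  assumes M: "M \<in> inputs" and "j \<le> q" "a \<in> {1..n}" "c \<in> {1..n}"
  shows "mat_prefix n (assignment M) j a c = of_bool (prefix_perm M j a = c)"
  using assms(2-4)
proof (induction j arbitrary: c)
  case 0
  then show ?case by simp
next
  case (Suc j)
  define f where "f = prefix_perm M j"
  have perm: "prefix_perm M i permutes {1..n}" for i
  proof (induction i)
    case 0 show ?case unfolding prefix_perm.simps by (rule permutes_id)
  next
    case (Suc i)
    show ?case unfolding prefix_perm.simps by (rule permutes_compose[OF Suc permutes_G[OF tuple_in_G[OF M]]])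
  qed
  have fa: "f a \<in> {1..n}" using permutes_in_image[OF perm] Suc.prems(2) unfolding f_def by blast
  have "mat_prefix n (assignment M) (Suc j) a c
      = (\<Sum>b\<in>{1..n}. of_bool (f a = b) * mat_of (assignment M) (Suc j) b c)"
    using Suc by (simp add: f_def)
  also have "\<dots> = (\<Sum>b\<in>{1..n}. if b = f a then mat_of (assignment M) (Suc j) b c else 0)"
    by (intro sum.cong) auto
  also have "\<dots> = mat_of (assignment M) (Suc j) (f a) c" using fa by (simp only: sum.delta finite_atLeastAtMost if_True)
  also have "\<dots> = of_bool (M (Suc j) (f a) = c)"
    using fa Suc.prems by (auto simp: mat_of_def assignment_def word_vars_def)
  finally show ?case by (simp add: f_def)
qed

lemma assignment_in_domain:
  assumes "M \<in> inputs"
  shows "assignment M \<in> word_domain n G q"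
proof -
  have 1: "\<exists>g\<in>G. \<forall>a\<in>{1..n}. \<forall>b\<in>{1..n}. assignment M (i, a, b) = perm_matrix n g a b" if "i \<in> {1..q}" for i
    using that tuple_in_G[OF assms, of i]
    by (intro bexI[of _ "M i"]) (auto simp: assignment_def word_vars_def perm_matrix_def)
  have 2: "assignment M v = False" if "v \<notin> word_vars n q" for v using that by (simp add: assignment_def)
  show ?thesis unfolding word_domain_def
  proof (intro CollectI conjI ballI allI impI)
    fix i assume "i \<in> {1..q}"
    then show "\<exists>g\<in>G. \<forall>a\<in>{1..n}. \<forall>b\<in>{1..n}. assignment M (i, a, b) = perm_matrix n g a b" by (rule 1)
  qed (rule 2)
qed

end

text \<open>The action on the left cosets of \<open>L\<close> is nontrivial because \<open>L\<close>
  is proper, hence faithful by simplicity. Numbering the cosets gives a faithful permutation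
  representation whose degree is the index of \<open>L\<close>.\<close>

lemma (in simple_group) index_ge_min_degree:
  assumes fin: "finite (carrier G)" and L: "subgroup L G" "L \<noteq> carrier G"
    and min: "\<And>m h. h \<in> hom G (sym_group m) \<Longrightarrow> inj_on h (carrier G) \<Longrightarrow> n \<le> m"
  shows "card L * n \<le> card (carrier G)"
proof -
  define C where "C = lcosets L"
  define r where "r = card C"
  have Lsub: "L \<subseteq> carrier G" using subgroup.subset[OF L(1)] .
  have CL: "c \<in> C \<longleftrightarrow> (\<exists>a\<in>carrier G. c = a <# L)" for c by (auto simp: C_def LCOSETS_def)
  have "C = (\<lambda>a. a <# L) ` carrier G" using CL by auto
  then have finC: "finite C" using fin by simp
  obtain \<psi> where \<psi>: "bij_betw \<psi> {1..r} C" using ex_bij_betw_nat_finite_1[OF finC] by (auto simp: r_def)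
  define \<phi> where "\<phi> = inv_into {1..r} \<psi>"
  have \<phi>: "bij_betw \<phi> C {1..r}" unfolding \<phi>_def using bij_betw_inv_into[OF \<psi>] .
  have \<psi>C: "\<psi> x \<in> C" if "x \<in> {1..r}" for x using bij_betwE[OF \<psi>] that by blast
  have \<phi>r: "\<phi> c \<in> {1..r}" if "c \<in> C" for c using bij_betwE[OF \<phi>] that by blast
  have \<phi>\<psi>: "\<phi> (\<psi> x) = x" if "x \<in> {1..r}" for x
    unfolding \<phi>_def using bij_betw_inv_into_left[OF \<psi> that] .
  have \<psi>\<phi>: "\<psi> (\<phi> c) = c" if "c \<in> C" for c
    unfolding \<phi>_def using bij_betw_inv_into_right[OF \<psi> that] .
  have act: "g <# c \<in> C" if gc: "g \<in> carrier G" "c \<in> C" for g c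
  proof -
    obtain a where a: "a \<in> carrier G" "c = a <# L" using gc(2) CL by auto
    have "g <# c = (g \<otimes> a) <# L" unfolding a(2) using lcos_m_assoc[OF Lsub gc(1) a(1)] .
    then show ?thesis using CL gc(1) a(1) by auto
  qed
  have Csub: "c \<subseteq> carrier G" if "c \<in> C" for c
    using that CL l_coset_subset_G[OF Lsub] by auto
  have act_mult: "g <# (h <# c) = (g \<otimes> h) <# c" if "g \<in> carrier G" "h \<in> carrier G" "c \<in> C" for g h c
    using lcos_m_assoc[OF Csub[OF that(3)] that(1,2)] .
  have act_one: "\<one> <# c = c" if "c \<in> C" for c using lcos_mult_one[OF Csub[OF that]] .
  define \<rho> where "\<rho> = (\<lambda>g x. if x \<in> {1..r} then \<phi> (g <# \<psi> x) else x)"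
  have \<rho>in: "\<rho> g x \<in> {1..r}" if "g \<in> carrier G" "x \<in> {1..r}" for g x
    using \<phi>r[OF act[OF that(1) \<psi>C[OF that(2)]]] that(2) by (simp add: \<rho>_def)
  have \<rho>mult: "\<rho> (g \<otimes> h) = \<rho> g \<circ> \<rho> h" if gh: "g \<in> carrier G" "h \<in> carrier G" for g h
  proof
    fix x
    show "\<rho> (g \<otimes> h) x = (\<rho> g \<circ> \<rho> h) x"
    proof (cases "x \<in> {1..r}")
      case True
      have "\<rho> g (\<rho> h x) = \<phi> (g <# \<psi> (\<rho> h x))" using \<rho>in[OF gh(2) True] by (simp add: \<rho>_def)
      also have "\<psi> (\<rho> h x) = h <# \<psi> x" using \<psi>\<phi>[OF act[OF gh(2) \<psi>C[OF True]]] True by (simp add: \<rho>_def)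
      also have "g <# (h <# \<psi> x) = (g \<otimes> h) <# \<psi> x" using act_mult[OF gh \<psi>C[OF True]] .
      finally show ?thesis using True by (simp add: \<rho>_def)
    next
      case False then show ?thesis by (auto simp: \<rho>_def)
    qed
  qed
  have \<rho>one: "\<rho> \<one> = id"
  proof
    fix x show "\<rho> \<one> x = id x"
      using act_one[OF \<psi>C[of x]] \<phi>\<psi>[of x] by (simp add: \<rho>_def)
  qed
  have \<rho>perm: "\<rho> g permutes {1..r}" if g: "g \<in> carrier G" for g
  proof (rule bij_imp_permutes)
    have i: "\<rho> (inv g) \<circ> \<rho> g = id" "\<rho> g \<circ> \<rho> (inv g) = id"
      using \<rho>mult[of "inv g" g] \<rho>mult[of g "inv g"] g \<rho>one by auto
    show "bij_betw (\<rho> g) {1..r} {1..r}"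
      by (rule bij_betw_byWitness[where f' = "\<rho> (inv g)"])
         (use i \<rho>in[OF g] \<rho>in[of "inv g"] g in \<open>auto simp: fun_eq_iff image_subset_iff\<close>)
    show "\<rho> g x = x" if "x \<notin> {1..r}" for x using that by (auto simp: \<rho>_def)
  qed
  have hom: "\<rho> \<in> hom G (sym_group r)"
    by (rule homI) (simp_all only: sym_group_carrier sym_group_mult \<rho>perm \<rho>mult)
  interpret h: group_hom G "sym_group r" \<rho>
    using hom sym_group_is_group by (simp add: group_hom_def group_hom_axioms_def is_group)
  have "kernel G (sym_group r) \<rho> \<noteq> carrier G"
  proof
    assume k: "kernel G (sym_group r) \<rho> = carrier G"
    have LC: "L \<in> C" using CL lcos_mult_one[OF Lsub] one_closed by metis
    have "g \<in> L" if g: "g \<in> carrier G" for g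
    proof -
      have "\<rho> g = id" using k g by (auto simp: kernel_def sym_group_def)
      then have "\<rho> g (\<phi> L) = \<phi> L" by simp
      then have "\<phi> (g <# \<psi> (\<phi> L)) = \<phi> L" using \<phi>r[OF LC] by (simp add: \<rho>_def)
      then have "\<phi> (g <# L) = \<phi> L" using \<psi>\<phi>[OF LC] by simp
      then have "g <# L = L" using act[OF g LC] LC \<psi>\<phi> by metis
      then show ?thesis using lcos_self[OF g L(1)] by simp
    qed
    then show False using L(2) Lsub by auto
  qed
  then have "kernel G (sym_group r) \<rho> = {\<one>}" using no_real_normal_subgroup[OF h.normal_kernel] by auto
  then have "inj_on \<rho> (carrier G)" using h.inj_iff_trivial_ker by simp
  then have "n \<le> r" using min[OF hom] by simp
  moreover have "r * card L = card (carrier G)" using l_lagrange[OF fin L(1)] by (simp add: r_def C_def order_def)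
  ultimately show ?thesis by (metis mult.commute mult_le_mono2)
qed

section \<open>A separated pair of inputs and the resulting bounds\<close>

context word_problem
begin

lemma degree_ge_2:
  assumes "simple_group (perm_grp n G)"
  shows "2 \<le> n"
proof (rule ccontr)
  assume "\<not> 2 \<le> n"
  then have "n = 0 \<or> n = 1" by auto
  then have "g = id" if "g \<in> G" for g using permutes_G[OF that] by auto
  then have "card G \<le> 1" using card_mono[of "{id}" G] by auto
  then show False using simple_group.order_gt_one[OF assms] by (simp add: order_def)
qed

text \<open>If all of \<open>G\<close> fixed the point \<open>1\<close>, conjugation by the
  transposition of \<open>1\<close> and \<open>n\<close> would make \<open>n\<close> the fixed point
  and embed \<open>G\<close> in degree \<open>n - 1\<close>. A moved point \<open>1\<close> is what
  keeps the word function from being constant.\<close>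

lemma point_one_moved:
  assumes "simple_group (perm_grp n G)" "min_faithful_degree n G"
  shows "\<exists>g\<in>G. g 1 \<noteq> 1"
proof (rule ccontr)
  assume "\<not> ?thesis"
  then have fix1: "\<And>g. g \<in> G \<Longrightarrow> g 1 = 1" by auto
  have n: "2 \<le> n" using degree_ge_2[OF assms(1)] .
  define \<tau> where "\<tau> = transpose 1 n"
  have \<tau>: "\<tau> permutes {1..n}" unfolding \<tau>_def using n by (intro permutes_swap_id) auto
  have \<tau>\<tau>: "\<tau> \<circ> \<tau> = id" by (simp add: \<tau>_def)
  define h where "h = (\<lambda>g. \<tau> \<circ> g \<circ> \<tau>)"
  have "h \<in> hom (perm_grp n G) (sym_group (n - 1))"
  proof (rule homI)
    fix g assume "g \<in> carrier (perm_grp n G)"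
    then have g: "g \<in> G" by simp
    have "h g permutes {1..n}" unfolding h_def
      using permutes_compose[OF \<tau> permutes_compose[OF permutes_G[OF g] \<tau>]] by (simp add: comp_assoc)
    moreover have "h g x = x" if "x \<in> {1..n} - {1..n - 1}" for x
    proof -
      have "x = n" using that by auto
      then show ?thesis using fix1[OF g] by (simp add: h_def \<tau>_def)
    qed
    ultimately have "h g permutes {1..n - 1}" by (rule permutes_superset)
    then show "h g \<in> carrier (sym_group (n - 1))" by (simp add: sym_group_carrier)
  next
    fix g g' assume "g \<in> carrier (perm_grp n G)" "g' \<in> carrier (perm_grp n G)"
    show "h (g \<otimes>\<^bsub>perm_grp n G\<^esub> g') = h g \<otimes>\<^bsub>sym_group (n - 1)\<^esub> h g'"
      using \<tau>\<tau> by (simp add: h_def sym_group_mult) (metis comp_assoc comp_id)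
  qed
  moreover have "inj_on h G"
  proof (rule inj_onI)
    fix g g' assume "h g = h g'"
    then have "\<tau> \<circ> h g \<circ> \<tau> = \<tau> \<circ> h g' \<circ> \<tau>" by simp
    moreover have "\<tau> \<circ> h x \<circ> \<tau> = x" for x
      unfolding h_def using \<tau>\<tau> by (metis comp_assoc comp_id id_comp)
    ultimately show "g = g'" by simp
  qed
  ultimately have "n \<le> n - 1" using assms(2) unfolding min_faithful_degree_def by blast
  then show False using n by simp
qed

lemma index_bounded:
  assumes "simple_group (perm_grp n G)" "min_faithful_degree n G"
  shows "index_bounded_group (perm_grp n G) n"
proof -
  interpret s: simple_group "perm_grp n G" by fact
  show ?thesis
  proof (unfold_locales)
    show "2 \<le> n" using degree_ge_2[OF assms(1)] .
    show "finite (carrier (perm_grp n G))" using finite_G by simp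
    fix L assume L: "subgroup L (perm_grp n G)" "L \<noteq> carrier (perm_grp n G)"
    show "card L * n \<le> card (carrier (perm_grp n G))"
    proof (rule s.index_ge_min_degree[OF _ L])
      fix m h assume "h \<in> hom (perm_grp n G) (sym_group m)" "inj_on h (carrier (perm_grp n G))"
      then show "n \<le> m" using assms(2) unfolding min_faithful_degree_def perm_grp_simps by blast
    qed (use finite_G in simp)
  qed
qed

lemma initial_state:
  assumes sim: "simple_group (perm_grp n G)" and deg: "min_faithful_degree n G"
    and M: "M \<in> inputs" "M' \<in> inputs" and eq: "\<And>i. i \<noteq> 1 \<Longrightarrow> M i = M' i"
  shows "\<exists>P. gr.indistinguishability n q P \<and> P gauges q M M'"
proof (cases "\<forall>x\<in>G. \<forall>y\<in>G. x \<circ> y = y \<circ> x")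
  case True
  then interpret A: abelian_simple_group "perm_grp n G" n
    using index_bounded[OF sim deg] sim
    by (simp add: abelian_simple_group_def abelian_simple_group_axioms_def)
  show ?thesis using A.indistinguishability_blind_state A.blind_state_initial[OF q M eq] by blast
next
  case False
  then interpret A: nonabelian_simple_group "perm_grp n G" n
    using index_bounded[OF sim deg] sim
    by (simp add: nonabelian_simple_group_def nonabelian_simple_group_axioms_def)
  show ?thesis using A.indistinguishability_diag_state A.diag_state_initial[OF q M eq] by blast
qed

lemma word_fun_assignment:
  assumes "M \<in> inputs" "1 \<le> n"
  shows "word_fun n q (assignment M) \<longleftrightarrow> prefix_perm M q 1 = 1"
  using mat_prefix_assignment[OF assms(1), of q 1 1] assms(2) by (simp add: word_fun_def)

lemma invariant_formula_bound:
  assumes sim: "simple_group (perm_grp n G)" and deg: "min_faithful_degree n G"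
    and inv: "tc_invariant (word_group n G q) \<Phi>"
    and comp: "tc_computes \<Phi> (word_domain n G q) (word_fun n q)"
  shows "real n powr log 2 (real q) \<le> real (tc_size \<Phi>)"
    and "1 \<le> d \<Longrightarrow> tc_depth \<Phi> \<le> d \<Longrightarrow> real n powr (real d * (real q powr (1 / real d) - 1)) \<le> real (tc_size \<Phi>)"
proof -
  have n2: "2 \<le> n" using degree_ge_2[OF sim] .
  obtain g where g: "g \<in> G" "g 1 \<noteq> 1" using point_one_moved[OF sim deg] by auto
  have idG: "id \<in> G" using gr.one_closed by simp
  \<comment> \<open>All factors trivial against a single factor \<open>g\<close> at the first edge:
    the products are the identity and \<open>g\<close>, told apart by the image of
    \<open>1\<close>.\<close>
  define M where "M = (\<lambda>j::nat. id :: nat \<Rightarrow> nat)"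
  define M' where "M' = M(1 := g)"
  have M: "M \<in> inputs" "M' \<in> inputs"
    using idG g(1) q by (auto simp: gr.mem_tuple_group M_def M'_def)
  have "prefix_perm M j = id" for j by (induction j) (auto simp: M_def)
  then have "word_fun n q (assignment M)" using word_fun_assignment[OF M(1)] n2 by simp
  moreover have "1 \<le> j \<Longrightarrow> prefix_perm M' j = g" for j
    by (induction j rule: dec_induct) (auto simp: M'_def M_def)
  then have "\<not> word_fun n q (assignment M')" using word_fun_assignment[OF M(2)] n2 g(2) q by simp
  ultimately have ne: "tc_eval (assignment M) \<Phi> \<noteq> tc_eval (assignment M') \<Phi>"
    using comp assignment_in_domain M unfolding tc_computes_def by metis
  obtain P where P: "gr.indistinguishability n q P" "P gauges q M M'"
    using initial_state[OF sim deg M] by (auto simp: M'_def)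
  have "\<forall>u\<in>gauges. map_tc (word_perm n q u) \<Phi> = \<Phi>"
  proof
    fix u assume "u \<in> gauges"
    then have "word_perm n q u \<in> word_group n G q" using tuple_in_G unfolding word_group_def by blast
    then show "map_tc (word_perm n q u) \<Phi> = \<Phi>" using inv by (simp add: tc_invariant_def)
  qed
  note b = formula_size_bound[OF n2 P this ne]
  show "real n powr log 2 (real q) \<le> real (tc_size \<Phi>)" using b by blast
  show "1 \<le> d \<Longrightarrow> tc_depth \<Phi> \<le> d \<Longrightarrow> real n powr (real d * (real q powr (1 / real d) - 1)) \<le> real (tc_size \<Phi>)"
    using b by blast
qed

end

theorem theorem1p3:
  fixes n k d :: nat and G :: "(nat \<Rightarrow> nat) set"
  assumes "subgroup G (sym_group n)"
    and "simple_group (perm_grp n G)"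
    and "min_faithful_degree n G"
    and "k \<ge> 1" and "d \<ge> 1"
  shows "(\<forall>\<Phi> :: (nat \<times> nat \<times> nat) tc.
            set_tc \<Phi> \<subseteq> word_vars n k \<and> tc_invariant (word_group n G k) \<Phi>
            \<and> tc_computes \<Phi> (word_domain n G k) (word_fun n k)
            \<longrightarrow> real (tc_size \<Phi>) \<ge> real n powr log 2 (real k))
       \<and> (\<forall>\<Phi> :: (nat \<times> nat \<times> nat) tc.
            set_tc \<Phi> \<subseteq> word_vars n k \<and> tc_invariant (word_group n G k) \<Phi>
            \<and> tc_depth \<Phi> \<le> d
            \<and> tc_computes \<Phi> (word_domain n G k) (word_fun n k)
            \<longrightarrow> real (tc_size \<Phi>) \<ge> real n powr (real d * (real k powr (1 / real d) - 1)))"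
proof -
  interpret word_problem n k G using assms(1,4) by (simp add: word_problem_def)
  show ?thesis using invariant_formula_bound[OF assms(2,3)] assms(5) by blast
qed

end
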